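(* Let $\mathbb{F}\in\{\mathbb{R},\mathbb{C}\}$, and set $\alpha=1$ if $\mathbb{F}=\mathbb{R}$ and $\alpha=0$ if $\mathbb{F}=\mathbb{C}$. Let $r,k,n$ be integers with $1\le r<k\le n$. Let $A\in\mathbb{F}^{n\times n}$ be a (deterministic) positive-semidefinite matrix. Draw a random test matrix $\Omega\in\mathbb{F}^{n\times k}$ from either the Gaussian or the orthonormal distribution, form the sketch $Y=A\Omega$, and let $$\hat A^{\mathrm{nys}}=Y(\Omega^*Y)^{\dagger}Y^*,\qquad \hat A_r=[\![\hat A^{\mathrm{nys}}]\!]_r .$$ Then $$\mathbb{E}\,\|A-\hat A_r\|_1\le\|A-[\![A]\!]_r\|_1+2\min_{\varrho<k-\alpha}\left[\left(1+\frac{\varrho}{k-\varrho-\alpha}\right)\cdot\|A-[\![A]\!]_\varrho\|_1\right]$$ and $$\mathbb{E}\,\|A-\hat A_r\|_\infty\le\|A-[\![A]\!]_r\|_\infty+2\min_{\varrho<k-\alpha}\left[\left(1+\frac{\varrho}{k-\varrho-\alpha}\right)\cdot\|A-[\![A]\!]_\varrho\|_1\right],$$ where in both minima the index $\varrho$ ranges over the natural numbers satisfying $\varrho<k-\alpha$.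
   Context: Notation: ${}^*$ is the (conjugate) transpose and ${}^\dagger$ is the Moore--Penrose pseudoinverse. A positive-semidefinite (psd) matrix is (conjugate) symmetric with nonnegative eigenvalues. For $p\in[1,\infty]$, the Schatten $p$-norm $\|\cdot\|_p$ is the $\ell_p$ norm of the singular values of a matrix (so $\|\cdot\|_\infty$ is the spectral norm and $\|\cdot\|_1$ is the trace/nuclear norm). "Rank-$r$" means rank at most $r$. For a matrix $M$, $[\![M]\!]_r$ denotes a simultaneous best rank-$r$ approximation of $M$ with respect to all Schatten $p$-norms; it can be taken to be any $r$-truncated singular value decomposition of $M$. Test matrix distributions: (Gaussian) the entries of $\Omega\in\mathbb{F}^{n\times k}$ are independent standard normal variables on $\mathbb{F}$ (for $\mathbb{F}=\mathbb{C}$, of the form $g+\mathrm{i}g'$ with $g,g'$ independent real standard normal). (Orthonormal) draw a matrix $G\in\mathbb{F}^{n\times k}$ whose entries are independent standard normal variables on $\mathbb{F}$ (for $\mathbb{F}=\mathbb{C}$, of the form $g+\mathrm{i}g'$ with $g,g'$ independent real standard normal), compute a thin orthogonal--triangular factorization $G=\Omega R$ with $\Omega\in\mathbb{F}^{n\times k}$ having orthonormal columns and $R\in\mathbb{F}^{k\times k}$ upper triangular, and take $\Omega$ as the test matrix. *)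

theory Defs
  imports
    "HOL-Probability.Probability"
    "Jordan_Normal_Form.Schur_Decomposition"
    "Jordan_Normal_Form.DL_Rank"
begin

text \<open>
  The base field is a set \<open>F\<close> of complex numbers, either \<open>\<real>\<close> or \<open>UNIV\<close>, and a matrix over
  \<open>F\<close> is a complex matrix whose entries all lie in \<open>F\<close>. Adjoint, eigenvalues, singular values,
  rank and pseudoinverse of a real matrix do not change when it is viewed as a complex matrix.
\<close>

definition mats_over :: "complex set \<Rightarrow> nat \<Rightarrow> nat \<Rightarrow> complex mat set" where
  "mats_over F m n = {A \<in> carrier_mat m n. elements_mat A \<subseteq> F}"

definition psd :: "complex mat \<Rightarrow> bool" where
  "psd A \<longleftrightarrow> mat_adjoint A = A \<and> (\<forall>e. eigenvalue A e \<longrightarrow> e \<in> \<real>\<^sub>\<ge>\<^sub>0)"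

text \<open>
  The square roots of the eigenvalues of \<open>A\<^sup>* A\<close> (real and nonnegative), with multiplicity.
  For a wide matrix this adds zeros to the usual list of singular values,
  which does not affect any Schatten norm.
\<close>

definition singular_values :: "complex mat \<Rightarrow> real multiset" where
  "singular_values A =
     image_mset (\<lambda>e. sqrt (Re e)) (proots (char_poly (mat_adjoint A * A)))"

definition schatten_norm :: "ereal \<Rightarrow> complex mat \<Rightarrow> real" where
  "schatten_norm p A =
     (if p = \<infinity> then Max (insert 0 (set_mset (singular_values A)))
      else (\<Sum>s\<in>#singular_values A. s powr real_of_ereal p) powr (1 / real_of_ereal p))"

definition pinv :: "complex mat \<Rightarrow> complex mat" where
  "pinv A = (THE X. X \<in> carrier_mat (dim_col A) (dim_row A) \<and>
     A * X * A = A \<and> X * A * X = X \<and>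
     mat_adjoint (A * X) = A * X \<and> mat_adjoint (X * A) = X * A)"

abbreviation mat_rank :: "complex mat \<Rightarrow> nat" where
  "mat_rank A \<equiv> vec_space.rank (dim_row A) A"

definition best_rank_approx :: "complex set \<Rightarrow> nat \<Rightarrow> complex mat \<Rightarrow> complex mat \<Rightarrow> bool" where
  "best_rank_approx F r A B \<longleftrightarrow>
     B \<in> mats_over F (dim_row A) (dim_col A) \<and> mat_rank B \<le> r \<and>
     (\<forall>p::ereal. 1 \<le> p \<longrightarrow>
       (\<forall>C \<in> mats_over F (dim_row A) (dim_col A). mat_rank C \<le> r \<longrightarrow>
          schatten_norm p (A - B) \<le> schatten_norm p (A - C)))"

text \<open>
  The complex standard normal is \<open>g + \<i> g'\<close> with \<open>g\<close>, \<open>g'\<close> independent real standard normals,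
  so it has variance 2.
\<close>

definition std_normal_over :: "complex set \<Rightarrow> 'w measure \<Rightarrow> ('w \<Rightarrow> complex) \<Rightarrow> bool" where
  "std_normal_over F M X \<longleftrightarrow>
     distributed M lborel (\<lambda>\<omega>. Re (X \<omega>)) std_normal_density \<and>
     (if F = \<real> then \<forall>\<omega> \<in> space M. Im (X \<omega>) = 0
      else distributed M lborel (\<lambda>\<omega>. Im (X \<omega>)) std_normal_density \<and>
           prob_space.indep_var M borel (\<lambda>\<omega>. Re (X \<omega>)) borel (\<lambda>\<omega>. Im (X \<omega>)))"

definition gaussian_test_matrix ::
  "complex set \<Rightarrow> 'w measure \<Rightarrow> nat \<Rightarrow> nat \<Rightarrow> ('w \<Rightarrow> complex mat) \<Rightarrow> bool" where
  "gaussian_test_matrix F M n k \<Omega> \<longleftrightarrow>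
     (\<forall>\<omega> \<in> space M. \<Omega> \<omega> \<in> mats_over F n k) \<and>
     prob_space.indep_vars M (\<lambda>_. borel) (\<lambda>(i, j) \<omega>. \<Omega> \<omega> $$ (i, j)) ({..<n} \<times> {..<k}) \<and>
     (\<forall>i<n. \<forall>j<k. std_normal_over F M (\<lambda>\<omega>. \<Omega> \<omega> $$ (i, j)))"

definition thin_qr ::
  "complex set \<Rightarrow> nat \<Rightarrow> nat \<Rightarrow> complex mat \<Rightarrow> complex mat \<Rightarrow> complex mat \<Rightarrow> bool" where
  "thin_qr F n k G Q R \<longleftrightarrow>
     Q \<in> mats_over F n k \<and> R \<in> mats_over F k k \<and>
     mat_adjoint Q * Q = 1\<^sub>m k \<and> upper_triangular R \<and> G = Q * R"

definition orthonormal_test_matrix ::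
  "complex set \<Rightarrow> 'w measure \<Rightarrow> nat \<Rightarrow> nat \<Rightarrow> ('w \<Rightarrow> complex mat) \<Rightarrow> bool" where
  "orthonormal_test_matrix F M n k \<Omega> \<longleftrightarrow>
     (\<exists>G R. gaussian_test_matrix F M n k G \<and>
            (\<forall>\<omega> \<in> space M. thin_qr F n k (G \<omega>) (\<Omega> \<omega>) (R \<omega>)))"

definition nystrom :: "complex mat \<Rightarrow> complex mat \<Rightarrow> complex mat" where
  "nystrom A \<Omega> =
     (let Y = A * \<Omega> in Y * pinv (mat_adjoint \<Omega> * Y) * mat_adjoint Y)"

end

theory Submission
  imports Defs "Jordan_Normal_Form.Spectral_Radius"
begin

text \<open>
  Factor \<open>A = B\<^sup>* B\<close>. The Nystrom approximation is \<open>B\<^sup>* P B\<close>, where \<open>P\<close> is the orthogonal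
  projector onto the range of \<open>B \<Omega>\<close>, so its error is \<open>B\<^sup>* (1 - P) B\<close>. The trace norm of
  the latter is at most the squared Frobenius norm of \<open>(1 - P) B\<close>, hence of
  \<open>B - B \<Omega> Y\<close> for \<^emph>\<open>every\<close> matrix \<open>Y\<close> (\<open>nystrom_error_le_frob\<close>). The freedom in \<open>Y\<close> is
  used twice. If \<open>G = \<Omega> R\<close> is a thin factorisation, then \<open>Y = R X\<close> turns the bound into one
  for the Gaussian matrix \<open>G\<close>, because all that matters is that the range of \<open>\<Omega>\<close> contains that
  of \<open>G\<close>; so both distributions of the test matrix reduce to the Gaussian one.
  And \<open>X\<close> can be chosen to suit any competitor \<open>C\<close> of rank at most \<open>\<rho>\<close>.

  Given \<open>C\<close>, take an orthonormal basis \<open>v\<close> over \<open>F\<close> whose last \<open>n - \<rho>\<close> vectors are orthogonal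
  to the columns of \<open>C\<close>, and let \<open>W\<close> be the coordinates of the columns of \<open>G\<close> in this basis. Let
  \<open>x\<^sub>c\<close> be vectors dual to the first \<open>\<rho>\<close> rows of \<open>W\<close>. Then \<open>nystrom_error_bound\<close> bounds the error by
  \<open>t + (\<Sum>c<\<rho>. \<parallel>\<Sum>l\<ge>\<rho>. (W x\<^sub>c)\<^sub>l B v\<^sub>l\<parallel>\<^sup>2)\<close>, where \<open>t = (\<Sum>l\<ge>\<rho>. \<parallel>B v\<^sub>l\<parallel>\<^sup>2)\<close>. The
  quadratic form of \<open>C\<close> vanishes at these \<open>v\<^sub>l\<close>, so \<open>t\<close> is a partial trace of \<open>A - C\<close>, and trace
  duality gives \<open>t \<le> \<parallel>A - C\<parallel>\<^sub>1\<close> (\<open>tail_le_schatten_one\<close>).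

  By rotation invariance \<open>W\<close> is Gaussian again. Its rows from \<open>\<rho>\<close> on are independent of the
  dual vectors, so taking the mean over them replaces each summand by \<open>\<beta> t \<parallel>x\<^sub>c\<parallel>\<^sup>2\<close>, where \<open>\<beta>\<close> is
  the real dimension of \<open>F\<close> and also the variance of one entry. The shortest dual vectors
  have \<open>\<parallel>x\<^sub>c\<parallel> = 1 / \<parallel>r\<^sub>c\<parallel>\<close> with \<open>r\<^sub>c\<close> the component of row \<open>c\<close> orthogonal to the other \<open>\<rho> - 1\<close> rows.
  This component contains \<open>m = k - \<rho> + 1\<close> independent Gaussian coordinates, and the inverse
  square norm of these has mean \<open>1 / (\<beta> m - 2)\<close>. As \<open>\<beta> / (\<beta> m - 2) = 1 / (k - \<rho> - \<alpha>)\<close>, the expected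
  trace norm error is at most \<open>(1 + \<rho> / (k - \<rho> - \<alpha>)) \<parallel>A - C\<parallel>\<^sub>1\<close> (\<open>expected_nystrom_error\<close>).

  Truncation costs only the triangle inequality: the best rank-\<open>r\<close> approximation of the Nystrom
  matrix is no further from it than the one of \<open>A\<close>, whence the term for \<open>A\<close> and the factor 2
  (\<open>truncation_error\<close>).
\<close>

section \<open>Orthonormal systems over the base field\<close>

text \<open>
  Vectors are functions on \<open>nat\<close> of which only the entries below the explicit dimension count.
  The dimension varies inside proofs, rows and columns of matrices and slices of a
  random array are vectors without conversion, and measurability is a statement about entries.
\<close>

definition ip :: "nat \<Rightarrow> (nat \<Rightarrow> complex) \<Rightarrow> (nat \<Rightarrow> complex) \<Rightarrow> complex" where
  "ip n x y = (\<Sum>i<n. cnj (x i) * y i)"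

definition nsq :: "nat \<Rightarrow> (nat \<Rightarrow> complex) \<Rightarrow> real" where
  "nsq n x = (\<Sum>i<n. (cmod (x i))\<^sup>2)"

lemma nsq_nonneg [simp]: "0 \<le> nsq n x"
  by (simp add: nsq_def sum_nonneg)

lemma ip_self: "ip n x x = of_real (nsq n x)"
  unfolding ip_def nsq_def of_real_sum
  by (rule sum.cong) (auto simp: complex_norm_square mult.commute simp flip: of_real_power)

lemma cnj_ip: "cnj (ip n x y) = ip n y x"
  by (simp add: ip_def mult.commute)

lemma ip_cong: "(\<And>i. i < n \<Longrightarrow> x i = x' i) \<Longrightarrow> (\<And>i. i < n \<Longrightarrow> y i = y' i) \<Longrightarrow> ip n x y = ip n x' y'"
  by (simp add: ip_def)

lemma nsq_cong: "(\<And>i. i < n \<Longrightarrow> x i = x' i) \<Longrightarrow> nsq n x = nsq n x'"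
  by (simp add: nsq_def)

lemma ip_add: "ip n x (\<lambda>i. y i + z i) = ip n x y + ip n x z"
  by (simp add: ip_def algebra_simps sum.distrib)

lemma ip_diff: "ip n x (\<lambda>i. y i - z i) = ip n x y - ip n x z"
  by (simp add: ip_def algebra_simps sum_subtractf)

lemma ip_scale: "ip n x (\<lambda>i. c * y i) = c * ip n x y"
  by (simp add: ip_def sum_distrib_left mult_ac)

lemma ip_sum: "ip n x (\<lambda>i. \<Sum>l\<in>J. y l i) = (\<Sum>l\<in>J. ip n x (y l))"
  unfolding ip_def sum_distrib_left by (rule sum.swap)

lemma ip_lincomb: "ip n x (\<lambda>i. \<Sum>l\<in>J. c l * y l i) = (\<Sum>l\<in>J. c l * ip n x (y l))"
  by (simp add: ip_sum ip_scale)

lemma ip_lincomb_left: "ip n (\<lambda>i. \<Sum>l\<in>J. c l * y l i) x = (\<Sum>l\<in>J. cnj (c l) * ip n (y l) x)"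
proof -
  have "ip n (\<lambda>i. \<Sum>l\<in>J. c l * y l i) x = cnj (ip n x (\<lambda>i. \<Sum>l\<in>J. c l * y l i))"
    by (simp add: cnj_ip)
  also have "\<dots> = (\<Sum>l\<in>J. cnj (c l) * ip n (y l) x)"
    by (simp add: ip_lincomb cnj_ip)
  finally show ?thesis .
qed

lemma ip_left_diff: "ip n (\<lambda>i. y i - z i) x = ip n y x - ip n z x"
  by (simp add: ip_def algebra_simps sum_subtractf)

lemma ip_left_add: "ip n (\<lambda>i. y i + z i) x = ip n y x + ip n z x"
  by (simp add: ip_def algebra_simps sum.distrib)

lemma ip_left_scale: "ip n (\<lambda>i. c * y i) x = cnj c * ip n y x"
  by (simp add: ip_def sum_distrib_left mult_ac)

lemma nsq_scale: "nsq n (\<lambda>i. c * x i) = (cmod c)\<^sup>2 * nsq n x"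
  by (simp add: nsq_def norm_mult power_mult_distrib sum_distrib_left)

lemma nsq_eq_0_iff: "nsq n x = 0 \<longleftrightarrow> (\<forall>i<n. x i = 0)"
  by (auto simp: nsq_def sum_nonneg_eq_0_iff)

definition orthonormal :: "nat \<Rightarrow> nat set \<Rightarrow> (nat \<Rightarrow> nat \<Rightarrow> complex) \<Rightarrow> bool" where
  "orthonormal n J u \<longleftrightarrow> (\<forall>i\<in>J. \<forall>j\<in>J. ip n (u i) (u j) = (if i = j then 1 else 0))"

lemma orthonormalD: "orthonormal n J u \<Longrightarrow> i \<in> J \<Longrightarrow> j \<in> J \<Longrightarrow> ip n (u i) (u j) = (if i = j then 1 else 0)"
  by (simp add: orthonormal_def)

lemma orthonormal_nsq: "orthonormal n J u \<Longrightarrow> i \<in> J \<Longrightarrow> nsq n (u i) = 1"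
  using orthonormalD[of n J u i i] by (simp add: ip_self)

lemma orthonormal_subset: "orthonormal n J u \<Longrightarrow> K \<subseteq> J \<Longrightarrow> orthonormal n K u"
  by (auto simp: orthonormal_def subset_iff)

text \<open>
  Pythagoras for the projection onto an orthonormal system. Both Bessel's inequality and
  the dimension count that extends a system to a basis come from this identity.
\<close>

lemma nsq_residual:
  assumes "finite J" "orthonormal n J u"
  shows "nsq n (\<lambda>i. x i - (\<Sum>j\<in>J. ip n (u j) x * u j i)) = nsq n x - (\<Sum>j\<in>J. (cmod (ip n (u j) x))\<^sup>2)"
proof -
  let ?p = "\<lambda>i. \<Sum>j\<in>J. ip n (u j) x * u j i"
  have sq: "z * cnj z = of_real ((cmod z)\<^sup>2)" for z
    using complex_norm_square[of z] by simp
  have sq': "ip n (u j) x * ip n x (u j) = of_real ((cmod (ip n (u j) x))\<^sup>2)" for j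
    using sq[of "ip n (u j) x"] by (simp only: cnj_ip)
  have a: "ip n x ?p = of_real (\<Sum>j\<in>J. (cmod (ip n (u j) x))\<^sup>2)"
    unfolding ip_lincomb of_real_sum
    by (rule sum.cong) (simp_all only: sq')
  have b: "ip n ?p x = of_real (\<Sum>j\<in>J. (cmod (ip n (u j) x))\<^sup>2)"
    by (subst cnj_ip[symmetric]) (simp add: a del: of_real_sum of_real_power)
  have c: "ip n (u j) ?p = ip n (u j) x" if "j \<in> J" for j
  proof -
    have "ip n (u j) ?p = (\<Sum>l\<in>J. if j = l then ip n (u l) x else 0)"
      unfolding ip_lincomb by (rule sum.cong) (use assms(2) that in \<open>auto simp: orthonormalD\<close>)
    then show ?thesis using that assms(1) by simp
  qed
  have d: "ip n ?p ?p = of_real (\<Sum>j\<in>J. (cmod (ip n (u j) x))\<^sup>2)"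
    by (simp only: ip_lincomb_left[of n _ _ J] c of_real_sum cnj_ip)
      (rule sum.cong, simp, simp only: c, simp only: sq'[symmetric] mult.commute)
  have "complex_of_real (nsq n (\<lambda>i. x i - ?p i)) = ip n (\<lambda>i. x i - ?p i) (\<lambda>i. x i - ?p i)"
    by (simp add: ip_self)
  also have "\<dots> = of_real (nsq n x - (\<Sum>j\<in>J. (cmod (ip n (u j) x))\<^sup>2))"
    unfolding ip_diff ip_left_diff a b d by (simp add: ip_self)
  finally show ?thesis using of_real_eq_iff by blast
qed

lemma bessel:
  assumes "finite J" "orthonormal n J u"
  shows "(\<Sum>j\<in>J. (cmod (ip n (u j) x))\<^sup>2) \<le> nsq n x"
  using nsq_residual[OF assms, of x] nsq_nonneg[of n "\<lambda>i. x i - (\<Sum>j\<in>J. ip n (u j) x * u j i)"] by linarith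

text \<open>
  Kept folded, so that the simplifier treats \<open>F\<close> uniformly instead of splitting
  into the two cases; the linear algebra uses only closure under the field operations and
  conjugation.
\<close>

definition real_or_complex :: "complex set \<Rightarrow> bool" where
  "real_or_complex F \<longleftrightarrow> F = \<real> \<or> F = UNIV"

lemma real_or_complex_closed:
  assumes "real_or_complex F"
  shows "0 \<in> F" "1 \<in> F" "complex_of_real t \<in> F"
    "x \<in> F \<Longrightarrow> y \<in> F \<Longrightarrow> x + y \<in> F" "x \<in> F \<Longrightarrow> y \<in> F \<Longrightarrow> x - y \<in> F"
    "x \<in> F \<Longrightarrow> y \<in> F \<Longrightarrow> x * y \<in> F" "x \<in> F \<Longrightarrow> cnj x \<in> F"
    "x \<in> F \<Longrightarrow> - x \<in> F"
  using assms by (auto simp: real_or_complex_def Reals_cnj_iff complex_is_Real_iff)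

lemma real_or_complex_sum:
  assumes "real_or_complex F" "\<And>i. i \<in> J \<Longrightarrow> f i \<in> F"
  shows "sum f J \<in> F"
  using assms(2) by (induction J rule: infinite_finite_induct)
    (auto intro!: real_or_complex_closed assms(1))

lemma ip_in_F:
  assumes "real_or_complex F" "\<And>i. i < n \<Longrightarrow> x i \<in> F" "\<And>i. i < n \<Longrightarrow> y i \<in> F"
  shows "ip n x y \<in> F"
  unfolding ip_def by (intro real_or_complex_sum real_or_complex_closed assms; simp)

lemma residual_in_F:
  assumes F: "real_or_complex F" "\<And>j i. j \<in> J \<Longrightarrow> i < n \<Longrightarrow> u j i \<in> F" "\<And>i. i < n \<Longrightarrow> x i \<in> F" "i < n"
  shows "x i - (\<Sum>j\<in>J. ip n (u j) x * u j i) \<in> F"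
  by (intro real_or_complex_closed real_or_complex_sum ip_in_F F; simp)

lemma residual_orth:
  assumes "finite J" "orthonormal n J u" "l \<in> J"
  shows "ip n (u l) (\<lambda>i. x i - (\<Sum>j\<in>J. ip n (u j) x * u j i)) = 0"
proof -
  have "ip n (u l) (\<lambda>i. \<Sum>j\<in>J. ip n (u j) x * u j i) = (\<Sum>j\<in>J. if l = j then ip n (u j) x else 0)"
    unfolding ip_lincomb by (rule sum.cong) (use assms in \<open>auto simp: orthonormalD\<close>)
  then show ?thesis using assms by (simp add: ip_diff)
qed

lemma normalise:
  assumes F: "real_or_complex F" and x: "\<And>i. i < n \<Longrightarrow> x i \<in> F" and nz: "nsq n x \<noteq> 0"
  obtains c where "c \<noteq> 0" "nsq n (\<lambda>i. complex_of_real c * x i) = 1"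
    "\<And>i. i < n \<Longrightarrow> complex_of_real c * x i \<in> F"
proof (rule that[of "1 / sqrt (nsq n x)"])
  show "1 / sqrt (nsq n x) \<noteq> 0" using nz by simp
  show "nsq n (\<lambda>i. complex_of_real (1 / sqrt (nsq n x)) * x i) = 1"
    unfolding nsq_scale using nz by (simp add: norm_divide power_divide)
  show "complex_of_real (1 / sqrt (nsq n x)) * x i \<in> F" if "i < n" for i
    by (intro real_or_complex_closed F x that)
qed

text \<open>
  The squared residuals of the standard basis vectors sum to \<open>n - m > 0\<close>, so one of
  them is nonzero. Unlike an argument about orthogonal complements, this stays inside \<open>F\<close>.
\<close>

lemma exists_unit_orthogonal:
  assumes F: "real_or_complex F" and u: "orthonormal n {..<m} u" and m: "m < n"
    and uF: "\<And>j i. j < m \<Longrightarrow> i < n \<Longrightarrow> u j i \<in> F"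
  shows "\<exists>w. nsq n w = 1 \<and> (\<forall>i<n. w i \<in> F) \<and> (\<forall>j<m. ip n (u j) w = 0)"
proof -
  define e where "e = (\<lambda>k i::nat. if i = k then 1 else 0 :: complex)"
  define r where "r = (\<lambda>k i. e k i - (\<Sum>j<m. ip n (u j) (e k) * u j i))"
  have ue: "ip n (u j) (e k) = cnj (u j k)" if "k < n" for j k
  proof -
    have "ip n (u j) (e k) = (\<Sum>i<n. if i = k then cnj (u j i) else 0)"
      unfolding ip_def e_def by (rule sum.cong) auto
    then show ?thesis using that by simp
  qed
  have ee: "nsq n (e k) = 1" if "k < n" for k
  proof -
    have "nsq n (e k) = (\<Sum>i<n. if i = k then 1 else 0)"
      unfolding nsq_def e_def by (rule sum.cong) auto
    then show ?thesis using that by simp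
  qed
  have "(\<Sum>k<n. nsq n (r k)) = (\<Sum>k<n. 1 - (\<Sum>j<m. (cmod (u j k))\<^sup>2))"
    unfolding r_def nsq_residual[OF finite_lessThan u] by (rule sum.cong) (auto simp: ue ee)
  also have "\<dots> = real n - (\<Sum>k<n. \<Sum>j<m. (cmod (u j k))\<^sup>2)"
    by (simp add: sum_subtractf)
  also have "(\<Sum>k<n. \<Sum>j<m. (cmod (u j k))\<^sup>2) = (\<Sum>j<m. nsq n (u j))"
    unfolding nsq_def by (rule sum.swap)
  also have "\<dots> = real m" using orthonormal_nsq[OF u] by simp
  finally have "(\<Sum>k<n. nsq n (r k)) \<noteq> 0" using m by simp
  then obtain k where k: "k < n" "nsq n (r k) \<noteq> 0"
    by (metis (no_types, lifting) lessThan_iff sum.neutral)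
  have rF: "r k i \<in> F" if "i < n" for i
    unfolding r_def by (rule residual_in_F[OF F])
      (use uF that F in \<open>auto simp: e_def real_or_complex_closed\<close>)
  obtain c where c: "c \<noteq> 0" "nsq n (\<lambda>i. complex_of_real c * r k i) = 1"
    "\<And>i. i < n \<Longrightarrow> complex_of_real c * r k i \<in> F"
    using normalise[of F n "r k"] F rF k by blast
  have "ip n (u j) (r k) = 0" if "j < m" for j
    unfolding r_def by (rule residual_orth) (use u that in auto)
  then show ?thesis
    by (intro exI[of _ "\<lambda>i. complex_of_real c * r k i"]) (use c in \<open>auto simp: ip_scale\<close>)
qed

lemma orthonormal_update:
  assumes "orthonormal n {..<m} u" "nsq n w = 1" "\<And>j. j < m \<Longrightarrow> ip n (u j) w = 0"
  shows "orthonormal n {..<Suc m} (u(m := w))"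
proof -
  have "ip n w (u j) = 0" if "j < m" for j
    using assms(3)[OF that] by (metis cnj_ip complex_cnj_zero)
  then show ?thesis
    using assms orthonormalD[OF assms(1)] unfolding orthonormal_def
    by (simp add: ip_self[of n w] less_Suc_eq lessThan_Suc)
qed

lemma orthonormal_extend:
  assumes F: "real_or_complex F" and u: "orthonormal n {..<m} u" and m: "m \<le> n"
    and uF: "\<And>j i. j < m \<Longrightarrow> i < n \<Longrightarrow> u j i \<in> F"
  shows "\<exists>v. orthonormal n {..<n} v \<and> (\<forall>j<n. \<forall>i<n. v j i \<in> F) \<and> (\<forall>j<m. v j = u j)"
  using m u uF
proof (induction m arbitrary: u rule: inc_induct)
  case base
  then show ?case by blast
next
  case (step m)
  obtain w where w: "nsq n w = 1" "\<forall>i<n. w i \<in> F" "\<forall>j<m. ip n (u j) w = 0"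
    using exists_unit_orthogonal[OF F step.prems(1) \<open>m < n\<close>] step.prems(2) by blast
  have "\<exists>v. orthonormal n {..<n} v \<and> (\<forall>j<n. \<forall>i<n. v j i \<in> F) \<and> (\<forall>j<Suc m. v j = (u(m := w)) j)"
  proof (rule step.IH)
    show "orthonormal n {..<Suc m} (u(m := w))"
      using orthonormal_update step.prems(1) w by blast
    show "(u(m := w)) j i \<in> F" if "j < Suc m" "i < n" for j i
      using that w step.prems(2) by (auto simp: less_Suc_eq)
  qed
  then obtain v where v: "orthonormal n {..<n} v" "\<forall>j<n. \<forall>i<n. v j i \<in> F"
    "\<forall>j<Suc m. v j = (u(m := w)) j" by metis
  have "v j = u j" if "j < m" for j using v(3) that by simp
  then show ?case using v by blast
qed

text \<open>
  The system has exactly \<open>m\<close> members even if the given vectors are dependent: whenever a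
  residual vanishes, any new unit vector is added instead. That the span contains each \<open>S s\<close> is
  stated dually, through the vectors orthogonal to the system.
\<close>

lemma gram_schmidt_span:
  assumes F: "real_or_complex F" and m: "m \<le> n"
    and SF: "\<And>s i. s < m \<Longrightarrow> i < n \<Longrightarrow> S s i \<in> F"
  shows "\<exists>u. orthonormal n {..<m} u \<and> (\<forall>j<m. \<forall>i<n. u j i \<in> F) \<and>
    (\<forall>s<m. \<forall>x. (\<forall>j<m. ip n (u j) x = 0) \<longrightarrow> ip n (S s) x = 0)"
  using m SF
proof (induction m)
  case 0
  then show ?case by (auto simp: orthonormal_def)
next
  case (Suc m)
  then obtain u where u: "orthonormal n {..<m} u" and uF: "\<forall>j<m. \<forall>i<n. u j i \<in> F"
    and us: "\<forall>s<m. \<forall>x. (\<forall>j<m. ip n (u j) x = 0) \<longrightarrow> ip n (S s) x = 0"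
    by fastforce
  define r where "r = (\<lambda>i. S m i - (\<Sum>j<m. ip n (u j) (S m) * u j i))"
  have rF: "r i \<in> F" if "i < n" for i
    unfolding r_def by (rule residual_in_F[OF F]) (use uF that Suc.prems in auto)
  have ro: "ip n (u j) r = 0" if "j < m" for j
    unfolding r_def by (rule residual_orth) (use u that in auto)
  \<comment> \<open>a zero residual is the multiple 0 of any unit vector, so both cases have this form\<close>
  have "\<exists>w c. nsq n w = 1 \<and> (\<forall>i<n. w i \<in> F) \<and> (\<forall>j<m. ip n (u j) w = 0) \<and> (\<forall>i<n. r i = c * w i)"
  proof (cases "nsq n r = 0")
    case True
    have "m < n" using Suc.prems(1) by simp
    then obtain w where "nsq n w = 1" "\<forall>i<n. w i \<in> F" "\<forall>j<m. ip n (u j) w = 0"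
      using exists_unit_orthogonal[OF F u] uF by blast
    then show ?thesis using True
      by (intro exI[of _ w] exI[of _ 0]) (simp add: nsq_eq_0_iff)
  next
    case False
    obtain c where c: "c \<noteq> 0" "nsq n (\<lambda>i. complex_of_real c * r i) = 1"
      "\<And>i. i < n \<Longrightarrow> complex_of_real c * r i \<in> F"
      using normalise[of F n "r"] F rF False by blast
    then show ?thesis
      by (intro exI[of _ "\<lambda>i. complex_of_real c * r i"] exI[of _ "1 / complex_of_real c"])
        (auto simp: ip_scale ro)
  qed
  then obtain w c where w: "nsq n w = 1" "\<forall>i<n. w i \<in> F" "\<forall>j<m. ip n (u j) w = 0"
    and c: "\<forall>i<n. r i = c * w i" by blast
  have Sm: "ip n (S m) x = 0" if "\<forall>j<m. ip n (u j) x = 0" "ip n w x = 0" for x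
  proof -
    have "ip n (S m) x = ip n (\<lambda>i. c * w i + (\<Sum>j<m. ip n (u j) (S m) * u j i)) x"
      by (rule ip_cong) (use c in \<open>auto simp: r_def algebra_simps\<close>)
    also have "\<dots> = 0" unfolding ip_left_add ip_left_scale ip_lincomb_left using that by simp
    finally show ?thesis .
  qed
  show ?case
  proof (intro exI[of _ "u(m := w)"] conjI)
    show "orthonormal n {..<Suc m} (u(m := w))"
      using orthonormal_update u w by blast
    show "\<forall>j<Suc m. \<forall>i<n. (u(m := w)) j i \<in> F" using uF w by (auto simp: less_Suc_eq)
    show "\<forall>s<Suc m. \<forall>x. (\<forall>j<Suc m. ip n ((u(m := w)) j) x = 0) \<longrightarrow> ip n (S s) x = 0"
    proof (intro allI impI)
      fix s x assume s: "s < Suc m" and x: "\<forall>j<Suc m. ip n ((u(m := w)) j) x = 0"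
      have "\<forall>j<m. ip n (u j) x = 0" "ip n w x = 0"
        using x by (metis fun_upd_apply less_Suc_eq nat_neq_iff, metis fun_upd_same lessI)
      then show "ip n (S s) x = 0" using us Sm s by (auto simp: less_Suc_eq)
    qed
  qed
qed

lemma orthonormal_basis_avoiding:
  assumes F: "real_or_complex F" and m: "m \<le> n"
    and SF: "\<And>s i. s < m \<Longrightarrow> i < n \<Longrightarrow> S s i \<in> F"
  shows "\<exists>u. orthonormal n {..<n} u \<and> (\<forall>j<n. \<forall>i<n. u j i \<in> F) \<and>
    (\<forall>s<m. \<forall>j. m \<le> j \<longrightarrow> j < n \<longrightarrow> ip n (S s) (u j) = 0)"
proof -
  obtain u where u: "orthonormal n {..<m} u" and uF: "\<forall>j<m. \<forall>i<n. u j i \<in> F"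
    and us: "\<forall>s<m. \<forall>x. (\<forall>j<m. ip n (u j) x = 0) \<longrightarrow> ip n (S s) x = 0"
    using gram_schmidt_span[where S=S, OF F m] SF by blast
  obtain v where v: "orthonormal n {..<n} v" "\<forall>j<n. \<forall>i<n. v j i \<in> F" "\<forall>j<m. v j = u j"
    using orthonormal_extend[OF F u m] uF by blast
  have "ip n (u i) (v j) = 0" if "m \<le> j" "j < n" "i < m" for i j
    using orthonormalD[OF v(1), of i j] v(3) that by auto
  then show ?thesis using v us by blast
qed

text \<open>
  A square matrix with a left inverse has the same matrix as right inverse; this is where
  orthonormality of \<open>n\<close> vectors in dimension \<open>n\<close> turns into completeness.
\<close>

lemma orthonormal_unitary:
  assumes u: "orthonormal n {..<n} u"
  defines "U \<equiv> mat n n (\<lambda>(j, i). cnj (u j i))" and "W \<equiv> mat n n (\<lambda>(i, j). u j i)"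
  shows "U * W = 1\<^sub>m n" "W * U = 1\<^sub>m n"
proof -
  show UW: "U * W = 1\<^sub>m n"
  proof (rule eq_matI)
    fix i j assume ij: "i < dim_row (1\<^sub>m n :: complex mat)" "j < dim_col (1\<^sub>m n :: complex mat)"
    then have "(U * W) $$ (i, j) = ip n (u i) (u j)"
      by (simp add: U_def W_def scalar_prod_def ip_def atLeast0LessThan)
    then show "(U * W) $$ (i, j) = 1\<^sub>m n $$ (i, j)" using orthonormalD[OF u] ij by simp
  qed (auto simp: U_def W_def)
  show "W * U = 1\<^sub>m n"
    by (rule mat_mult_left_right_inverse[OF _ _ UW]) (auto simp: U_def W_def)
qed

lemma orthonormal_complete:
  assumes u: "orthonormal n {..<n} u" and ab: "a < n" "b < n"
  shows "(\<Sum>j<n. u j a * cnj (u j b)) = (if a = b then 1 else 0)"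
proof -
  have "(mat n n (\<lambda>(i, j). u j i) * mat n n (\<lambda>(j, i). cnj (u j i))) $$ (a, b) = 1\<^sub>m n $$ (a, b)"
    by (simp only: orthonormal_unitary(2)[OF u])
  then show ?thesis using ab by (simp add: scalar_prod_def atLeast0LessThan)
qed

lemma orthonormal_expand:
  assumes u: "orthonormal n {..<n} u" and a: "a < n"
  shows "x a = (\<Sum>j<n. ip n (u j) x * u j a)"
proof -
  have "(\<Sum>j<n. ip n (u j) x * u j a) = (\<Sum>j<n. \<Sum>b<n. x b * (u j a * cnj (u j b)))"
    unfolding ip_def sum_distrib_right by (simp add: mult_ac)
  also have "\<dots> = (\<Sum>b<n. x b * (\<Sum>j<n. u j a * cnj (u j b)))"
    unfolding sum_distrib_left by (rule sum.swap)
  also have "\<dots> = (\<Sum>b<n. if a = b then x b else 0)"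
    by (rule sum.cong) (auto simp: orthonormal_complete[OF u a])
  finally show ?thesis using a by simp
qed

lemma parseval:
  assumes u: "orthonormal n {..<n} u"
  shows "nsq n x = (\<Sum>j<n. (cmod (ip n (u j) x))\<^sup>2)"
proof -
  have "nsq n (\<lambda>i. x i - (\<Sum>j<n. ip n (u j) x * u j i)) = 0"
    unfolding nsq_eq_0_iff
  proof (intro allI impI)
    fix i assume "i < n"
    then show "x i - (\<Sum>j<n. ip n (u j) x * u j i) = 0"
      using orthonormal_expand[OF u, of i x] by simp
  qed
  then show ?thesis using nsq_residual[OF finite_lessThan u, of x] by simp
qed

section \<open>Eigenbases and singular values\<close>

definition app :: "complex mat \<Rightarrow> (nat \<Rightarrow> complex) \<Rightarrow> (nat \<Rightarrow> complex)" where
  "app M x = (\<lambda>i. \<Sum>j<dim_col M. M $$ (i, j) * x j)"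

lemma mat_adjoint_carrier [simp]: "(M :: complex mat) \<in> carrier_mat m n \<Longrightarrow> mat_adjoint M \<in> carrier_mat n m"
  by (rule carrier_matI) (auto simp: mat_adjoint_def)

lemma mat_adjoint_dims [simp]:
  "dim_row (mat_adjoint (M :: complex mat)) = dim_col M" "dim_col (mat_adjoint M) = dim_row M"
  by (auto simp: mat_adjoint_def)

lemma mat_adjoint_index [simp]:
  "i < dim_col M \<Longrightarrow> j < dim_row M \<Longrightarrow> mat_adjoint (M :: complex mat) $$ (i, j) = cnj (M $$ (j, i))"
  by (simp add: mat_adjoint_def mat_of_rows_index)

lemma mat_adjoint_adjoint [simp]: "mat_adjoint (mat_adjoint (M :: complex mat)) = M"
  by (rule eq_matI) auto

lemma mat_mult_index:
  "A \<in> carrier_mat m p \<Longrightarrow> B \<in> carrier_mat p n \<Longrightarrow> i < m \<Longrightarrow> j < n \<Longrightarrow>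
    (A * B) $$ (i, j) = (\<Sum>l<p. A $$ (i, l) * B $$ (l, j) :: complex)"
  by (simp add: scalar_prod_def atLeast0LessThan)

lemma mat_adjoint_mult:
  assumes "A \<in> carrier_mat m p" "B \<in> carrier_mat p n"
  shows "mat_adjoint (A * B) = mat_adjoint B * mat_adjoint (A :: complex mat)"
proof (rule eq_matI)
  fix i j assume "i < dim_row (mat_adjoint B * mat_adjoint A)" "j < dim_col (mat_adjoint B * mat_adjoint A)"
  then have ij: "i < n" "j < m" using assms by auto
  have "mat_adjoint (A * B) $$ (i, j) = cnj ((A * B) $$ (j, i))" using ij assms by auto
  also have "\<dots> = (mat_adjoint B * mat_adjoint A) $$ (i, j)"
    using assms ij by (subst mat_mult_index[of _ m p _ n]; (subst mat_mult_index[of _ n p _ m])?) (auto simp: mult.commute)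
  finally show "mat_adjoint (A * B) $$ (i, j) = (mat_adjoint B * mat_adjoint A) $$ (i, j)" .
qed (use assms in auto)

lemma mat_adjoint_minus:
  assumes "A \<in> carrier_mat m n" "B \<in> carrier_mat m n"
  shows "mat_adjoint (A - B) = mat_adjoint A - mat_adjoint (B :: complex mat)"
  by (rule eq_matI) (use assms in auto)

lemma mat_adjoint_one [simp]: "mat_adjoint (1\<^sub>m n :: complex mat) = 1\<^sub>m n"
  by (rule eq_matI) auto

lemma app_cong: "(\<And>j. j < dim_col M \<Longrightarrow> x j = y j) \<Longrightarrow> app M x = app M y"
  by (simp add: app_def)

lemma app_mult:
  assumes "A \<in> carrier_mat m p" "B \<in> carrier_mat p n" "i < m"
  shows "app (A * B) x i = app A (app B x) i"
proof -
  have "app (A * B) x i = (\<Sum>j<n. \<Sum>l<p. A $$ (i, l) * B $$ (l, j) * x j)"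
    unfolding app_def
    by (rule sum.cong)
      (use assms in \<open>auto simp: mat_mult_index[of A m p B n] sum_distrib_right simp del: index_mult_mat(1)\<close>)
  also have "\<dots> = (\<Sum>l<p. \<Sum>j<n. A $$ (i, l) * B $$ (l, j) * x j)" by (rule sum.swap)
  also have "\<dots> = app A (app B x) i"
    unfolding app_def using assms by (simp add: sum_distrib_left mult.assoc)
  finally show ?thesis .
qed

lemma app_diff: "app M (\<lambda>i. x i - y i) = (\<lambda>i. app M x i - app M y i)"
  by (simp add: app_def algebra_simps sum_subtractf)

lemma app_scale: "app M (\<lambda>i. c * x i) = (\<lambda>i. c * app M x i)"
  by (simp add: app_def sum_distrib_left mult_ac)

lemma app_lincomb: "app M (\<lambda>i. \<Sum>l\<in>J. c l * y l i) = (\<lambda>i. \<Sum>l\<in>J. c l * app M (y l) i)"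
proof
  fix i
  have "app M (\<lambda>i. \<Sum>l\<in>J. c l * y l i) i = (\<Sum>j<dim_col M. \<Sum>l\<in>J. M $$ (i, j) * (c l * y l j))"
    by (simp add: app_def sum_distrib_left)
  also have "\<dots> = (\<Sum>l\<in>J. \<Sum>j<dim_col M. M $$ (i, j) * (c l * y l j))" by (rule sum.swap)
  also have "\<dots> = (\<Sum>l\<in>J. c l * app M (y l) i)"
    by (simp add: app_def sum_distrib_left mult_ac)
  finally show "app M (\<lambda>i. \<Sum>l\<in>J. c l * y l i) i = (\<Sum>l\<in>J. c l * app M (y l) i)" .
qed

lemma app_minus_mat:
  "A \<in> carrier_mat m n \<Longrightarrow> B \<in> carrier_mat m n \<Longrightarrow> i < m \<Longrightarrow> app (A - B) x i = app A x i - app B x i"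
  by (simp add: app_def algebra_simps sum_subtractf)

lemma ip_app:
  assumes "M \<in> carrier_mat m n"
  shows "ip m y (app M x) = ip n (app (mat_adjoint M) y) x"
proof -
  have "ip m y (app M x) = (\<Sum>i<m. \<Sum>j<n. cnj (y i) * (M $$ (i, j) * x j))"
    using assms by (simp add: ip_def app_def sum_distrib_left)
  also have "\<dots> = (\<Sum>j<n. \<Sum>i<m. cnj (y i) * (M $$ (i, j) * x j))" by (rule sum.swap)
  also have "\<dots> = ip n (app (mat_adjoint M) y) x"
    using assms by (auto simp: ip_def app_def sum_distrib_left mult_ac intro!: sum.cong)
  finally show ?thesis .
qed

text \<open>
  The orthogonal complement of the eigenvectors found so far is invariant under \<open>H\<close>.
  An eigenvector of the compression of \<open>H\<close> to it is therefore an eigenvector of \<open>H\<close>.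
\<close>

lemma hermitian_eigenvector_step:
  assumes H: "H \<in> carrier_mat n n" "mat_adjoint H = H" and m: "m < n"
    and u: "orthonormal n {..<m} u"
    and eig: "\<forall>j<m. \<forall>i<n. app H (u j) i = \<mu> j * u j i"
  shows "\<exists>w \<nu>. nsq n w = 1 \<and> (\<forall>j<m. ip n (u j) w = 0) \<and> (\<forall>i<n. app H w i = \<nu> * w i)"
proof -
  have RC: "real_or_complex UNIV" by (simp add: real_or_complex_def)
  obtain v where v: "orthonormal n {..<n} v" and vu: "\<forall>j<m. v j = u j"
    using orthonormal_extend[OF RC u less_imp_le[OF m]] by auto
  \<comment> \<open>the compression of \<open>H\<close> to the span of the new basis vectors\<close>
  define K where "K = mat (n - m) (n - m) (\<lambda>(a, b). ip n (v (m + a)) (app H (v (m + b))))"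
  have K: "K \<in> carrier_mat (n - m) (n - m)" by (simp add: K_def)
  obtain \<nu> y where y: "eigenvector K y \<nu>"
    using spectrum_non_empty[OF K] m by (auto simp: spectrum_def eigenvalue_def)
  have yc: "y \<in> carrier_vec (n - m)" and y0: "y \<noteq> 0\<^sub>v (n - m)" and Ky: "K *\<^sub>v y = \<nu> \<cdot>\<^sub>v y"
    using y K by (auto simp: eigenvector_def)
  define x where "x = (\<lambda>i. \<Sum>b<n - m. y $ b * v (m + b) i)"
  have vx: "ip n (v j) x = (if j < m then 0 else y $ (j - m))" if j: "j < n" for j
  proof -
    have "ip n (v j) x = (\<Sum>b<n - m. if j = m + b then y $ b else 0)"
      unfolding x_def ip_lincomb by (rule sum.cong) (use orthonormalD[OF v] j in auto)
    also have "\<dots> = (\<Sum>b<n - m. if b = j - m \<and> m \<le> j then y $ b else 0)"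
      by (rule sum.cong) auto
    also have "\<dots> = (if j < m then 0 else y $ (j - m))" using j by (auto simp: sum.delta')
    finally show ?thesis .
  qed
  have vHx: "ip n (v j) (app H x) = \<nu> * ip n (v j) x" if j: "j < n" for j
  proof (cases "j < m")
    case True
    have "ip n (v j) (app H x) = ip n (app H (v j)) x" using ip_app[OF H(1)] H(2) by simp
    also have "\<dots> = ip n (\<lambda>i. \<mu> j * v j i) x" by (rule ip_cong) (use eig vu True in auto)
    also have "\<dots> = cnj (\<mu> j) * ip n (v j) x" by (rule ip_left_scale)
    finally show ?thesis using vx[OF j] True by simp
  next
    case False
    have "ip n (v j) (app H x) = (\<Sum>b<n - m. y $ b * ip n (v j) (app H (v (m + b))))"
      unfolding x_def app_lincomb ip_lincomb ..
    also have "\<dots> = (K *\<^sub>v y) $ (j - m)"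
      using False j yc by (simp add: K_def scalar_prod_def atLeast0LessThan mult.commute)
    finally show ?thesis using vx[OF j] False j yc by (simp add: Ky)
  qed
  have Hx: "app H x i = \<nu> * x i" if "i < n" for i
  proof -
    have "app H x i = (\<Sum>j<n. ip n (v j) (app H x) * v j i)" by (rule orthonormal_expand[OF v that])
    also have "\<dots> = \<nu> * (\<Sum>j<n. ip n (v j) x * v j i)"
      by (simp add: vHx sum_distrib_left mult.assoc)
    also have "\<dots> = \<nu> * x i" by (simp only: orthonormal_expand[OF v that, of x, symmetric])
    finally show ?thesis .
  qed
  have "\<exists>b<n - m. y $ b \<noteq> 0"
  proof (rule ccontr)
    assume "\<not> ?thesis"
    then have "y = 0\<^sub>v (n - m)" by (intro eq_vecI) (use yc in auto)
    then show False using y0 by simp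
  qed
  then obtain b where b: "b < n - m" "y $ b \<noteq> 0" by blast
  have nz: "nsq n x \<noteq> 0"
  proof
    assume "nsq n x = 0"
    then have "ip n (v (m + b)) x = 0" by (simp add: nsq_eq_0_iff ip_def)
    then show False using vx[of "m + b"] b by simp
  qed
  obtain c where c: "nsq n (\<lambda>i. complex_of_real c * x i) = 1"
    using normalise[OF RC _ nz] by blast
  have "ip n (u j) (\<lambda>i. complex_of_real c * x i) = 0" if "j < m" for j
    using vx[of j] vu that m by (simp add: ip_scale)
  then show ?thesis
    by (intro exI[of _ "\<lambda>i. complex_of_real c * x i"] exI[of _ \<nu>])
      (use c Hx in \<open>simp add: app_scale\<close>)
qed

lemma hermitian_eigenbasis:
  assumes H: "H \<in> carrier_mat n n" "mat_adjoint H = H"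
  shows "\<exists>u \<mu>. orthonormal n {..<n} u \<and> (\<forall>j<n. \<forall>i<n. app H (u j) i = \<mu> j * u j i)"
proof -
  have "m \<le> n \<Longrightarrow> \<exists>u \<mu>. orthonormal n {..<m} u \<and> (\<forall>j<m. \<forall>i<n. app H (u j) i = \<mu> j * u j i)" for m
  proof (induction m)
    case 0
    show ?case by (simp add: orthonormal_def)
  next
    case (Suc m)
    then obtain u \<mu> where u: "orthonormal n {..<m} u"
      and eig: "\<forall>j<m. \<forall>i<n. app H (u j) i = \<mu> j * u j i" by auto
    obtain w \<nu> where w: "nsq n w = 1" "\<forall>j<m. ip n (u j) w = 0" "\<forall>i<n. app H w i = \<nu> * w i"
      using hermitian_eigenvector_step[OF H _ u eig] Suc.prems by auto
    show ?case
    proof (intro exI[of _ "u(m := w)"] exI[of _ "\<mu>(m := \<nu>)"] conjI allI impI)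
      show "orthonormal n {..<Suc m} (u(m := w))" using orthonormal_update u w by blast
      fix j i assume "j < Suc m" "i < n"
      then show "app H ((u(m := w)) j) i = (\<mu>(m := \<nu>)) j * (u(m := w)) j i"
        using eig w by (cases "j = m") auto
    qed
  qed
  then show ?thesis by blast
qed

lemma proots_linear_factors:
  "proots (\<Prod>a\<leftarrow>xs. [:- f a, 1:]) = image_mset f (mset xs)" for f :: "'a \<Rightarrow> 'b :: idom"
proof (induction xs)
  case (Cons a xs)
  have "(\<Prod>a\<leftarrow>xs. [:- f a, 1:]) \<noteq> 0" by (auto simp: prod_list_zero_iff)
  then show ?case using Cons
    by (simp add: proots_mult del: mult_pCons_left mult_pCons_right)
qed simp

lemma hermitian_diagonalisation:
  assumes H: "H \<in> carrier_mat n n"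
    and u: "orthonormal n {..<n} u" and eig: "\<forall>j<n. \<forall>i<n. app H (u j) i = \<mu> j * u j i"
  shows "i < n \<Longrightarrow> k < n \<Longrightarrow> H $$ (i, k) = (\<Sum>j<n. \<mu> j * (u j i * cnj (u j k)))"
    and "proots (char_poly H) = image_mset \<mu> (mset_set {..<n})"
proof -
  show 1: "H $$ (i, k) = (\<Sum>j<n. \<mu> j * (u j i * cnj (u j k)))" if ik: "i < n" "k < n" for i k
  proof -
    have "(\<Sum>j<n. \<mu> j * (u j i * cnj (u j k))) = (\<Sum>j<n. app H (u j) i * cnj (u j k))"
      by (rule sum.cong) (use eig ik in auto)
    also have "\<dots> = (\<Sum>j<n. \<Sum>l<n. H $$ (i, l) * (u j l * cnj (u j k)))"
      using H by (auto simp: app_def sum_distrib_left mult_ac intro!: sum.cong)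
    also have "\<dots> = (\<Sum>l<n. H $$ (i, l) * (\<Sum>j<n. u j l * cnj (u j k)))"
      unfolding sum_distrib_left by (rule sum.swap)
    also have "\<dots> = (\<Sum>l<n. if l = k then H $$ (i, l) else 0)"
      by (rule sum.cong) (use orthonormal_complete[OF u _ ik(2)] in auto)
    finally show ?thesis using ik by simp
  qed
  define U where "U = mat n n (\<lambda>(j, i). cnj (u j i))"
  define W where "W = mat n n (\<lambda>(i, j). u j i)"
  define D where "D = mat n n (\<lambda>(i, j). if i = j then \<mu> i else 0)"
  have car: "U \<in> carrier_mat n n" "W \<in> carrier_mat n n" "D \<in> carrier_mat n n"
    by (auto simp: U_def W_def D_def)
  have UW: "U * W = 1\<^sub>m n" and WU: "W * U = 1\<^sub>m n"
    unfolding U_def W_def by (rule orthonormal_unitary[OF u])+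
  have WD: "(W * D) $$ (i, j) = \<mu> j * u j i" if "i < n" "j < n" for i j
  proof -
    have "(W * D) $$ (i, j) = (\<Sum>l<n. if l = j then \<mu> j * u j i else 0)"
      unfolding mat_mult_index[OF car(2,3) that]
      by (rule sum.cong) (use that in \<open>auto simp: W_def D_def\<close>)
    then show ?thesis using that by simp
  qed
  have "H = W * D * U"
  proof (rule eq_matI)
    fix i k assume "i < dim_row (W * D * U)" "k < dim_col (W * D * U)"
    then have ik: "i < n" "k < n" using car by auto
    have "(W * D * U) $$ (i, k) = (\<Sum>j<n. (W * D) $$ (i, j) * U $$ (j, k))"
      by (rule mat_mult_index) (use car ik in auto)
    also have "\<dots> = (\<Sum>j<n. \<mu> j * (u j i * cnj (u j k)))"
      by (rule sum.cong) (use ik in \<open>auto simp: WD U_def\<close>)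
    finally show "H $$ (i, k) = (W * D * U) $$ (i, k)" using 1[OF ik] by simp
  qed (use H car in auto)
  then have "similar_mat H D"
    unfolding similar_mat_def similar_mat_wit_def Let_def
    by (intro exI[of _ W] exI[of _ U]) (use H car UW WU in auto)
  then have "char_poly H = char_poly D" by (rule char_poly_similar)
  also have "\<dots> = (\<Prod>a\<leftarrow>diag_mat D. [:- a, 1:])"
    by (rule char_poly_upper_triangular[OF car(3)]) (auto simp: D_def)
  also have "diag_mat D = map \<mu> [0..<n]"
    unfolding diag_mat_def by (rule map_cong) (auto simp: D_def)
  finally have "proots (char_poly H) = proots (\<Prod>a\<leftarrow>[0..<n]. [:- \<mu> a, 1:])"
    by (simp add: comp_def)
  also have "\<dots> = image_mset \<mu> (mset [0..<n])" by (rule proots_linear_factors)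
  finally show "proots (char_poly H) = image_mset \<mu> (mset_set {..<n})"
    by (simp add: mset_upt atLeast0LessThan)
qed

text \<open>
  All that is needed about Schatten norms: the eigenbasis of \<open>M\<^sup>* M\<close> is mapped by \<open>M\<close> to an
  orthogonal system whose lengths are the singular values.
\<close>

lemma right_singular_basis:
  assumes M: "M \<in> carrier_mat m n"
  obtains w where "orthonormal n {..<n} w"
    "\<And>i j. i < n \<Longrightarrow> j < n \<Longrightarrow> i \<noteq> j \<Longrightarrow> ip m (app M (w i)) (app M (w j)) = 0"
    "singular_values M = image_mset (\<lambda>j. sqrt (nsq m (app M (w j)))) (mset_set {..<n})"
proof -
  let ?H = "mat_adjoint M * M"
  have H: "?H \<in> carrier_mat n n" using M by (intro mult_carrier_mat[of _ n m]) auto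
  have "mat_adjoint ?H = ?H" using mat_adjoint_mult[of "mat_adjoint M" n m M n] M by simp
  then obtain w \<mu> where w: "orthonormal n {..<n} w"
    and eig: "\<forall>j<n. \<forall>i<n. app ?H (w j) i = \<mu> j * w j i"
    using hermitian_eigenbasis[OF H] by blast
  have ipM: "ip m (app M (w i)) (app M (w j)) = (if i = j then \<mu> j else 0)" if "i < n" "j < n" for i j
  proof -
    have "ip m (app M (w i)) (app M (w j)) = cnj (ip m (app M (w j)) (app M (w i)))"
      by (simp add: cnj_ip)
    also have "\<dots> = cnj (ip n (app (mat_adjoint M) (app M (w j))) (w i))"
      by (simp only: ip_app[OF M])
    also have "\<dots> = ip n (w i) (app (mat_adjoint M) (app M (w j)))" by (simp add: cnj_ip)
    also have "\<dots> = ip n (w i) (\<lambda>l. \<mu> j * w j l)"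
    proof (rule ip_cong)
      fix l assume l: "l < n"
      have "app (mat_adjoint M) (app M (w j)) l = app ?H (w j) l"
        by (rule app_mult[symmetric, of _ n m _ n]) (use M l in auto)
      then show "app (mat_adjoint M) (app M (w j)) l = \<mu> j * w j l" using eig that l by auto
    qed simp
    also have "\<dots> = (if i = j then \<mu> j else 0)"
      unfolding ip_scale using orthonormalD[OF w] that by auto
    finally show ?thesis .
  qed
  have \<mu>: "\<mu> j = of_real (nsq m (app M (w j)))" if "j < n" for j
    using ipM[OF that that] by (simp add: ip_self)
  have "singular_values M = image_mset (\<lambda>e. sqrt (Re e)) (image_mset \<mu> (mset_set {..<n}))"
    unfolding singular_values_def hermitian_diagonalisation(2)[OF H w eig] ..
  also have "\<dots> = image_mset (\<lambda>j. sqrt (nsq m (app M (w j)))) (mset_set {..<n})"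
    unfolding multiset.map_comp by (rule image_mset_cong) (auto simp: \<mu>)
  finally show ?thesis using that w ipM by simp
qed

lemma psd_factor:
  assumes A: "A \<in> carrier_mat n n" and psd: "psd A"
  obtains B where "B \<in> carrier_mat n n" "A = mat_adjoint B * B"
proof -
  have "mat_adjoint A = A" using psd by (simp add: psd_def)
  then obtain u \<mu> where u: "orthonormal n {..<n} u"
    and eig: "\<forall>j<n. \<forall>i<n. app A (u j) i = \<mu> j * u j i"
    using hermitian_eigenbasis[OF A] by blast
  have \<mu>: "\<mu> j \<in> \<real>\<^sub>\<ge>\<^sub>0" if j: "j < n" for j
  proof -
    have "vec n (u j) \<noteq> 0\<^sub>v n"
    proof
      assume *: "vec n (u j) = 0\<^sub>v n"
      have "u j i = 0" if "i < n" for i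
      proof -
        have "vec n (u j) $ i = 0\<^sub>v n $ i" by (simp only: *)
        then show ?thesis using that by simp
      qed
      then have "nsq n (u j) = 0" unfolding nsq_eq_0_iff by blast
      then show False using orthonormal_nsq[OF u, of j] j by simp
    qed
    moreover have "A *\<^sub>v vec n (u j) = \<mu> j \<cdot>\<^sub>v vec n (u j)"
      by (rule eq_vecI) (use A eig j in \<open>auto simp: scalar_prod_def app_def atLeast0LessThan\<close>)
    ultimately have "eigenvalue A (\<mu> j)"
      unfolding eigenvalue_def eigenvector_def using A by (intro exI[of _ "vec n (u j)"]) auto
    then show ?thesis using psd by (simp add: psd_def)
  qed
  define B where "B = mat n n (\<lambda>(j, i). complex_of_real (sqrt (Re (\<mu> j))) * cnj (u j i))"
  have B: "B \<in> carrier_mat n n" by (simp add: B_def)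
  have "A = mat_adjoint B * B"
  proof (rule eq_matI)
    fix i k assume "i < dim_row (mat_adjoint B * B)" "k < dim_col (mat_adjoint B * B)"
    then have ik: "i < n" "k < n" using B by auto
    have "(mat_adjoint B * B) $$ (i, k) = (\<Sum>j<n. mat_adjoint B $$ (i, j) * B $$ (j, k))"
      by (rule mat_mult_index) (use B ik in auto)
    also have "\<dots> = (\<Sum>j<n. \<mu> j * (u j i * cnj (u j k)))"
    proof (rule sum.cong)
      fix j assume "j \<in> {..<n}"
      then have j: "j < n" by simp
      obtain t where t: "\<mu> j = of_real t" "0 \<le> t" using \<mu>[OF j] by (auto elim: nonneg_Reals_cases)
      have sq: "complex_of_real (sqrt t) * complex_of_real (sqrt t) = of_real t"
        using t(2) by (simp flip: of_real_mult)
      have "mat_adjoint B $$ (i, j) * B $$ (j, k)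
          = (complex_of_real (sqrt t) * complex_of_real (sqrt t)) * (u j i * cnj (u j k))"
        using B ik j t(1) by (simp add: B_def)
      then show "mat_adjoint B $$ (i, j) * B $$ (j, k) = \<mu> j * (u j i * cnj (u j k))"
        by (simp only: sq t(1))
    qed simp
    finally show "A $$ (i, k) = (mat_adjoint B * B) $$ (i, k)"
      by (simp only: hermitian_diagonalisation(1)[OF A u eig ik])
  qed (use A B in auto)
  then show ?thesis using that B by blast
qed

section \<open>Trace norm duality and triangle inequalities\<close>

lemma schatten_one_eq:
  assumes "singular_values M = image_mset f (mset_set {..<n})" "\<And>j. j < n \<Longrightarrow> 0 \<le> f j"
  shows "schatten_norm 1 M = (\<Sum>j<n. f j)"
proof -
  have one: "real_of_ereal 1 = 1" by (simp add: one_ereal_def)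
  have "(\<Sum>s\<in>#singular_values M. s powr 1) = (\<Sum>j<n. f j powr 1)"
    by (simp add: assms(1) multiset.map_comp comp_def sum_unfold_sum_mset)
  also have "\<dots> = (\<Sum>j<n. f j)" by (rule sum.cong) (use assms(2) in auto)
  finally have "(\<Sum>s\<in>#singular_values M. s powr 1) = (\<Sum>j<n. f j)" .
  moreover have "0 \<le> (\<Sum>j<n. f j)" by (rule sum_nonneg) (use assms(2) in auto)
  ultimately show ?thesis by (simp add: schatten_norm_def one)
qed

lemma schatten_inf_eq:
  fixes n :: nat
  assumes "singular_values M = image_mset f (mset_set {..<n})"
  shows "schatten_norm \<infinity> M = Max (insert 0 (f ` {..<n}))"
  by (simp add: schatten_norm_def assms finite_set_mset_mset_set)

lemma schatten_norm_nonneg: "0 \<le> schatten_norm p M"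
  by (auto simp: schatten_norm_def intro!: Max_ge)

lemma schatten_inf_le_one:
  assumes M: "M \<in> carrier_mat m n"
  shows "schatten_norm \<infinity> M \<le> schatten_norm 1 M"
proof -
  obtain w where sv: "singular_values M = image_mset (\<lambda>j. sqrt (nsq m (app M (w j)))) (mset_set {..<n})"
    using right_singular_basis[OF M] by metis
  show ?thesis
    unfolding schatten_inf_eq[OF sv] schatten_one_eq[OF sv real_sqrt_ge_zero[OF nsq_nonneg]]
    by (rule Max.boundedI) (auto intro!: sum_nonneg member_le_sum)
qed

lemma cauchy_schwarz_sum:
  fixes f g :: "'a \<Rightarrow> real"
  assumes "\<And>i. i \<in> J \<Longrightarrow> 0 \<le> f i" "\<And>i. i \<in> J \<Longrightarrow> 0 \<le> g i"
  shows "(\<Sum>i\<in>J. f i * g i) \<le> sqrt (\<Sum>i\<in>J. (f i)\<^sup>2) * sqrt (\<Sum>i\<in>J. (g i)\<^sup>2)"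
proof -
  have "(\<Sum>i\<in>J. f i * g i) = (\<Sum>i\<in>J. \<bar>f i\<bar> * \<bar>g i\<bar>)"
    by (rule sum.cong) (use assms in auto)
  also have "\<dots> \<le> L2_set f J * L2_set g J" by (rule L2_set_mult_ineq)
  finally show ?thesis by (simp add: L2_set_def)
qed

lemma cmod_ip_commute: "cmod (ip n x y) = cmod (ip n y x)"
  by (metis cnj_ip complex_mod_cnj)

lemma app_expand:
  assumes M: "M \<in> carrier_mat m n" and w: "orthonormal n {..<n} w"
  shows "app M x = (\<lambda>i. \<Sum>j<n. ip n (w j) x * app M (w j) i)"
proof -
  have "app M x = app M (\<lambda>i. \<Sum>j<n. ip n (w j) x * w j i)"
    by (rule app_cong) (use M orthonormal_expand[OF w] in auto)
  then show ?thesis by (simp only: app_lincomb)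
qed

text \<open>
  Expand \<open>u i\<close> in the right singular basis \<open>w\<close>. For each \<open>j\<close> the Cauchy-Schwarz
  inequality over \<open>i\<close> and Bessel's inequality for both systems bound the contribution by
  \<open>\<parallel>M w\<^sub>j\<parallel>\<close>.
\<close>

lemma orthonormal_pairing_le_schatten_one:
  assumes M: "M \<in> carrier_mat m n" and J: "finite J"
    and u: "orthonormal n J u" and v: "orthonormal m J v"
  shows "(\<Sum>i\<in>J. cmod (ip m (v i) (app M (u i)))) \<le> schatten_norm 1 M"
proof -
  obtain w where w: "orthonormal n {..<n} w"
    and sv: "singular_values M = image_mset (\<lambda>j. sqrt (nsq m (app M (w j)))) (mset_set {..<n})"
    using right_singular_basis[OF M] by metis
  have 1: "ip m (v i) (app M (u i)) = (\<Sum>j<n. ip n (w j) (u i) * ip m (v i) (app M (w j)))" for i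
    by (subst app_expand[OF M w]) (rule ip_lincomb)
  have "(\<Sum>i\<in>J. cmod (ip m (v i) (app M (u i))))
      \<le> (\<Sum>i\<in>J. \<Sum>j<n. cmod (ip n (w j) (u i)) * cmod (ip m (v i) (app M (w j))))"
    unfolding 1 by (intro sum_mono order.trans[OF norm_sum]) (simp add: norm_mult)
  also have "\<dots> = (\<Sum>j<n. \<Sum>i\<in>J. cmod (ip n (u i) (w j)) * cmod (ip m (v i) (app M (w j))))"
    by (subst sum.swap) (simp add: cmod_ip_commute[of n "w _"])
  also have "\<dots> \<le> (\<Sum>j<n. sqrt (nsq m (app M (w j))))"
  proof (rule sum_mono)
    fix j assume "j \<in> {..<n}"
    then have nw: "nsq n (w j) = 1" using orthonormal_nsq[OF w] by simp
    have "(\<Sum>i\<in>J. cmod (ip n (u i) (w j)) * cmod (ip m (v i) (app M (w j))))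
        \<le> sqrt (\<Sum>i\<in>J. (cmod (ip n (u i) (w j)))\<^sup>2) * sqrt (\<Sum>i\<in>J. (cmod (ip m (v i) (app M (w j))))\<^sup>2)"
      by (rule cauchy_schwarz_sum) auto
    also have "\<dots> \<le> sqrt (nsq n (w j)) * sqrt (nsq m (app M (w j)))"
      by (intro mult_mono real_sqrt_le_mono bessel J u v real_sqrt_ge_zero sum_nonneg) auto
    finally show "(\<Sum>i\<in>J. cmod (ip n (u i) (w j)) * cmod (ip m (v i) (app M (w j))))
        \<le> sqrt (nsq m (app M (w j)))" by (simp add: nw)
  qed
  also have "\<dots> = schatten_norm 1 M"
    by (rule schatten_one_eq[OF sv real_sqrt_ge_zero[OF nsq_nonneg], symmetric])
  finally show ?thesis .
qed

text \<open>
  Pair the right singular vectors with their normalised images. Those with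
  singular value 0 have no normalised image and are left out, which is why \<open>J\<close> is a subset.
\<close>

lemma schatten_one_attained:
  assumes M: "M \<in> carrier_mat m n"
  obtains J u v where "finite J" "orthonormal n J u" "orthonormal m J v"
    "(\<Sum>i\<in>J. ip m (v i) (app M (u i))) = complex_of_real (schatten_norm 1 M)"
proof -
  obtain w where w: "orthonormal n {..<n} w"
    and wo: "\<And>i j. i < n \<Longrightarrow> j < n \<Longrightarrow> i \<noteq> j \<Longrightarrow> ip m (app M (w i)) (app M (w j)) = 0"
    and sv: "singular_values M = image_mset (\<lambda>j. sqrt (nsq m (app M (w j)))) (mset_set {..<n})"
    using right_singular_basis[OF M] by metis
  define \<sigma> where "\<sigma> j = sqrt (nsq m (app M (w j)))" for j
  have \<sigma>2: "complex_of_real (nsq m (app M (w j))) = of_real (\<sigma> j) * of_real (\<sigma> j)" for j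
    by (simp add: \<sigma>_def flip: of_real_mult)
  define J where "J = {j. j < n \<and> \<sigma> j \<noteq> 0}"
  define v where "v = (\<lambda>j i. complex_of_real (1 / \<sigma> j) * app M (w j) i)"
  have vM: "ip m (v i) (app M (w j)) = (if i = j then of_real (\<sigma> i) else 0)" if "i \<in> J" "j \<in> J" for i j
  proof -
    have "ip m (v i) (app M (w j)) = cnj (complex_of_real (1 / \<sigma> i)) * ip m (app M (w i)) (app M (w j))"
      unfolding v_def by (rule ip_left_scale)
    then show ?thesis using that wo by (auto simp: J_def ip_self \<sigma>2)
  qed
  have "orthonormal m J v"
    unfolding orthonormal_def
  proof (intro ballI)
    fix i j assume ij: "i \<in> J" "j \<in> J"
    have "ip m (v i) (v j) = complex_of_real (1 / \<sigma> j) * ip m (v i) (app M (w j))"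
      unfolding v_def by (rule ip_scale)
    then show "ip m (v i) (v j) = (if i = j then 1 else 0)" using vM ij by (auto simp: J_def)
  qed
  moreover have "orthonormal n J w" by (rule orthonormal_subset[OF w]) (auto simp: J_def)
  moreover have "(\<Sum>i\<in>J. ip m (v i) (app M (w i))) = complex_of_real (schatten_norm 1 M)"
  proof -
    have "(\<Sum>i\<in>J. ip m (v i) (app M (w i))) = complex_of_real (\<Sum>i\<in>J. \<sigma> i)"
      by (simp add: vM)
    also have "(\<Sum>i\<in>J. \<sigma> i) = (\<Sum>i<n. \<sigma> i)"
      by (rule sum.mono_neutral_left) (auto simp: J_def)
    also have "\<dots> = schatten_norm 1 M"
      unfolding \<sigma>_def by (rule schatten_one_eq[OF sv real_sqrt_ge_zero[OF nsq_nonneg], symmetric])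
    finally show ?thesis .
  qed
  moreover have "finite J" by (simp add: J_def)
  ultimately show ?thesis using that by blast
qed

lemma app_minus_split:
  assumes "A \<in> carrier_mat m n" "B \<in> carrier_mat m n" "C \<in> carrier_mat m n" "i < m"
  shows "app (A - C) x i = app (A - B) x i + app (B - C) x i"
  using assms by (simp add: app_minus_mat[of _ m n])

lemma schatten_one_triangle:
  assumes A: "A \<in> carrier_mat m n" and B: "B \<in> carrier_mat m n" and C: "C \<in> carrier_mat m n"
  shows "schatten_norm 1 (A - C) \<le> schatten_norm 1 (A - B) + schatten_norm 1 (B - C)"
proof -
  have AC: "A - C \<in> carrier_mat m n" and AB: "A - B \<in> carrier_mat m n" and BC: "B - C \<in> carrier_mat m n"
    using A B C by auto
  obtain J u v where J: "finite J" and u: "orthonormal n J u" and v: "orthonormal m J v"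
    and eq: "(\<Sum>i\<in>J. ip m (v i) (app (A - C) (u i))) = complex_of_real (schatten_norm 1 (A - C))"
    by (rule schatten_one_attained[OF AC])
  have split: "ip m (v i) (app (A - C) (u i)) = ip m (v i) (app (A - B) (u i)) + ip m (v i) (app (B - C) (u i))" for i
    unfolding ip_add[symmetric] by (rule ip_cong) (auto intro: app_minus_split[OF A B C])
  have "schatten_norm 1 (A - C) \<le> cmod (\<Sum>i\<in>J. ip m (v i) (app (A - C) (u i)))"
    by (simp add: eq)
  also have "\<dots> \<le> (\<Sum>i\<in>J. cmod (ip m (v i) (app (A - B) (u i))) + cmod (ip m (v i) (app (B - C) (u i))))"
    unfolding split by (intro order.trans[OF norm_sum] sum_mono norm_triangle_ineq)
  also have "\<dots> \<le> schatten_norm 1 (A - B) + schatten_norm 1 (B - C)"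
    unfolding sum.distrib
    by (intro add_mono orthonormal_pairing_le_schatten_one[OF _ J u v] AB BC)
  finally show ?thesis .
qed

lemma nsq_app_le_schatten_inf:
  assumes M: "M \<in> carrier_mat m n"
  shows "sqrt (nsq m (app M x)) \<le> schatten_norm \<infinity> M * sqrt (nsq n x)"
proof -
  obtain w where w: "orthonormal n {..<n} w"
    and wo: "\<And>i j. i < n \<Longrightarrow> j < n \<Longrightarrow> i \<noteq> j \<Longrightarrow> ip m (app M (w i)) (app M (w j)) = 0"
    and sv: "singular_values M = image_mset (\<lambda>j. sqrt (nsq m (app M (w j)))) (mset_set {..<n})"
    using right_singular_basis[OF M] by metis
  define s where "s = schatten_norm \<infinity> M"
  have s0: "0 \<le> s" unfolding s_def by (rule schatten_norm_nonneg)
  have sj: "nsq m (app M (w j)) \<le> s\<^sup>2" if "j < n" for j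
  proof -
    have "sqrt (nsq m (app M (w j))) \<le> s"
      unfolding s_def schatten_inf_eq[OF sv] by (rule Max_ge) (use that in auto)
    then show ?thesis by (rule sqrt_le_D)
  qed
  have inner: "ip m (app M (w i)) (app M x) = ip n (w i) x * complex_of_real (nsq m (app M (w i)))" if "i < n" for i
  proof -
    have "ip m (app M (w i)) (app M x) = (\<Sum>j<n. ip n (w j) x * ip m (app M (w i)) (app M (w j)))"
      by (subst (2) app_expand[OF M w]) (rule ip_lincomb)
    also have "\<dots> = (\<Sum>j<n. if i = j then ip n (w j) x * complex_of_real (nsq m (app M (w i))) else 0)"
      by (rule sum.cong) (use wo that in \<open>auto simp: ip_self\<close>)
    finally show ?thesis using that by simp
  qed
  have "complex_of_real (nsq m (app M x)) = ip m (app M x) (app M x)" by (simp add: ip_self)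
  also have "\<dots> = (\<Sum>j<n. cnj (ip n (w j) x) * ip m (app M (w j)) (app M x))"
    by (subst (1) app_expand[OF M w]) (rule ip_lincomb_left)
  also have "\<dots> = (\<Sum>j<n. complex_of_real ((cmod (ip n (w j) x))\<^sup>2 * nsq m (app M (w j))))"
  proof (rule sum.cong)
    fix j assume "j \<in> {..<n}"
    have "cnj (ip n (w j) x) * ip n (w j) x = of_real ((cmod (ip n (w j) x))\<^sup>2)"
      using complex_norm_square[of "ip n (w j) x"] by (simp add: mult.commute)
    then show "cnj (ip n (w j) x) * ip m (app M (w j)) (app M x)
        = complex_of_real ((cmod (ip n (w j) x))\<^sup>2 * nsq m (app M (w j)))"
      using inner[of j] \<open>j \<in> {..<n}\<close> by (simp flip: mult.assoc)
  qed simp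
  finally have "nsq m (app M x) = (\<Sum>j<n. (cmod (ip n (w j) x))\<^sup>2 * nsq m (app M (w j)))"
    unfolding of_real_sum[symmetric] of_real_eq_iff .
  also have "\<dots> \<le> (\<Sum>j<n. (cmod (ip n (w j) x))\<^sup>2 * s\<^sup>2)"
    by (intro sum_mono mult_left_mono sj) auto
  also have "\<dots> = s\<^sup>2 * nsq n x"
    by (simp add: parseval[OF w, of x] sum_distrib_left mult.commute)
  finally have "sqrt (nsq m (app M x)) \<le> sqrt (s\<^sup>2 * nsq n x)" by (rule real_sqrt_le_mono)
  then show ?thesis using s0 by (simp add: real_sqrt_mult s_def)
qed

lemma sqrt_nsq_triangle: "sqrt (nsq n (\<lambda>i. x i + y i)) \<le> sqrt (nsq n x) + sqrt (nsq n y)"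
proof -
  have "sqrt (nsq n (\<lambda>i. x i + y i)) \<le> L2_set (\<lambda>i. cmod (x i) + cmod (y i)) {..<n}"
    unfolding nsq_def L2_set_def by (intro real_sqrt_le_mono sum_mono power_mono norm_triangle_ineq) auto
  also have "\<dots> \<le> L2_set (\<lambda>i. cmod (x i)) {..<n} + L2_set (\<lambda>i. cmod (y i)) {..<n}"
    by (rule L2_set_triangle_ineq)
  finally show ?thesis by (simp add: nsq_def L2_set_def)
qed

lemma schatten_inf_triangle:
  assumes A: "A \<in> carrier_mat m n" and B: "B \<in> carrier_mat m n" and C: "C \<in> carrier_mat m n"
  shows "schatten_norm \<infinity> (A - C) \<le> schatten_norm \<infinity> (A - B) + schatten_norm \<infinity> (B - C)"
proof -
  have AC: "A - C \<in> carrier_mat m n" and AB: "A - B \<in> carrier_mat m n" and BC: "B - C \<in> carrier_mat m n"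
    using A B C by auto
  obtain w where w: "orthonormal n {..<n} w"
    and sv: "singular_values (A - C) = image_mset (\<lambda>j. sqrt (nsq m (app (A - C) (w j)))) (mset_set {..<n})"
    using right_singular_basis[OF AC] by metis
  show ?thesis
    unfolding schatten_inf_eq[OF sv]
  proof (rule Max.boundedI)
    fix t assume "t \<in> insert 0 ((\<lambda>j. sqrt (nsq m (app (A - C) (w j)))) ` {..<n})"
    then consider "t = 0" | j where "j < n" "t = sqrt (nsq m (app (A - C) (w j)))" by auto
    then show "t \<le> schatten_norm \<infinity> (A - B) + schatten_norm \<infinity> (B - C)"
    proof cases
      case 1
      then show ?thesis using schatten_norm_nonneg[of \<infinity> "A - B"] schatten_norm_nonneg[of \<infinity> "B - C"] by simp
    next
      case 2
      have "t = sqrt (nsq m (\<lambda>i. app (A - B) (w j) i + app (B - C) (w j) i))"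
        unfolding 2(2) by (intro arg_cong[where f = sqrt] nsq_cong app_minus_split[OF A B C])
      also have "\<dots> \<le> sqrt (nsq m (app (A - B) (w j))) + sqrt (nsq m (app (B - C) (w j)))"
        by (rule sqrt_nsq_triangle)
      also have "\<dots> \<le> schatten_norm \<infinity> (A - B) + schatten_norm \<infinity> (B - C)"
        using nsq_app_le_schatten_inf[OF AB, of "w j"] nsq_app_le_schatten_inf[OF BC, of "w j"]
          orthonormal_nsq[OF w, of j] 2(1) by simp
      finally show ?thesis .
    qed
  qed auto
qed

lemma schatten_norm_minus_commute:
  assumes A: "A \<in> carrier_mat m n" and B: "B \<in> carrier_mat m n"
  shows "schatten_norm p (A - B) = schatten_norm p (B - A)"
proof -
  have "mat_adjoint (A - B) * (A - B) = mat_adjoint (B - A) * (B - A)"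
    by (rule eq_matI) (use A B in \<open>auto simp: scalar_prod_def algebra_simps intro!: sum.cong\<close>)
  then show ?thesis by (simp add: schatten_norm_def singular_values_def)
qed

section \<open>The pseudoinverse and the Nystrom approximation\<close>

definition penrose :: "complex mat \<Rightarrow> complex mat \<Rightarrow> bool" where
  "penrose A X \<longleftrightarrow> X \<in> carrier_mat (dim_col A) (dim_row A) \<and>
     A * X * A = A \<and> X * A * X = X \<and>
     mat_adjoint (A * X) = A * X \<and> mat_adjoint (X * A) = X * A"

text \<open>
  The selfadjointness conditions give \<open>A X = A Y\<close> and \<open>X A = Y A\<close>, and then
  \<open>X = X A X = Y A X = Y A Y = Y\<close>.
\<close>

lemma penrose_unique:
  assumes X: "penrose A X" and Y: "penrose A Y"
  shows "X = Y"
proof -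
  define m n where "m = dim_row A" and "n = dim_col A"
  have A: "A \<in> carrier_mat m n" by (simp add: m_def n_def)
  have Xc: "X \<in> carrier_mat n m" and X1: "A * X * A = A" and X2: "X * A * X = X"
    and X3: "mat_adjoint (A * X) = A * X" and X4: "mat_adjoint (X * A) = X * A"
    using X by (auto simp: penrose_def m_def n_def)
  have Yc: "Y \<in> carrier_mat n m" and Y1: "A * Y * A = A" and Y2: "Y * A * Y = Y"
    and Y3: "mat_adjoint (A * Y) = A * Y" and Y4: "mat_adjoint (Y * A) = Y * A"
    using Y by (auto simp: penrose_def m_def n_def)
  have AX: "A * X \<in> carrier_mat m m" and AY: "A * Y \<in> carrier_mat m m"
    and XA: "X * A \<in> carrier_mat n n" and YA: "Y * A \<in> carrier_mat n n"
    using A Xc Yc by auto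
  have "A * X = mat_adjoint (A * Y * (A * X))"
    using X3 assoc_mult_mat[OF AY A Xc] Y1 by simp
  also have "\<dots> = A * X * (A * Y)" by (simp only: mat_adjoint_mult[OF AY AX] X3 Y3)
  also have "\<dots> = A * Y" using assoc_mult_mat[OF AX A Yc] X1 by simp
  finally have 1: "A * X = A * Y" .
  have "X * A = mat_adjoint (X * A * (Y * A))"
    using X4 assoc_mult_mat[OF Xc A YA] assoc_mult_mat[OF A Yc A] Y1 by simp
  also have "\<dots> = Y * A * (X * A)" by (simp only: mat_adjoint_mult[OF XA YA] X4 Y4)
  also have "\<dots> = Y * A" using assoc_mult_mat[OF Yc A XA] assoc_mult_mat[OF A Xc A] X1 by simp
  finally have 2: "X * A = Y * A" .
  have "X = Y * A * X" using X2 2 by simp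
  also have "\<dots> = Y * (A * Y)" using assoc_mult_mat[OF Yc A Xc] 1 by simp
  also have "\<dots> = Y" using assoc_mult_mat[OF Yc A Yc] Y2 by simp
  finally show ?thesis .
qed

lemma pinv_eq: "penrose A X \<Longrightarrow> pinv A = X"
  unfolding pinv_def penrose_def[symmetric] by (rule the_equality) (auto intro: penrose_unique)

text \<open>
  The function \<open>f\<close> of the eigenvalues, applied to a matrix with eigenbasis \<open>u\<close>.
\<close>

definition spectral_mat :: "nat \<Rightarrow> (nat \<Rightarrow> nat \<Rightarrow> complex) \<Rightarrow> (nat \<Rightarrow> complex) \<Rightarrow> complex mat" where
  "spectral_mat n u f = mat n n (\<lambda>(i, k). \<Sum>j<n. f j * (u j i * cnj (u j k)))"

lemma spectral_mat_carrier [simp]: "spectral_mat n u f \<in> carrier_mat n n"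
  by (simp add: spectral_mat_def)

lemma spectral_mat_dims [simp]: "dim_row (spectral_mat n u f) = n" "dim_col (spectral_mat n u f) = n"
  by (simp_all add: spectral_mat_def)

lemma spectral_mat_mult:
  assumes u: "orthonormal n {..<n} u"
  shows "spectral_mat n u f * spectral_mat n u g = spectral_mat n u (\<lambda>j. f j * g j)"
proof (rule eq_matI)
  fix i k assume "i < dim_row (spectral_mat n u (\<lambda>j. f j * g j))" "k < dim_col (spectral_mat n u (\<lambda>j. f j * g j))"
  then have ik: "i < n" "k < n" by auto
  have "(spectral_mat n u f * spectral_mat n u g) $$ (i, k)
      = (\<Sum>l<n. (\<Sum>a<n. f a * (u a i * cnj (u a l))) * (\<Sum>b<n. g b * (u b l * cnj (u b k))))"
    unfolding mat_mult_index[OF spectral_mat_carrier spectral_mat_carrier ik]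
    by (rule sum.cong) (use ik in \<open>auto simp: spectral_mat_def\<close>)
  also have "\<dots> = (\<Sum>l<n. \<Sum>a<n. \<Sum>b<n. (f a * u a i * g b * cnj (u b k)) * (cnj (u a l) * u b l))"
    unfolding sum_product by (intro sum.cong refl) (simp add: mult_ac)
  also have "\<dots> = (\<Sum>a<n. \<Sum>l<n. \<Sum>b<n. (f a * u a i * g b * cnj (u b k)) * (cnj (u a l) * u b l))"
    by (rule sum.swap)
  also have "\<dots> = (\<Sum>a<n. \<Sum>b<n. (f a * u a i * g b * cnj (u b k)) * ip n (u a) (u b))"
    unfolding ip_def sum_distrib_left by (intro sum.cong refl sum.swap)
  also have "\<dots> = (\<Sum>a<n. \<Sum>b<n. if a = b then f a * u a i * g a * cnj (u a k) else 0)"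
    by (intro sum.cong refl) (use orthonormalD[OF u] in auto)
  also have "\<dots> = (\<Sum>a<n. f a * g a * (u a i * cnj (u a k)))"
    by (simp add: mult_ac)
  finally show "(spectral_mat n u f * spectral_mat n u g) $$ (i, k) = spectral_mat n u (\<lambda>j. f j * g j) $$ (i, k)"
    using ik by (simp add: spectral_mat_def)
qed auto

lemma spectral_mat_adjoint: "mat_adjoint (spectral_mat n u f) = spectral_mat n u (\<lambda>j. cnj (f j))"
  by (rule eq_matI) (auto simp: spectral_mat_def mult_ac intro!: sum.cong)

text \<open>
  Invert the nonzero eigenvalues. The convention \<open>inverse 0 = 0\<close> takes care of the others.
\<close>

lemma hermitian_penrose_exists:
  assumes H: "H \<in> carrier_mat n n" "mat_adjoint H = H"
  shows "\<exists>X. penrose H X"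
proof -
  obtain u \<mu> where u: "orthonormal n {..<n} u" and eig: "\<forall>j<n. \<forall>i<n. app H (u j) i = \<mu> j * u j i"
    using hermitian_eigenbasis[OF H] by blast
  have HS: "H = spectral_mat n u \<mu>"
  proof (rule eq_matI)
    fix i k assume "i < dim_row (spectral_mat n u \<mu>)" "k < dim_col (spectral_mat n u \<mu>)"
    then have ik: "i < n" "k < n" by auto
    show "H $$ (i, k) = spectral_mat n u \<mu> $$ (i, k)"
      using ik by (simp only: hermitian_diagonalisation(1)[OF H(1) u eig ik]) (simp add: spectral_mat_def)
  qed (use H in auto)
  have inv1: "(\<lambda>j. cnj (\<mu> j * inverse (\<mu> j))) = (\<lambda>j. \<mu> j * inverse (\<mu> j))"
  proof
    show "cnj (\<mu> j * inverse (\<mu> j)) = \<mu> j * inverse (\<mu> j)" for j by (cases "\<mu> j = 0") auto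
  qed
  have inv2: "(\<lambda>j. cnj (inverse (\<mu> j) * \<mu> j)) = (\<lambda>j. inverse (\<mu> j) * \<mu> j)"
  proof
    show "cnj (inverse (\<mu> j) * \<mu> j) = inverse (\<mu> j) * \<mu> j" for j by (cases "\<mu> j = 0") auto
  qed
  have inv3: "(\<lambda>j. \<mu> j * inverse (\<mu> j) * \<mu> j) = \<mu>"
  proof
    show "\<mu> j * inverse (\<mu> j) * \<mu> j = \<mu> j" for j by (cases "\<mu> j = 0") auto
  qed
  have inv4: "(\<lambda>j. inverse (\<mu> j) * \<mu> j * inverse (\<mu> j)) = (\<lambda>j. inverse (\<mu> j))"
  proof
    show "inverse (\<mu> j) * \<mu> j * inverse (\<mu> j) = inverse (\<mu> j)" for j by (cases "\<mu> j = 0") auto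
  qed
  show ?thesis
    unfolding penrose_def HS
    by (intro exI[of _ "spectral_mat n u (\<lambda>j. inverse (\<mu> j))"])
      (simp only: spectral_mat_mult[OF u] spectral_mat_adjoint inv1 inv2 inv3 inv4 spectral_mat_dims
        spectral_mat_carrier simp_thms)
qed

lemma penrose_adjoint:
  assumes H: "H \<in> carrier_mat n n" "mat_adjoint H = H" and X: "penrose H X"
  shows "penrose H (mat_adjoint X)"
proof -
  have Xc: "X \<in> carrier_mat n n" and X1: "H * X * H = H" and X2: "X * H * X = X"
    and X3: "mat_adjoint (H * X) = H * X" and X4: "mat_adjoint (X * H) = X * H"
    using X H(1) by (auto simp: penrose_def)
  have Xa: "mat_adjoint X \<in> carrier_mat n n" using Xc by simp
  have HX: "H * X \<in> carrier_mat n n" and XH: "X * H \<in> carrier_mat n n" using H Xc by auto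
  have a: "H * mat_adjoint X = X * H" using mat_adjoint_mult[OF Xc H(1)] X4 H(2) by simp
  have b: "mat_adjoint X * H = H * X" using mat_adjoint_mult[OF H(1) Xc] X3 H(2) by simp
  have c: "H * mat_adjoint X * H = H"
  proof -
    have "H * mat_adjoint X * H = H * (mat_adjoint X * H)" by (rule assoc_mult_mat[OF H(1) Xa H(1)])
    also have "\<dots> = mat_adjoint (H * X * H)"
      by (simp only: mat_adjoint_mult[OF HX H(1)] mat_adjoint_mult[OF H(1) Xc] H(2))
    finally show ?thesis by (simp only: X1 H(2))
  qed
  have d: "mat_adjoint X * H * mat_adjoint X = mat_adjoint X"
  proof -
    have "mat_adjoint X * H * mat_adjoint X = mat_adjoint X * (H * mat_adjoint X)"
      by (rule assoc_mult_mat[OF Xa H(1) Xa])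
    also have "\<dots> = mat_adjoint (X * H * X)"
      by (simp only: mat_adjoint_mult[OF XH Xc] mat_adjoint_mult[OF Xc H(1)] H(2))
    finally show ?thesis by (simp only: X2)
  qed
  show ?thesis unfolding penrose_def using c d X3 X4 a b Xa H(1) by auto
qed

lemma pinv_hermitian:
  assumes H: "H \<in> carrier_mat n n" "mat_adjoint H = H"
  shows "pinv H \<in> carrier_mat n n" "H * pinv H * H = H" "pinv H * H * pinv H = pinv H"
    "mat_adjoint (pinv H) = pinv H"
proof -
  obtain X where X: "penrose H X" using hermitian_penrose_exists[OF H] by blast
  have "mat_adjoint X = X" by (rule penrose_unique[OF penrose_adjoint[OF H X] X])
  then show "pinv H \<in> carrier_mat n n" "H * pinv H * H = H" "pinv H * H * pinv H = pinv H"
    "mat_adjoint (pinv H) = pinv H"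
    using X H(1) by (auto simp: pinv_eq[OF X] penrose_def)
qed

lemma gram_zero_imp_zero:
  fixes D :: "complex mat"
  assumes D: "D \<in> carrier_mat m n" and z: "mat_adjoint D * D = 0\<^sub>m n n"
  shows "D = 0\<^sub>m m n"
proof (rule eq_matI)
  fix i j assume "i < dim_row (0\<^sub>m m n :: complex mat)" "j < dim_col (0\<^sub>m m n :: complex mat)"
  then have ij: "i < m" "j < n" by auto
  have "0 = (mat_adjoint D * D) $$ (j, j)" using z ij by simp
  also have "\<dots> = (\<Sum>l<m. mat_adjoint D $$ (j, l) * D $$ (l, j))"
    by (rule mat_mult_index) (use D ij in auto)
  also have "\<dots> = ip m (\<lambda>l. D $$ (l, j)) (\<lambda>l. D $$ (l, j))"
    unfolding ip_def by (rule sum.cong) (use D ij in auto)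
  finally have "nsq m (\<lambda>l. D $$ (l, j)) = 0" by (simp add: ip_self)
  then show "D $$ (i, j) = 0\<^sub>m m n $$ (i, j)" using ij by (auto simp: nsq_eq_0_iff)
qed (use D in auto)

definition range_proj :: "complex mat \<Rightarrow> complex mat" where
  "range_proj Z = Z * pinv (mat_adjoint Z * Z) * mat_adjoint Z"

text \<open>
  With \<open>H = Z\<^sup>* Z\<close> and \<open>X\<close> its pseudoinverse, \<open>W = X H - 1\<close> satisfies \<open>H W = 0\<close>. Hence \<open>Z W\<close>
  has Gram matrix 0 and vanishes, which says that the projector fixes \<open>Z\<close>.
\<close>

lemma range_proj:
  assumes Z: "Z \<in> carrier_mat n k"
  shows "range_proj Z \<in> carrier_mat n n" "mat_adjoint (range_proj Z) = range_proj Z"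
    "range_proj Z * Z = Z" "range_proj Z * range_proj Z = range_proj Z"
proof -
  define H where "H = mat_adjoint Z * Z"
  define X where "X = pinv H"
  have Za: "mat_adjoint Z \<in> carrier_mat k n" using Z by simp
  have Hc: "H \<in> carrier_mat k k" unfolding H_def by (rule mult_carrier_mat[OF Za Z])
  have Hh: "mat_adjoint H = H" using mat_adjoint_mult[OF Za Z] by (simp add: H_def)
  have X: "X \<in> carrier_mat k k" "H * X * H = H" "X * H * X = X" "mat_adjoint X = X"
    unfolding X_def using pinv_hermitian[OF Hc Hh] by auto
  have P: "range_proj Z = Z * X * mat_adjoint Z" by (simp add: range_proj_def X_def H_def)
  have ZX: "Z * X \<in> carrier_mat n k" using Z X(1) by simp
  show c: "range_proj Z \<in> carrier_mat n n" unfolding P by (rule mult_carrier_mat[OF ZX Za])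
  have "mat_adjoint (range_proj Z) = Z * (X * mat_adjoint Z)"
    unfolding P by (simp add: mat_adjoint_mult[OF ZX Za] mat_adjoint_mult[OF Z X(1)] X(4))
  then show "mat_adjoint (range_proj Z) = range_proj Z"
    unfolding P using assoc_mult_mat[OF Z X(1) Za] by simp
  have XH: "X * H \<in> carrier_mat k k" using X(1) Hc by simp
  define W where "W = X * H - 1\<^sub>m k"
  have W: "W \<in> carrier_mat k k" unfolding W_def by (intro minus_carrier_mat one_carrier_mat)
  have "H * W = H * (X * H) - H * 1\<^sub>m k"
    unfolding W_def by (rule mult_minus_distrib_mat[OF Hc XH]) simp
  also have "\<dots> = 0\<^sub>m k k" using assoc_mult_mat[OF Hc X(1) Hc] X(2) Hc by simp
  finally have HW: "H * W = 0\<^sub>m k k" .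
  have ZW: "Z * W \<in> carrier_mat n k" by (rule mult_carrier_mat[OF Z W])
  have Wa: "mat_adjoint W \<in> carrier_mat k k" using W by simp
  have "mat_adjoint (Z * W) * (Z * W) = mat_adjoint W * mat_adjoint Z * (Z * W)"
    by (simp only: mat_adjoint_mult[OF Z W])
  also have "\<dots> = mat_adjoint W * (mat_adjoint Z * (Z * W))" by (rule assoc_mult_mat[OF Wa Za ZW])
  also have "mat_adjoint Z * (Z * W) = H * W" unfolding H_def by (rule assoc_mult_mat[OF Za Z W, symmetric])
  finally have "mat_adjoint (Z * W) * (Z * W) = 0\<^sub>m k k" using HW right_mult_zero_mat[OF Wa, of k] by simp
  then have "Z * W = 0\<^sub>m n k" by (rule gram_zero_imp_zero[OF ZW])
  moreover have "Z * W = Z * (X * H) - Z * 1\<^sub>m k"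
    unfolding W_def by (rule mult_minus_distrib_mat[OF Z XH]) simp
  ultimately have eq: "Z * (X * H) - Z = 0\<^sub>m n k" using Z by simp
  have ZXH: "Z * (X * H) = Z"
  proof (rule eq_matI)
    fix i j assume ij: "i < dim_row Z" "j < dim_col Z"
    then have "(Z * (X * H) - Z) $$ (i, j) = 0" using eq Z by simp
    then show "(Z * (X * H)) $$ (i, j) = Z $$ (i, j)" using ij by simp
  qed (use Z XH in auto)
  show PZ: "range_proj Z * Z = Z"
  proof -
    have "range_proj Z * Z = Z * X * H" unfolding P H_def by (rule assoc_mult_mat[OF ZX Za Z])
    also have "\<dots> = Z * (X * H)" by (rule assoc_mult_mat[OF Z X(1) Hc])
    finally show ?thesis using ZXH by simp
  qed
  have XZ: "X * mat_adjoint Z \<in> carrier_mat k n" by (rule mult_carrier_mat[OF X(1) Za])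
  have P': "range_proj Z = Z * (X * mat_adjoint Z)" unfolding P by (rule assoc_mult_mat[OF Z X(1) Za])
  have "range_proj Z * (Z * (X * mat_adjoint Z)) = range_proj Z * Z * (X * mat_adjoint Z)"
    by (rule assoc_mult_mat[OF c Z XZ, symmetric])
  then show "range_proj Z * range_proj Z = range_proj Z" using PZ P' by simp
qed

lemma nystrom_eq:
  assumes B: "B \<in> carrier_mat n n" and \<Omega>: "\<Omega> \<in> carrier_mat n k"
  shows "nystrom (mat_adjoint B * B) \<Omega> = mat_adjoint B * (range_proj (B * \<Omega>) * B)"
proof -
  define Z where "Z = B * \<Omega>"
  define X where "X = pinv (mat_adjoint Z * Z)"
  have Z: "Z \<in> carrier_mat n k" and Ba: "mat_adjoint B \<in> carrier_mat n n"
    and \<Omega>a: "mat_adjoint \<Omega> \<in> carrier_mat k n" using B \<Omega> by (auto simp: Z_def)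
  have Za: "mat_adjoint Z \<in> carrier_mat k n" using Z by simp
  have Y: "mat_adjoint B * B * \<Omega> = mat_adjoint B * Z" unfolding Z_def by (rule assoc_mult_mat[OF Ba B \<Omega>])
  have "mat_adjoint \<Omega> * (mat_adjoint B * Z) = mat_adjoint \<Omega> * mat_adjoint B * Z"
    by (rule assoc_mult_mat[OF \<Omega>a Ba Z, symmetric])
  then have H: "mat_adjoint \<Omega> * (mat_adjoint B * Z) = mat_adjoint Z * Z"
    by (simp add: Z_def mat_adjoint_mult[OF B \<Omega>])
  have Hc: "mat_adjoint Z * Z \<in> carrier_mat k k" by (rule mult_carrier_mat[OF Za Z])
  have X: "X \<in> carrier_mat k k" unfolding X_def
    by (rule pinv_hermitian(1)[OF Hc]) (simp add: mat_adjoint_mult[OF Za Z])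
  have ZX: "Z * X \<in> carrier_mat n k" by (rule mult_carrier_mat[OF Z X])
  have ZB: "mat_adjoint Z * B \<in> carrier_mat k n" by (rule mult_carrier_mat[OF Za B])
  have "nystrom (mat_adjoint B * B) \<Omega> = mat_adjoint B * Z * X * mat_adjoint (mat_adjoint B * Z)"
    unfolding nystrom_def Let_def Y H X_def ..
  also have "mat_adjoint (mat_adjoint B * Z) = mat_adjoint Z * B"
    by (simp add: mat_adjoint_mult[OF Ba Z])
  also have "mat_adjoint B * Z * X = mat_adjoint B * (Z * X)" by (rule assoc_mult_mat[OF Ba Z X])
  also have "mat_adjoint B * (Z * X) * (mat_adjoint Z * B) = mat_adjoint B * (Z * X * (mat_adjoint Z * B))"
    by (rule assoc_mult_mat[OF Ba ZX ZB])
  also have "Z * X * (mat_adjoint Z * B) = Z * X * mat_adjoint Z * B"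
    by (rule assoc_mult_mat[OF ZX Za B, symmetric])
  finally show ?thesis by (simp add: range_proj_def X_def Z_def)
qed

lemma cmod_ip_le: "cmod (ip n x y) \<le> (nsq n x + nsq n y) / 2"
proof -
  have "cmod (ip n x y) \<le> (\<Sum>i<n. cmod (x i) * cmod (y i))"
    unfolding ip_def by (intro order.trans[OF norm_sum]) (simp add: norm_mult)
  also have "\<dots> \<le> (\<Sum>i<n. ((cmod (x i))\<^sup>2 + (cmod (y i))\<^sup>2) / 2)"
  proof (rule sum_mono)
    fix i
    have "0 \<le> (cmod (x i) - cmod (y i))\<^sup>2" by simp
    then show "cmod (x i) * cmod (y i) \<le> ((cmod (x i))\<^sup>2 + (cmod (y i))\<^sup>2) / 2"
      by (simp add: power2_diff)
  qed
  also have "\<dots> = (nsq n x + nsq n y) / 2"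
    by (simp add: nsq_def sum.distrib flip: sum_divide_distrib)
  finally show ?thesis .
qed

lemma nsq_projection_le:
  assumes Q: "Q \<in> carrier_mat n n" "mat_adjoint Q = Q" "Q * Q = Q"
  shows "nsq n (app Q x) \<le> nsq n x"
proof -
  have QQ: "ip n y (app Q z) = ip n (app Q y) (app Q z)" for y z
  proof -
    have "ip n y (app Q z) = ip n y (app Q (app Q z))"
    proof (rule ip_cong)
      fix i assume "i < n"
      from app_mult[OF Q(1) Q(1) this, of z] show "app Q z i = app Q (app Q z) i"
        by (simp only: Q(3))
    qed simp
    also have "\<dots> = ip n (app Q y) (app Q z)" using ip_app[OF Q(1), of y "app Q z"] Q(2) by simp
    finally show ?thesis .
  qed
  have a: "ip n x (app Q x) = of_real (nsq n (app Q x))" using QQ[of x x] by (simp add: ip_self)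
  have b: "ip n (app Q x) x = of_real (nsq n (app Q x))"
    using arg_cong[OF a, of cnj] by (simp add: cnj_ip)
  have "complex_of_real (nsq n (\<lambda>i. x i - app Q x i)) = ip n (\<lambda>i. x i - app Q x i) (\<lambda>i. x i - app Q x i)"
    by (simp add: ip_self)
  also have "\<dots> = of_real (nsq n x - nsq n (app Q x))"
    unfolding ip_diff ip_left_diff a b by (simp add: ip_self)
  finally have "nsq n (\<lambda>i. x i - app Q x i) = nsq n x - nsq n (app Q x)"
    using of_real_eq_iff by blast
  then show ?thesis using nsq_nonneg[of n "\<lambda>i. x i - app Q x i"] by linarith
qed

definition frob_sq :: "complex mat \<Rightarrow> real" where
  "frob_sq M = (\<Sum>i<dim_row M. \<Sum>j<dim_col M. (cmod (M $$ (i, j)))\<^sup>2)"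

lemma app_row: "M \<in> carrier_mat m n \<Longrightarrow> app M x i = ip n (\<lambda>j. cnj (M $$ (i, j))) x"
  by (simp add: app_def ip_def)

lemma sum_nsq_app_le_frob:
  assumes M: "M \<in> carrier_mat m n" and J: "finite J" and u: "orthonormal n J u"
  shows "(\<Sum>j\<in>J. nsq m (app M (u j))) \<le> frob_sq M"
proof -
  have "(\<Sum>j\<in>J. nsq m (app M (u j))) = (\<Sum>i<m. \<Sum>j\<in>J. (cmod (app M (u j) i))\<^sup>2)"
    unfolding nsq_def by (rule sum.swap)
  also have "\<dots> \<le> (\<Sum>i<m. nsq n (\<lambda>j. cnj (M $$ (i, j))))"
    unfolding app_row[OF M] cmod_ip_commute[of n _ "u _"] by (intro sum_mono bessel J u)
  also have "\<dots> = frob_sq M" using M by (simp add: frob_sq_def nsq_def)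
  finally show ?thesis .
qed

lemma frob_sq_basis:
  assumes M: "M \<in> carrier_mat m n" and u: "orthonormal n {..<n} u"
  shows "frob_sq M = (\<Sum>j<n. nsq m (app M (u j)))"
proof -
  have "(\<Sum>j<n. nsq m (app M (u j))) = (\<Sum>i<m. \<Sum>j<n. (cmod (app M (u j) i))\<^sup>2)"
    unfolding nsq_def by (rule sum.swap)
  also have "\<dots> = (\<Sum>i<m. nsq n (\<lambda>j. cnj (M $$ (i, j))))"
    unfolding app_row[OF M] cmod_ip_commute[of n _ "u _"] by (simp add: parseval[OF u])
  also have "\<dots> = frob_sq M" using M by (simp add: frob_sq_def nsq_def)
  finally show ?thesis by simp
qed

text \<open>
  Put \<open>Q = 1 - P\<close> and \<open>E = B - B \<Omega> Y\<close>. Since \<open>Q\<close> annihilates \<open>B \<Omega>\<close>, the error \<open>B\<^sup>* Q B\<close> is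
  also \<open>E\<^sup>* Q E\<close>, and pairing it with orthonormal systems costs at most the squared Frobenius
  norm of \<open>E\<close>.
\<close>

lemma nystrom_error_le_frob:
  assumes B: "B \<in> carrier_mat n n" and \<Omega>: "\<Omega> \<in> carrier_mat n k" and Y: "Y \<in> carrier_mat k n"
  shows "schatten_norm 1 (mat_adjoint B * B - nystrom (mat_adjoint B * B) \<Omega>) \<le> frob_sq (B - B * \<Omega> * Y)"
proof -
  define Z where "Z = B * \<Omega>"
  define P where "P = range_proj Z"
  define Q where "Q = 1\<^sub>m n - P"
  define E where "E = B - Z * Y"
  define N where "N = mat_adjoint B * B - nystrom (mat_adjoint B * B) \<Omega>"
  have Z: "Z \<in> carrier_mat n k" using B \<Omega> by (simp add: Z_def)
  note P = range_proj[OF Z, folded P_def]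
  have Q: "Q \<in> carrier_mat n n" unfolding Q_def by (rule minus_carrier_mat[OF P(1)])
  have Qa: "mat_adjoint Q = Q" unfolding Q_def using mat_adjoint_minus[OF one_carrier_mat P(1)] P(2) by simp
  have QZ: "Q * Z = 0\<^sub>m n k"
    unfolding Q_def using minus_mult_distrib_mat[OF one_carrier_mat P(1) Z] P(3) Z by simp
  have QP: "Q * P = 0\<^sub>m n n"
    unfolding Q_def using minus_mult_distrib_mat[OF one_carrier_mat P(1) P(1)] P(1,4) by simp
  have QQ: "Q * Q = Q"
  proof -
    have "Q * Q = Q * 1\<^sub>m n - Q * P"
      by (subst (2) Q_def) (rule mult_minus_distrib_mat[OF Q one_carrier_mat P(1)])
    then show ?thesis using QP Q by (auto intro!: eq_matI)
  qed
  have ZY: "Z * Y \<in> carrier_mat n n" by (rule mult_carrier_mat[OF Z Y])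
  have E: "E \<in> carrier_mat n n" unfolding E_def by (rule minus_carrier_mat[OF ZY])
  have Ba: "mat_adjoint B \<in> carrier_mat n n" and Ea: "mat_adjoint E \<in> carrier_mat n n" using B E by auto
  have PB: "P * B \<in> carrier_mat n n" by (rule mult_carrier_mat[OF P(1) B])
  have QB: "Q * B \<in> carrier_mat n n" by (rule mult_carrier_mat[OF Q B])
  have QE: "Q * E = Q * B"
  proof -
    have "Q * E = Q * B - Q * (Z * Y)" unfolding E_def by (rule mult_minus_distrib_mat[OF Q B ZY])
    also have "Q * (Z * Y) = Q * Z * Y" by (rule assoc_mult_mat[OF Q Z Y, symmetric])
    also have "\<dots> = 0\<^sub>m n n" using QZ Y by simp
    also have "Q * B - 0\<^sub>m n n = Q * B" by (rule eq_matI) (use Q B in \<open>auto simp del: index_mult_mat(1)\<close>)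
    finally show ?thesis .
  qed
  have N: "N = mat_adjoint E * (Q * E)"
  proof -
    have "N = mat_adjoint B * B - mat_adjoint B * (P * B)"
      unfolding N_def nystrom_eq[OF B \<Omega>] P_def Z_def ..
    also have "\<dots> = mat_adjoint B * (B - P * B)" by (rule mult_minus_distrib_mat[OF Ba B PB, symmetric])
    also have "B - P * B = Q * B"
      unfolding Q_def using minus_mult_distrib_mat[OF one_carrier_mat P(1) B] B by simp
    also have "\<dots> = Q * E" by (rule QE[symmetric])
    also have "mat_adjoint B * (Q * E) = mat_adjoint B * Q * E" by (rule assoc_mult_mat[OF Ba Q E, symmetric])
    also have "mat_adjoint B * Q = mat_adjoint (Q * B)" by (simp add: mat_adjoint_mult[OF Q B] Qa)
    also have "\<dots> = mat_adjoint E * Q" unfolding QE[symmetric] by (simp add: mat_adjoint_mult[OF Q E] Qa)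
    also have "mat_adjoint E * Q * E = mat_adjoint E * (Q * E)" by (rule assoc_mult_mat[OF Ea Q E])
    finally show ?thesis .
  qed
  have Nc: "N \<in> carrier_mat n n" unfolding N using Ea Q E by (intro mult_carrier_mat[of _ n n]) auto
  obtain J u v where J: "finite J" and u: "orthonormal n J u" and v: "orthonormal n J v"
    and eq: "(\<Sum>i\<in>J. ip n (v i) (app N (u i))) = complex_of_real (schatten_norm 1 N)"
    by (rule schatten_one_attained[OF Nc])
  have pairing: "ip n y (app N x) = ip n (app E y) (app Q (app E x))" for x y
  proof -
    have "ip n y (app N x) = ip n y (app (mat_adjoint E) (app (Q * E) x))"
      unfolding N by (rule ip_cong) (use app_mult[OF Ea, of "Q * E" n] Q E in auto)
    also have "\<dots> = ip n (app E y) (app (Q * E) x)" using ip_app[OF Ea, of y "app (Q * E) x"] by simp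
    also have "\<dots> = ip n (app E y) (app Q (app E x))"
      by (rule ip_cong) (use app_mult[OF Q E] in auto)
    finally show ?thesis .
  qed
  have "schatten_norm 1 N \<le> cmod (\<Sum>i\<in>J. ip n (v i) (app N (u i)))" by (simp add: eq)
  also have "\<dots> \<le> (\<Sum>i\<in>J. cmod (ip n (app E (v i)) (app Q (app E (u i)))))"
    unfolding pairing by (rule norm_sum)
  also have "\<dots> \<le> (\<Sum>i\<in>J. (nsq n (app E (v i)) + nsq n (app E (u i))) / 2)"
  proof (rule sum_mono)
    fix i
    have "cmod (ip n (app E (v i)) (app Q (app E (u i))))
        \<le> (nsq n (app E (v i)) + nsq n (app Q (app E (u i)))) / 2" by (rule cmod_ip_le)
    also have "\<dots> \<le> (nsq n (app E (v i)) + nsq n (app E (u i))) / 2"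
      by (intro divide_right_mono add_mono order.refl nsq_projection_le[OF Q Qa QQ]) simp
    finally show "cmod (ip n (app E (v i)) (app Q (app E (u i)))) \<le> (nsq n (app E (v i)) + nsq n (app E (u i))) / 2" .
  qed
  also have "\<dots> = ((\<Sum>i\<in>J. nsq n (app E (v i))) + (\<Sum>i\<in>J. nsq n (app E (u i)))) / 2"
    by (simp add: sum.distrib flip: sum_divide_distrib)
  also have "\<dots> \<le> frob_sq E"
    using sum_nsq_app_le_frob[OF E J u] sum_nsq_app_le_frob[OF E J v] by simp
  finally show ?thesis unfolding N_def E_def Z_def .
qed

text \<open>
  On the vectors \<open>v c\<close> with \<open>c \<ge> \<rho>\<close> the quadratic form of \<open>C\<close> vanishes, so the sum is a
  pairing of \<open>A - C\<close> with the system \<open>v\<close> on both sides.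
\<close>

lemma tail_le_schatten_one:
  assumes B: "B \<in> carrier_mat n n" and C: "C \<in> carrier_mat n n"
    and v: "orthonormal n {..<n} v"
    and vC: "\<And>c j. \<rho> \<le> c \<Longrightarrow> c < n \<Longrightarrow> j < n \<Longrightarrow> ip n (v c) (\<lambda>i. C $$ (i, j)) = 0"
  shows "(\<Sum>c\<in>{\<rho>..<n}. nsq n (app B (v c))) \<le> schatten_norm 1 (mat_adjoint B * B - C)"
proof -
  have Ba: "mat_adjoint B \<in> carrier_mat n n" using B by simp
  have A: "mat_adjoint B * B \<in> carrier_mat n n" by (rule mult_carrier_mat[OF Ba B])
  have vJ: "orthonormal n {\<rho>..<n} v" by (rule orthonormal_subset[OF v]) auto
  have eq: "ip n (v c) (app (mat_adjoint B * B - C) (v c)) = of_real (nsq n (app B (v c)))"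
    if c: "c \<in> {\<rho>..<n}" for c
  proof -
    have "ip n (v c) (app C (v c)) = (\<Sum>j<n. v c j * ip n (v c) (\<lambda>i. C $$ (i, j)))"
    proof -
      have "app C (v c) = (\<lambda>i. \<Sum>j<n. v c j * C $$ (i, j))" using C by (simp add: app_def mult.commute)
      then show ?thesis by (simp only: ip_lincomb)
    qed
    then have 0: "ip n (v c) (app C (v c)) = 0" using vC c by simp
    have "ip n (v c) (app (mat_adjoint B * B - C) (v c))
        = ip n (v c) (\<lambda>i. app (mat_adjoint B) (app B (v c)) i - app C (v c) i)"
      by (rule ip_cong) (simp_all only: app_minus_mat[OF A C] app_mult[OF Ba B])
    also have "\<dots> = ip n (app B (v c)) (app B (v c))"
      using ip_app[OF Ba, of "v c" "app B (v c)"] 0 by (simp add: ip_diff)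
    finally show ?thesis by (simp add: ip_self)
  qed
  have "(\<Sum>c\<in>{\<rho>..<n}. nsq n (app B (v c)))
      = (\<Sum>c\<in>{\<rho>..<n}. cmod (ip n (v c) (app (mat_adjoint B * B - C) (v c))))"
    by (rule sum.cong) (simp_all add: eq)
  also have "\<dots> \<le> schatten_norm 1 (mat_adjoint B * B - C)"
    by (rule orthonormal_pairing_le_schatten_one[OF minus_carrier_mat[OF C] _ vJ vJ]) simp
  finally show ?thesis .
qed

text \<open>
  Take \<open>Y = R X\<close> with \<open>X = (\<Sum>c<\<rho>. x\<^sub>c v\<^sub>c\<^sup>*)\<close>. In the basis \<open>v\<close> the matrix
  \<open>G X\<close> sends \<open>v\<^sub>c\<close> to \<open>v\<^sub>c\<close> plus terms in the \<open>v\<^sub>l\<close> with \<open>l \<ge> \<rho>\<close> if \<open>c < \<rho>\<close>, and to 0 otherwise.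
\<close>

lemma nystrom_error_bound:
  assumes B: "B \<in> carrier_mat n n" and G: "G \<in> carrier_mat n k"
    and \<Omega>: "\<Omega> \<in> carrier_mat n k" and R: "R \<in> carrier_mat k k" and GR: "G = \<Omega> * R"
    and v: "orthonormal n {..<n} v" and \<rho>: "\<rho> \<le> n"
    and W: "\<And>l j. l < n \<Longrightarrow> j < k \<Longrightarrow> W l j = ip n (v l) (\<lambda>i. G $$ (i, j))"
    and dual: "\<And>l c. l < \<rho> \<Longrightarrow> c < \<rho> \<Longrightarrow> (\<Sum>j<k. W l j * x c j) = (if l = c then 1 else 0)"
  shows "schatten_norm 1 (mat_adjoint B * B - nystrom (mat_adjoint B * B) \<Omega>)
    \<le> (\<Sum>c\<in>{\<rho>..<n}. nsq n (app B (v c)))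
      + (\<Sum>c<\<rho>. nsq n (\<lambda>a. \<Sum>l\<in>{\<rho>..<n}. (\<Sum>j<k. W l j * x c j) * app B (v l) a))"
proof -
  define X where "X = mat k n (\<lambda>(j, i). \<Sum>c<\<rho>. x c j * cnj (v c i))"
  have X: "X \<in> carrier_mat k n" by (simp add: X_def)
  have RX: "R * X \<in> carrier_mat k n" by (rule mult_carrier_mat[OF R X])
  have GX: "G * X \<in> carrier_mat n n" by (rule mult_carrier_mat[OF G X])
  have B\<Omega>: "B * \<Omega> \<in> carrier_mat n k" by (rule mult_carrier_mat[OF B \<Omega>])
  define E where "E = B - B * \<Omega> * (R * X)"
  have BGX: "B * \<Omega> * (R * X) = B * (G * X)"
    by (simp only: assoc_mult_mat[OF B \<Omega> RX] assoc_mult_mat[OF \<Omega> R X] GR)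
  have BGXc: "B * (G * X) \<in> carrier_mat n n" by (rule mult_carrier_mat[OF B GX])
  have E: "E \<in> carrier_mat n n" unfolding E_def BGX by (rule minus_carrier_mat[OF BGXc])
  have Xv: "app X (v c) j = (if c < \<rho> then x c j else 0)" if "c < n" "j < k" for c j
  proof -
    have "app X (v c) j = (\<Sum>i<n. (\<Sum>d<\<rho>. x d j * cnj (v d i)) * v c i)"
      using that by (simp add: app_def X_def)
    also have "\<dots> = (\<Sum>d<\<rho>. x d j * ip n (v d) (v c))"
      unfolding ip_def sum_distrib_left sum_distrib_right mult.assoc by (rule sum.swap)
    also have "\<dots> = (\<Sum>d<\<rho>. if d = c then x d j else 0)"
      by (rule sum.cong) (use orthonormalD[OF v] that \<rho> in auto)
    finally show ?thesis by simp
  qed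
  have Gx: "app G y i = (\<Sum>l<n. (\<Sum>j<k. W l j * y j) * v l i)" if i: "i < n" for y i
  proof -
    have "app G y i = (\<Sum>l<n. ip n (v l) (app G y) * v l i)" by (rule orthonormal_expand[OF v i])
    also have "\<dots> = (\<Sum>l<n. (\<Sum>j<k. W l j * y j) * v l i)"
    proof (rule sum.cong)
      fix l assume l: "l \<in> {..<n}"
      have "app G y = (\<lambda>i. \<Sum>j<k. y j * G $$ (i, j))" using G by (simp add: app_def mult.commute)
      then have "ip n (v l) (app G y) = (\<Sum>j<k. y j * ip n (v l) (\<lambda>i. G $$ (i, j)))"
        by (simp only: ip_lincomb)
      also have "\<dots> = (\<Sum>j<k. W l j * y j)"
        by (rule sum.cong) (use W l in \<open>auto simp: mult.commute\<close>)
      finally show "ip n (v l) (app G y) * v l i = (\<Sum>j<k. W l j * y j) * v l i" by simp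
    qed simp
    finally show ?thesis .
  qed
  have Ev: "app E (v c) i = app B (\<lambda>i. v c i - app G (app X (v c)) i) i" if "i < n" for c i
  proof -
    have "app E (v c) i = app B (v c) i - app (B * (G * X)) (v c) i"
      unfolding E_def BGX by (rule app_minus_mat[OF B BGXc that])
    also have "app (B * (G * X)) (v c) i = app B (app (G * X) (v c)) i" by (rule app_mult[OF B GX that])
    also have "app B (app (G * X) (v c)) = app B (app G (app X (v c)))"
      by (rule app_cong) (use app_mult[OF G X] B in auto)
    finally show ?thesis by (simp only: app_diff)
  qed
  have hi: "nsq n (app E (v c)) = nsq n (app B (v c))" if c: "\<rho> \<le> c" "c < n" for c
  proof (rule nsq_cong)
    fix i assume i: "i < n"
    have "app G (app X (v c)) = app G (\<lambda>j. 0)" by (rule app_cong) (use Xv c G in auto)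
    then have "app G (app X (v c)) = (\<lambda>i. 0)" by (simp add: app_def)
    then show "app E (v c) i = app B (v c) i" using Ev[OF i, of c] by simp
  qed
  have lo: "nsq n (app E (v c)) = nsq n (\<lambda>a. \<Sum>l\<in>{\<rho>..<n}. (\<Sum>j<k. W l j * x c j) * app B (v l) a)"
    if c: "c < \<rho>" for c
  proof -
    let ?w = "\<lambda>l. \<Sum>j<k. W l j * x c j"
    have GX': "app G (app X (v c)) = app G (x c)" by (rule app_cong) (use Xv c \<rho> G in auto)
    have split: "v c i - app G (x c) i = (\<Sum>l\<in>{\<rho>..<n}. (- ?w l) * v l i)" if i: "i < n" for i
    proof -
      have "app G (x c) i = (\<Sum>l\<in>{..<\<rho>} \<union> {\<rho>..<n}. ?w l * v l i)"
        unfolding Gx[OF i] by (rule sum.cong) (use \<rho> in auto)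
      also have "\<dots> = (\<Sum>l<\<rho>. ?w l * v l i) + (\<Sum>l\<in>{\<rho>..<n}. ?w l * v l i)"
        by (rule sum.union_disjoint) auto
      also have "(\<Sum>l<\<rho>. ?w l * v l i) = (\<Sum>l<\<rho>. if l = c then v l i else 0)"
        by (rule sum.cong) (use dual c in auto)
      also have "\<dots> = v c i" using c by simp
      finally show ?thesis by (simp add: sum_negf)
    qed
    have "app E (v c) i = - (\<Sum>l\<in>{\<rho>..<n}. ?w l * app B (v l) i)" if i: "i < n" for i
    proof -
      have "app E (v c) i = app B (\<lambda>i. \<Sum>l\<in>{\<rho>..<n}. (- ?w l) * v l i) i"
        unfolding Ev[OF i] GX' by (rule fun_cong[OF app_cong]) (use split B in auto)
      then show ?thesis unfolding app_lincomb by (simp add: sum_negf)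
    qed
    then show ?thesis by (simp add: nsq_def)
  qed
  have "frob_sq E = (\<Sum>c\<in>{..<\<rho>} \<union> {\<rho>..<n}. nsq n (app E (v c)))"
    unfolding frob_sq_basis[OF E v] by (rule sum.cong) (use \<rho> in auto)
  also have "\<dots> = (\<Sum>c<\<rho>. nsq n (app E (v c))) + (\<Sum>c\<in>{\<rho>..<n}. nsq n (app E (v c)))"
    by (rule sum.union_disjoint) auto
  also have "(\<Sum>c\<in>{\<rho>..<n}. nsq n (app E (v c))) = (\<Sum>c\<in>{\<rho>..<n}. nsq n (app B (v c)))"
    by (rule sum.cong) (use hi in auto)
  also have "(\<Sum>c<\<rho>. nsq n (app E (v c)))
      = (\<Sum>c<\<rho>. nsq n (\<lambda>a. \<Sum>l\<in>{\<rho>..<n}. (\<Sum>j<k. W l j * x c j) * app B (v l) a))"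
    by (rule sum.cong) (use lo in auto)
  finally show ?thesis
    using nystrom_error_le_frob[OF B \<Omega> RX] by (simp add: E_def)
qed

text \<open>
  A maximal independent set of columns of \<open>C\<close>. Taking columns, rather than any
  spanning set, keeps the entries in \<open>F\<close>.
\<close>

lemma low_rank_columns:
  assumes C: "C \<in> carrier_mat n n" and rank: "mat_rank C \<le> \<rho>" and CF: "elements_mat C \<subseteq> F"
    and F: "real_or_complex F"
  obtains S where "\<And>s i. s < \<rho> \<Longrightarrow> i < n \<Longrightarrow> S s i \<in> F"
    "\<And>x j. \<lbrakk>\<And>s. s < \<rho> \<Longrightarrow> ip n (S s) x = 0\<rbrakk> \<Longrightarrow> j < n \<Longrightarrow> ip n (\<lambda>i. C $$ (i, j)) x = 0"
proof -
  interpret vec_space "TYPE(complex)" n .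
  have rk: "rank C \<le> \<rho>" using rank C by simp
  have fin: "finite (set (cols C))" by simp
  have colsC: "set (cols C) \<subseteq> carrier_vec n" using cols_dim[of C] C by simp
  let ?P = "\<lambda>T. T \<subseteq> set (cols C) \<and> lin_indpt T"
  have P0: "?P {}" by (auto simp: lin_dep_def)
  have "\<exists>T. finite T \<and> maximal T ?P \<and> {} \<subseteq> T"
    by (rule maximal_exists_superset[of "set (cols C)" ?P "{}", OF fin conjunct1 P0])
  then obtain T where T: "finite T" "maximal T ?P" by (elim exE conjE)
  have card: "card T \<le> \<rho>" using rank_card_indpt[OF C T(2)] rk by simp
  have Tsub: "T \<subseteq> set (cols C)" and Tind: "lin_indpt T" using T(2) by (auto simp: maximal_def)
  have Tc: "T \<subseteq> carrier_vec n" using Tsub colsC by blast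
  \<comment> \<open>the basis columns are enumerated and padded with zeros up to length \<open>\<rho>\<close>\<close>
  obtain ts where ts: "set ts = T" "length ts = card T"
    using finite_distinct_list[OF T(1)] distinct_card by metis
  define S where "S = (\<lambda>s i. if s < length ts then ts ! s $ i else 0)"
  show ?thesis
  proof (rule that)
    fix s i assume si: "s < \<rho>" "i < n"
    show "S s i \<in> F"
    proof (cases "s < length ts")
      case True
      then have "ts ! s \<in> set (cols C)" using ts Tsub nth_mem by blast
      then obtain j where j: "j < n" "ts ! s = col C j" using C by (auto simp: cols_def)
      then have "S s i = C $$ (i, j)" using True si C by (simp add: S_def)
      moreover have "C $$ (i, j) \<in> elements_mat C" using C si j by auto
      ultimately show ?thesis using CF by auto
    next
      case False
      then show ?thesis using real_or_complex_closed(1)[OF F] by (simp add: S_def)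
    qed
  next
    fix x j assume orth: "\<And>s. s < \<rho> \<Longrightarrow> ip n (S s) x = 0" and j: "j < n"
    have tx: "ip n (\<lambda>i. t $ i) x = 0" if "t \<in> T" for t
    proof -
      have "t \<in> set ts" using that ts(1) by simp
      then obtain s where s: "s < length ts" "t = ts ! s" unfolding in_set_conv_nth by blast
      have "s < \<rho>" using s(1) ts(2) card by simp
      then have "ip n (S s) x = 0" by (rule orth)
      moreover have "S s = (\<lambda>i. t $ i)" using s by (simp add: S_def)
      ultimately show ?thesis by simp
    qed
    have cj: "col C j \<in> set (cols C)" using C j by (auto simp: cols_def)
    have "\<exists>a. True \<and> lincomb a T = col C j"
    proof (rule finite_in_span[OF T(1) Tc])
      show "col C j \<in> span T"
    proof (cases "col C j \<in> T")
      case True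
      then show ?thesis using in_own_span[OF Tc] by blast
    next
      case False
      have "\<not> lin_indpt (T \<union> {col C j})"
      proof
        assume "lin_indpt (T \<union> {col C j})"
        then have "T \<union> {col C j} = T" using T(2) Tsub cj unfolding maximal_def by blast
        then show False using False by blast
      qed
      then show ?thesis using lin_dep_iff_in_span[OF Tc Tind _ False] colsC cj by blast
    qed
    qed
    then obtain a where a: "lincomb a T = col C j" by (elim exE conjE)
    have "C $$ (i, j) = (\<Sum>t\<in>T. a t * t $ i)" if "i < n" for i
    proof -
      have "C $$ (i, j) = col C j $ i" using C that j by simp
      also have "\<dots> = (\<Sum>t\<in>T. a t * t $ i)" unfolding a[symmetric] by (rule lincomb_index[OF that Tc])
      finally show ?thesis .
    qed
    then have "ip n (\<lambda>i. C $$ (i, j)) x = ip n (\<lambda>i. \<Sum>t\<in>T. a t * t $ i) x"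
      by (intro ip_cong) auto
    also have "\<dots> = (\<Sum>t\<in>T. cnj (a t) * ip n (\<lambda>i. t $ i) x)" by (rule ip_lincomb_left)
    also have "\<dots> = 0" using tx by simp
    finally show "ip n (\<lambda>i. C $$ (i, j)) x = 0" .
  qed
qed

section \<open>The standard normal distribution on the base field\<close>

text \<open>
  Lebesgue measure on \<open>F\<close>, carried by the complex numbers in both cases, so that one type
  of random matrix serves for real and complex test matrices.
\<close>

definition ref_measure :: "complex set \<Rightarrow> complex measure" where
  "ref_measure F = (if F = \<real> then distr lborel borel complex_of_real
     else distr (lborel :: (real \<times> real) measure) borel (\<lambda>(x, y). Complex x y))"

definition real_dim :: "complex set \<Rightarrow> nat" where
  "real_dim F = (if F = \<real> then 1 else 2)"

text \<open>
  The normalisation is the one in which every \<^emph>\<open>real\<close> coordinate has variance 1; a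
  variable with this density has second moment \<open>real_dim F\<close>.
\<close>

definition gauss_weight :: "complex set \<Rightarrow> complex \<Rightarrow> real" where
  "gauss_weight F z = exp (- (cmod z)\<^sup>2 / 2) / sqrt (2 * pi) ^ real_dim F"

definition gauss :: "complex set \<Rightarrow> complex measure" where
  "gauss F = density (ref_measure F) (\<lambda>z. ennreal (gauss_weight F z))"

lemma gauss_weight_nonneg [simp]: "0 \<le> gauss_weight F z"
  by (simp add: gauss_weight_def)

lemma gauss_weight_measurable [measurable]: "gauss_weight F \<in> borel_measurable borel"
  unfolding gauss_weight_def by measurable

lemma sets_ref_measure [measurable_cong, simp]: "sets (ref_measure F) = sets borel"
  by (simp add: ref_measure_def)

lemma space_ref_measure [simp]: "space (ref_measure F) = UNIV"
  by (simp add: ref_measure_def)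

lemma sets_gauss [measurable_cong, simp]: "sets (gauss F) = sets borel"
  by (simp add: gauss_def)

lemma space_gauss [simp]: "space (gauss F) = UNIV"
  by (simp add: gauss_def)

lemma Complex_measurable [measurable]: "(\<lambda>(x, y). Complex x y) \<in> borel_measurable borel"
  by (intro borel_measurable_continuous_onI) (auto simp: split_beta Complex_eq intro!: continuous_intros)

text \<open>
  The real line and the plane as isometric images of Euclidean spaces. The invariances of
  Lebesgue measure are transported once for both.
\<close>

locale isometric_parametrisation =
  fixes \<iota> :: "'e :: euclidean_space \<Rightarrow> complex"
  assumes iso_measurable [measurable]: "\<iota> \<in> borel_measurable borel"
    and iso_add: "\<iota> (x + y) = \<iota> x + \<iota> y"
    and iso_norm: "cmod (\<iota> x) = norm x"
begin

lemma iso_uminus: "\<iota> (- x) = - \<iota> x"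
proof -
  have "\<iota> 0 = 0" using iso_norm[of 0] by simp
  then show ?thesis using iso_add[of x "- x"] by (simp add: eq_neg_iff_add_eq_0 add.commute)
qed

lemma sigma_finite: "sigma_finite_measure (distr lborel borel \<iota>)"
proof (rule sigma_finite_measure.intro, intro exI[of _ "range (\<lambda>n::nat. cball (0::complex) n)"] conjI ballI)
  show "countable (range (\<lambda>n::nat. cball (0::complex) n))" by simp
  show "range (\<lambda>n::nat. cball (0::complex) n) \<subseteq> sets (distr lborel borel \<iota>)" by auto
  show "\<Union> (range (\<lambda>n::nat. cball (0::complex) n)) = space (distr lborel borel \<iota>)"
    using real_arch_simple by auto
  fix a assume "a \<in> range (\<lambda>n::nat. cball (0::complex) n)"
  then obtain n :: nat where a: "a = cball 0 n" by blast
  have "emeasure (distr lborel borel \<iota>) a = emeasure lborel (cball (0::'e) n)"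
    unfolding a by (subst emeasure_distr) (auto simp: vimage_def iso_norm cball_def dist_norm intro!: arg_cong[where f="emeasure lborel"])
  also have "\<dots> \<noteq> \<infinity>" using emeasure_bounded_finite[of "cball (0::'e) n"] by (simp add: less_top)
  finally show "emeasure (distr lborel borel \<iota>) a \<noteq> \<infinity>" .
qed

lemma translation:
  assumes [measurable]: "f \<in> borel_measurable borel"
  shows "(\<integral>\<^sup>+z. f (z + \<iota> b) \<partial>distr lborel borel \<iota>) = (\<integral>\<^sup>+z. f z \<partial>distr lborel borel \<iota>)"
proof -
  have "(\<integral>\<^sup>+z. f (z + \<iota> b) \<partial>distr lborel borel \<iota>) = (\<integral>\<^sup>+x. f (\<iota> (b + x)) \<partial>lborel)"
    by (simp add: nn_integral_distr iso_add add.commute)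
  also have "\<dots> = (\<integral>\<^sup>+x. f (\<iota> x) \<partial>distr lborel borel ((+) b))"
    by (simp add: nn_integral_distr)
  also have "\<dots> = (\<integral>\<^sup>+z. f z \<partial>distr lborel borel \<iota>)"
    by (simp add: nn_integral_distr lborel_distr_plus)
  finally show ?thesis .
qed

lemma reflection:
  assumes [measurable]: "f \<in> borel_measurable borel"
  shows "(\<integral>\<^sup>+z. f (- z) \<partial>distr lborel borel \<iota>) = (\<integral>\<^sup>+z. f z \<partial>distr lborel borel \<iota>)"
proof -
  have neg: "distr lborel borel uminus = (lborel :: 'e measure)"
  proof -
    have "lborel = density (distr lborel borel (\<lambda>x::'e. 0 + (-1) *\<^sub>R x)) (\<lambda>_. ennreal (\<bar>-1\<bar> ^ DIM('e)))"
      by (rule lborel_affine) simp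
    then show ?thesis by (simp add: density_1)
  qed
  have "(\<integral>\<^sup>+z. f (- z) \<partial>distr lborel borel \<iota>) = (\<integral>\<^sup>+x. f (\<iota> (- x)) \<partial>lborel)"
    by (simp add: nn_integral_distr iso_uminus)
  also have "\<dots> = (\<integral>\<^sup>+x. f (\<iota> x) \<partial>distr lborel borel uminus)"
    by (simp add: nn_integral_distr)
  also have "\<dots> = (\<integral>\<^sup>+z. f z \<partial>distr lborel borel \<iota>)"
    by (simp add: nn_integral_distr neg)
  finally show ?thesis .
qed

end

interpretation real_param: isometric_parametrisation complex_of_real
  by unfold_locales auto

interpretation complex_param: isometric_parametrisation "\<lambda>(x, y). Complex x y"
  by unfold_locales (auto simp: norm_prod_def complex_norm complex_eq_iff)

lemma sigma_finite_ref_measure: "sigma_finite_measure (ref_measure F)"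
  using real_param.sigma_finite complex_param.sigma_finite by (simp add: ref_measure_def)

text \<open>
  The real case is why the translation must lie in \<open>F\<close>: the measure lives on a line.
\<close>

lemma ref_measure_translation:
  assumes F: "F = \<real> \<or> F = UNIV" and a: "a \<in> F" and f: "f \<in> borel_measurable borel"
  shows "(\<integral>\<^sup>+z. f (z + a) \<partial>ref_measure F) = (\<integral>\<^sup>+z. f z \<partial>ref_measure F)"
proof (cases "F = \<real>")
  case True
  then obtain b where "a = complex_of_real b" using a by (auto elim: Reals_cases)
  then show ?thesis using real_param.translation[OF f, of b] True by (simp add: ref_measure_def)
next
  case False
  have "a = (\<lambda>(x, y). Complex x y) (Re a, Im a)" by simp
  then show ?thesis using complex_param.translation[OF f, of "(Re a, Im a)"] False
    by (simp add: ref_measure_def)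
qed

lemma ref_measure_reflection:
  assumes f: "f \<in> borel_measurable borel"
  shows "(\<integral>\<^sup>+z. f (- z) \<partial>ref_measure F) = (\<integral>\<^sup>+z. f z \<partial>ref_measure F)"
  using real_param.reflection[OF f] complex_param.reflection[OF f] by (simp add: ref_measure_def)

lemma AE_ref_measure:
  assumes F: "F = \<real> \<or> F = UNIV"
  shows "AE z in ref_measure F. z \<in> F"
proof (cases "F = \<real>")
  case True
  have "(\<real> :: complex set) \<in> sets borel" by (rule borel_closed[OF closed_complex_Reals])
  then have "AE z in distr lborel borel complex_of_real. z \<in> \<real>"
    by (subst AE_distr_iff) auto
  moreover have "ref_measure F = distr lborel borel complex_of_real"
    using True by (simp add: ref_measure_def)
  ultimately show ?thesis unfolding True by (simp only: True)
qed (use F in simp)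

lemma nn_integral_lborel_pair:
  fixes f g :: "real \<Rightarrow> ennreal"
  assumes [measurable]: "f \<in> borel_measurable borel" "g \<in> borel_measurable borel"
  shows "(\<integral>\<^sup>+z. f (fst z) * g (snd z) \<partial>(lborel :: (real \<times> real) measure))
    = (\<integral>\<^sup>+x. f x \<partial>lborel) * (\<integral>\<^sup>+y. g y \<partial>lborel)"
proof -
  have "(\<integral>\<^sup>+z. f (fst z) * g (snd z) \<partial>(lborel :: (real \<times> real) measure))
      = (\<integral>\<^sup>+x. \<integral>\<^sup>+y. f x * g y \<partial>lborel \<partial>lborel)"
    unfolding lborel_prod[symmetric] by (subst lborel.nn_integral_fst[symmetric]) simp_all
  then show ?thesis by (simp add: nn_integral_cmult nn_integral_multc)
qed

lemma nn_integral_scaled_std_normal: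
  assumes t: "(0::real) \<le> t"
  shows "(\<integral>\<^sup>+x. ennreal (exp (- (1 + t) * x\<^sup>2 / 2) / sqrt (2 * pi)) \<partial>lborel) = ennreal ((1 + t) powr (-1/2))"
proof -
  define \<sigma> where "\<sigma> = 1 / sqrt (1 + t)"
  have \<sigma>: "0 < \<sigma>" using t by (simp add: \<sigma>_def)
  have s2: "\<sigma>\<^sup>2 = 1 / (1 + t)" using t by (simp add: \<sigma>_def power_divide)
  have *: "exp (- (1 + t) * x\<^sup>2 / 2) / sqrt (2 * pi) = \<sigma> * normal_density 0 \<sigma> x" for x
    using t by (simp add: normal_density_def s2 real_sqrt_divide) (simp add: \<sigma>_def field_simps)
  have "(\<integral>\<^sup>+x. ennreal (normal_density 0 \<sigma> x) \<partial>lborel) = ennreal (\<integral>x. normal_density 0 \<sigma> x \<partial>lborel)"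
    by (rule nn_integral_eq_integral) (use \<sigma> in auto)
  also have "\<dots> = 1" using \<sigma> by simp
  finally have 1: "(\<integral>\<^sup>+x. ennreal (normal_density 0 \<sigma> x) \<partial>lborel) = 1" .
  have "(\<integral>\<^sup>+x. ennreal (exp (- (1 + t) * x\<^sup>2 / 2) / sqrt (2 * pi)) \<partial>lborel)
      = (\<integral>\<^sup>+x. ennreal \<sigma> * ennreal (normal_density 0 \<sigma> x) \<partial>lborel)"
    unfolding * using \<sigma> by (simp add: ennreal_mult)
  also have "\<dots> = ennreal \<sigma>" by (simp add: nn_integral_cmult 1)
  also have "\<sigma> = (1 + t) powr (-1/2)" using t by (simp add: \<sigma>_def powr_minus powr_half_sqrt field_simps)
  finally show ?thesis .
qed

lemma cmod_Complex_sq: "(cmod (Complex x y))\<^sup>2 = x\<^sup>2 + y\<^sup>2"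
  by (simp add: cmod_power2)

lemma nn_integral_gauss:
  assumes [measurable]: "f \<in> borel_measurable borel"
  shows "(\<integral>\<^sup>+z. f z \<partial>gauss F) = (\<integral>\<^sup>+z. ennreal (gauss_weight F z) * f z \<partial>ref_measure F)"
  unfolding gauss_def by (rule nn_integral_density) auto

lemma nn_integral_gauss_exp:
  assumes t: "0 \<le> t"
  shows "(\<integral>\<^sup>+z. ennreal (exp (- t * (cmod z)\<^sup>2 / 2)) \<partial>gauss F) = ennreal ((1 + t) powr (- real (real_dim F) / 2))"
proof -
  define h where "h x = exp (- (1 + t) * x\<^sup>2 / 2) / sqrt (2 * pi)" for x :: real
  have h0: "0 \<le> h x" for x by (simp add: h_def)
  have hm [measurable]: "h \<in> borel_measurable borel" unfolding h_def by measurable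
  have I: "(\<integral>\<^sup>+x. ennreal (h x) \<partial>lborel) = ennreal ((1 + t) powr (-1/2))"
    unfolding h_def by (rule nn_integral_scaled_std_normal[OF t])
  show ?thesis
  proof (cases "F = \<real>")
    case True
    have "ennreal (gauss_weight F (of_real x)) * ennreal (exp (- t * (cmod (of_real x))\<^sup>2 / 2)) = ennreal (h x)" for x
      by (simp add: gauss_weight_def h_def real_dim_def True flip: ennreal_mult)
        (simp add: field_simps flip: exp_add)
    then show ?thesis
      using I by (simp add: nn_integral_gauss ref_measure_def True nn_integral_distr real_dim_def)
  next
    case False
    have e: "ennreal (gauss_weight F (Complex x y)) * ennreal (exp (- t * (cmod (Complex x y))\<^sup>2 / 2)) = ennreal (h x) * ennreal (h y)" for x y
    proof -
      have "gauss_weight F (Complex x y) * exp (- t * (cmod (Complex x y))\<^sup>2 / 2) = h x * h y"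
        using False unfolding gauss_weight_def h_def cmod_Complex_sq
        by (simp add: real_dim_def power2_eq_square[of "sqrt (2 * pi)"] del: real_sqrt_mult_self)
          (simp add: field_simps flip: exp_add)
      then show ?thesis using h0 by (simp flip: ennreal_mult)
    qed
    have "(\<integral>\<^sup>+z. ennreal (exp (- t * (cmod z)\<^sup>2 / 2)) \<partial>gauss F)
        = (\<integral>\<^sup>+z. ennreal (h (fst z)) * ennreal (h (snd z)) \<partial>(lborel :: (real \<times> real) measure))"
      by (simp add: nn_integral_gauss ref_measure_def False nn_integral_distr split_beta
          e[unfolded mult_minus_left divide_minus_left])
    also have "\<dots> = ennreal ((1 + t) powr (-1/2)) * ennreal ((1 + t) powr (-1/2))"
      by (subst nn_integral_lborel_pair) (auto simp: I)
    also have "\<dots> = ennreal ((1 + t) powr (-1))" by (simp flip: ennreal_mult powr_add)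
    finally show ?thesis using False by (simp add: real_dim_def)
  qed
qed

lemma prob_space_gauss: "prob_space (gauss F)"
proof
  have "emeasure (gauss F) (space (gauss F)) = (\<integral>\<^sup>+z. ennreal (exp (- 0 * (cmod z)\<^sup>2 / 2)) \<partial>gauss F)" by simp
  also have "\<dots> = 1" by (subst nn_integral_gauss_exp) simp_all
  finally show "emeasure (gauss F) (space (gauss F)) = 1" .
qed

lemma AE_gauss: "F = \<real> \<or> F = UNIV \<Longrightarrow> AE z in gauss F. z \<in> F"
  unfolding gauss_def using AE_ref_measure[of F] by (subst AE_density) auto

lemma gauss_reflection:
  assumes [measurable]: "f \<in> borel_measurable borel"
  shows "(\<integral>\<^sup>+z. f (- z) \<partial>gauss F) = (\<integral>\<^sup>+z. f z \<partial>gauss F)"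
proof -
  have "(\<integral>\<^sup>+z. f (- z) \<partial>gauss F) = (\<integral>\<^sup>+z. ennreal (gauss_weight F (- z)) * f (- z) \<partial>ref_measure F)"
    by (simp add: nn_integral_gauss gauss_weight_def)
  also have "\<dots> = (\<integral>\<^sup>+z. f z \<partial>gauss F)"
    by (subst ref_measure_reflection) (simp_all add: nn_integral_gauss)
  finally show ?thesis .
qed

lemma nn_integral_gauss_sq: "(\<integral>\<^sup>+z. ennreal ((cmod z)\<^sup>2) \<partial>gauss F) = ennreal (real (real_dim F))"
proof -
  define \<phi> where "\<phi> = std_normal_density"
  have \<phi>m [measurable]: "\<phi> \<in> borel_measurable borel" by (simp add: \<phi>_def)
  have \<phi>0: "0 \<le> \<phi> x" for x by (simp add: \<phi>_def)
  have "has_bochner_integral lborel (\<lambda>x. \<phi> x * x\<^sup>2) 1"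
    using std_normal_moment_even[of 1] by (simp add: \<phi>_def)
  then have 2: "(\<integral>\<^sup>+x. ennreal (\<phi> x * x\<^sup>2) \<partial>lborel) = 1"
    using \<phi>0 by (subst nn_integral_eq_integral) (auto simp: has_bochner_integral_iff)
  have 0: "(\<integral>\<^sup>+x. ennreal (\<phi> x) \<partial>lborel) = 1"
    unfolding \<phi>_def by (subst nn_integral_eq_integral) auto
  show ?thesis
  proof (cases "F = \<real>")
    case True
    have "ennreal (gauss_weight F (of_real x)) * ennreal ((cmod (of_real x))\<^sup>2) = ennreal (\<phi> x * x\<^sup>2)" for x
      by (simp add: gauss_weight_def \<phi>_def std_normal_density_def real_dim_def True flip: ennreal_mult)
    then show ?thesis
      using 2 by (simp add: nn_integral_gauss ref_measure_def True nn_integral_distr real_dim_def)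
  next
    case False
    have e: "ennreal (gauss_weight F (Complex x y)) * ennreal ((cmod (Complex x y))\<^sup>2)
      = ennreal (\<phi> x * x\<^sup>2) * ennreal (\<phi> y) + ennreal (\<phi> x) * ennreal (\<phi> y * y\<^sup>2)" for x y
    proof -
      have "gauss_weight F (Complex x y) = \<phi> x * \<phi> y"
        using False unfolding gauss_weight_def cmod_Complex_sq \<phi>_def std_normal_density_def
        by (simp add: real_dim_def power2_eq_square[of "sqrt (2 * pi)"] del: real_sqrt_mult_self)
          (simp add: field_simps flip: exp_add)
      then have "gauss_weight F (Complex x y) * (cmod (Complex x y))\<^sup>2 = \<phi> x * x\<^sup>2 * \<phi> y + \<phi> x * (\<phi> y * y\<^sup>2)"
        unfolding cmod_Complex_sq by (simp add: algebra_simps)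
      then show ?thesis using \<phi>0 by (simp flip: ennreal_mult ennreal_plus)
    qed
    have "(\<integral>\<^sup>+z. ennreal ((cmod z)\<^sup>2) \<partial>gauss F)
        = (\<integral>\<^sup>+z. ennreal (\<phi> (fst z) * (fst z)\<^sup>2) * ennreal (\<phi> (snd z))
            + ennreal (\<phi> (fst z)) * ennreal (\<phi> (snd z) * (snd z)\<^sup>2) \<partial>(lborel :: (real \<times> real) measure))"
      by (simp add: nn_integral_gauss ref_measure_def False nn_integral_distr split_beta e)
    also have "\<dots> = (\<integral>\<^sup>+z. ennreal (\<phi> (fst z) * (fst z)\<^sup>2) * ennreal (\<phi> (snd z)) \<partial>(lborel :: (real \<times> real) measure))
            + (\<integral>\<^sup>+z. ennreal (\<phi> (fst z)) * ennreal (\<phi> (snd z) * (snd z)\<^sup>2) \<partial>(lborel :: (real \<times> real) measure))"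
      unfolding lborel_prod[symmetric] by (rule nn_integral_add) measurable
    also have "\<dots> = 1 * 1 + 1 * 1"
      by (subst (1 2) nn_integral_lborel_pair) (auto simp: 0 2)
    finally show ?thesis using False by (simp add: real_dim_def)
  qed
qed

lemma std_normal_over_distr:
  assumes M: "prob_space M" and F: "F = \<real> \<or> F = UNIV" and X: "std_normal_over F M X"
    and Xm [measurable]: "X \<in> borel_measurable M"
  shows "distr M borel X = gauss F"
proof -
  interpret prob_space M by fact
  have re: "distr M lborel (\<lambda>\<omega>. Re (X \<omega>)) = density lborel std_normal_density"
    using X by (auto simp: std_normal_over_def distributed_def)
  show ?thesis
  proof (cases "F = \<real>")
    case True
    then have im: "\<forall>\<omega>\<in>space M. Im (X \<omega>) = 0" using X by (simp add: std_normal_over_def)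
    have "distr M borel X = distr M borel (\<lambda>\<omega>. complex_of_real (Re (X \<omega>)))"
      by (rule distr_cong) (use im in \<open>auto simp: complex_eq_iff\<close>)
    also have "\<dots> = distr (distr M lborel (\<lambda>\<omega>. Re (X \<omega>))) borel complex_of_real"
      by (subst distr_distr) (auto simp: comp_def)
    also have "\<dots> = distr (density lborel (\<lambda>x. ennreal (gauss_weight F (of_real x)))) borel complex_of_real"
      unfolding re by (simp add: gauss_weight_def True real_dim_def std_normal_density_def)
    also have "\<dots> = gauss F"
      unfolding gauss_def ref_measure_def using True by (simp add: density_distr)
    finally show ?thesis .
  next
    case False
    then have imd: "distr M lborel (\<lambda>\<omega>. Im (X \<omega>)) = density lborel std_normal_density"
      and ind: "indep_var borel (\<lambda>\<omega>. Re (X \<omega>)) borel (\<lambda>\<omega>. Im (X \<omega>))"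
      using X by (auto simp: std_normal_over_def distributed_def)
    have lb: "distr M borel f = distr M lborel f" for f :: "_ \<Rightarrow> real" by (rule distr_cong) auto
    have w: "gauss_weight F (Complex x y) = std_normal_density x * std_normal_density y" for x y
      using False unfolding gauss_weight_def cmod_Complex_sq std_normal_density_def
      by (simp add: real_dim_def power2_eq_square[of "sqrt (2 * pi)"] del: real_sqrt_mult_self)
        (simp add: field_simps flip: exp_add)
    have sf: "sigma_finite_measure (density lborel (\<lambda>x. ennreal (std_normal_density x)))"
      using prob_space.finite_measure[OF prob_space_normal_density[of 1 0]]
      by (simp add: finite_measure.axioms(1))
    have "distr M (borel \<Otimes>\<^sub>M borel) (\<lambda>\<omega>. (Re (X \<omega>), Im (X \<omega>)))
        = density lborel std_normal_density \<Otimes>\<^sub>M density lborel std_normal_density"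
      using ind by (simp add: indep_var_distribution_eq lb re imd)
    also have "\<dots> = density (lborel \<Otimes>\<^sub>M lborel) (\<lambda>(x, y). ennreal (std_normal_density x) * ennreal (std_normal_density y))"
      by (rule pair_measure_density) (auto simp: sf lborel.sigma_finite_measure_axioms)
    also have fe: "(\<lambda>(x, y). ennreal (std_normal_density x) * ennreal (std_normal_density y))
        = (\<lambda>z. ennreal (gauss_weight F ((\<lambda>(x, y). Complex x y) z)))"
      by (rule ext) (simp add: split_beta w ennreal_mult)
    finally have joint: "distr M (borel \<Otimes>\<^sub>M borel) (\<lambda>\<omega>. (Re (X \<omega>), Im (X \<omega>)))
        = density lborel (\<lambda>z. ennreal (gauss_weight F ((\<lambda>(x, y). Complex x y) z)))"
      unfolding lborel_prod .
    have "distr M borel X = distr (distr M (borel \<Otimes>\<^sub>M borel) (\<lambda>\<omega>. (Re (X \<omega>), Im (X \<omega>)))) borel (\<lambda>(x, y). Complex x y)"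
      by (subst distr_distr) (auto simp: comp_def borel_prod)
    also have "\<dots> = gauss F"
      unfolding joint gauss_def ref_measure_def using False by (simp add: density_distr)
    finally show ?thesis .
  qed
qed

section \<open>Rotation invariance of Gaussian arrays\<close>

abbreviation ref_PiM :: "complex set \<Rightarrow> 'i set \<Rightarrow> ('i \<Rightarrow> complex) measure" where
  "ref_PiM F I \<equiv> PiM I (\<lambda>_. ref_measure F)"

abbreviation gauss_PiM :: "complex set \<Rightarrow> 'i set \<Rightarrow> ('i \<Rightarrow> complex) measure" where
  "gauss_PiM F I \<equiv> PiM I (\<lambda>_. gauss F)"

lemma product_sigma_finite_ref: "product_sigma_finite (\<lambda>_. ref_measure F)"
  by (rule product_sigma_finite.intro) (rule sigma_finite_ref_measure)

lemma product_sigma_finite_gauss: "product_sigma_finite (\<lambda>_. gauss F)"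
  by (intro product_sigma_finite.intro prob_space_imp_sigma_finite prob_space_gauss)

lemma emeasure_ref_translation:
  assumes F: "F = \<real> \<or> F = UNIV" and a: "a \<in> F" and A: "A \<in> sets borel"
  shows "emeasure (ref_measure F) ((\<lambda>z. z + a) -` A) = emeasure (ref_measure F) A"
proof -
  have "(\<lambda>z. z + a) -` A \<in> sets borel"
    using measurable_sets[of "\<lambda>z. z + a" borel borel A] A by simp
  then have "emeasure (ref_measure F) ((\<lambda>z. z + a) -` A) = (\<integral>\<^sup>+z. indicator A (z + a) \<partial>ref_measure F)"
    by (subst nn_integral_indicator[symmetric])
      (auto intro!: nn_integral_cong simp: indicator_def simp del: nn_integral_indicator)
  also have "\<dots> = (\<integral>\<^sup>+z. indicator A z \<partial>ref_measure F)"
    by (rule ref_measure_translation[OF F a]) (use A in simp)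
  finally show ?thesis using A by simp
qed

lemma PiM_ref_translation:
  fixes I :: "'i set"
  assumes F: "F = \<real> \<or> F = UNIV" and I: "finite I" and a: "\<And>i. i \<in> I \<Longrightarrow> a i \<in> F"
    and f: "f \<in> borel_measurable (ref_PiM F I)"
  shows "(\<integral>\<^sup>+x. f (\<lambda>i\<in>I. x i + a i) \<partial>ref_PiM F I) = (\<integral>\<^sup>+x. f x \<partial>ref_PiM F I)"
proof -
  let ?L = "ref_PiM F I"
  let ?s = "\<lambda>x. \<lambda>i\<in>I. x i + a i"
  have sm: "?s \<in> ?L \<rightarrow>\<^sub>M ?L" by measurable
  have "distr ?L ?L ?s = ?L"
  proof (rule product_sigma_finite.PiM_eqI[OF product_sigma_finite_ref I])
    fix A :: "'i \<Rightarrow> complex set" assume A: "\<And>i. i \<in> I \<Longrightarrow> A i \<in> sets (ref_measure F)"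
    have A': "(\<lambda>z. z + a i) -` A i \<in> sets (ref_measure F)" if "i \<in> I" for i
      using measurable_sets[of "\<lambda>z. z + a i" borel borel "A i"] A[OF that] by simp
    have "emeasure (distr ?L ?L ?s) (Pi\<^sub>E I A) = emeasure ?L (?s -` (Pi\<^sub>E I A) \<inter> space ?L)"
      by (rule emeasure_distr[OF sm sets_PiM_I_finite[OF I A]])
    also have "?s -` (Pi\<^sub>E I A) \<inter> space ?L = Pi\<^sub>E I (\<lambda>i. (\<lambda>z. z + a i) -` A i)"
      by (auto simp: space_PiM PiE_def Pi_def)
    also have "emeasure ?L \<dots> = (\<Prod>i\<in>I. emeasure (ref_measure F) ((\<lambda>z. z + a i) -` A i))"
      by (rule product_sigma_finite.emeasure_PiM[OF product_sigma_finite_ref I A'])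
    also have "\<dots> = (\<Prod>i\<in>I. emeasure (ref_measure F) (A i))"
      by (rule prod.cong) (use emeasure_ref_translation[OF F a] A in auto)
    finally show "emeasure (distr ?L ?L ?s) (Pi\<^sub>E I A) = (\<Prod>i\<in>I. emeasure (ref_measure F) (A i))" .
  qed simp
  then have "(\<integral>\<^sup>+x. f x \<partial>?L) = (\<integral>\<^sup>+x. f x \<partial>distr ?L ?L ?s)" by simp
  also have "\<dots> = (\<integral>\<^sup>+x. f (?s x) \<partial>?L)" by (rule nn_integral_distr[OF sm]) (use f in simp)
  finally show ?thesis by simp
qed

text \<open>
  The joint density of a Gaussian array relative to the product reference measure.
  It depends on the square norm of the array only.
\<close>

definition product_weight :: "complex set \<Rightarrow> 'i set \<Rightarrow> ('i \<Rightarrow> complex) \<Rightarrow> ennreal" where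
  "product_weight F I x = (\<Prod>i\<in>I. ennreal (gauss_weight F (x i)))"

lemma product_weight_measurable [measurable]:
  "product_weight F I \<in> borel_measurable (ref_PiM F I)"
  unfolding product_weight_def by measurable

lemma product_weight_cong:
  assumes I: "finite I" and eq: "(\<Sum>i\<in>I. (cmod (x i))\<^sup>2) = (\<Sum>i\<in>I. (cmod (y i))\<^sup>2)"
  shows "product_weight F I x = product_weight F I y"
proof -
  have "(\<Prod>i\<in>I. gauss_weight F (x i)) = exp (- (\<Sum>i\<in>I. (cmod (x i))\<^sup>2) / 2) / (\<Prod>i\<in>I. sqrt (2 * pi) ^ real_dim F)" for x
    by (simp add: gauss_weight_def prod_dividef exp_sum[OF I, symmetric] sum_negf flip: sum_divide_distrib)
  then show ?thesis by (simp add: product_weight_def prod_ennreal eq)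
qed

lemma PiM_gauss_eq_density:
  fixes I :: "'i set"
  assumes I: "finite I"
  shows "gauss_PiM F I = density (ref_PiM F I) (product_weight F I)"
proof (rule product_sigma_finite.PiM_eqI[OF product_sigma_finite_gauss I, symmetric])
  show "sets (density (ref_PiM F I) (product_weight F I)) = sets (gauss_PiM F I)"
    by (simp cong: sets_PiM_cong)
next
  fix A :: "'i \<Rightarrow> complex set" assume A: "\<And>i. i \<in> I \<Longrightarrow> A i \<in> sets (gauss F)"
  let ?L = "ref_PiM F I"
  have A': "A i \<in> sets borel" if "i \<in> I" for i using A[OF that] by simp
  have "emeasure (density ?L (product_weight F I)) (Pi\<^sub>E I A)
      = (\<integral>\<^sup>+x. product_weight F I x * indicator (Pi\<^sub>E I A) x \<partial>?L)"
    by (rule emeasure_density) (use A' I in auto)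
  also have "\<dots> = (\<integral>\<^sup>+x. (\<Prod>i\<in>I. ennreal (gauss_weight F (x i)) * indicator (A i) (x i)) \<partial>?L)"
  proof (rule nn_integral_cong)
    fix x assume "x \<in> space ?L"
    then have x: "x \<in> extensional I" by (auto simp: space_PiM PiE_def)
    have "indicator (Pi\<^sub>E I A) x = (\<Prod>i\<in>I. indicator (A i) (x i) :: ennreal)"
    proof (cases "\<forall>i\<in>I. x i \<in> A i")
      case True
      then show ?thesis using x by (auto simp: PiE_def Pi_def)
    next
      case False
      then show ?thesis using I by (auto simp: PiE_def Pi_def indicator_def intro!: prod_zero[symmetric])
    qed
    then show "product_weight F I x * indicator (Pi\<^sub>E I A) x
        = (\<Prod>i\<in>I. ennreal (gauss_weight F (x i)) * indicator (A i) (x i))"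
      by (simp add: product_weight_def prod.distrib)
  qed
  also have "\<dots> = (\<Prod>i\<in>I. \<integral>\<^sup>+z. ennreal (gauss_weight F z) * indicator (A i) z \<partial>ref_measure F)"
    by (rule product_sigma_finite.product_nn_integral_prod[OF product_sigma_finite_ref I]) (use A' in simp)
  also have "\<dots> = (\<Prod>i\<in>I. emeasure (gauss F) (A i))"
    unfolding gauss_def by (intro prod.cong refl emeasure_density[symmetric]) (use A' in auto)
  finally show "emeasure (density ?L (product_weight F I)) (Pi\<^sub>E I A) = (\<Prod>i\<in>I. emeasure (gauss F) (A i))" .
qed

lemma prob_space_PiM_gauss: "prob_space (gauss_PiM F I)"
  by (intro prob_space_PiM prob_space_gauss)

lemma nn_integral_PiM_gauss:
  assumes I: "finite I" and f: "f \<in> borel_measurable (ref_PiM F I)"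
  shows "(\<integral>\<^sup>+x. f x \<partial>gauss_PiM F I)
    = (\<integral>\<^sup>+x. product_weight F I x * f x \<partial>ref_PiM F I)"
  unfolding PiM_gauss_eq_density[OF I] by (rule nn_integral_density) (use f in auto)

lemma AE_PiM_ref:
  assumes F: "F = \<real> \<or> F = UNIV" and I: "finite I"
  shows "AE x in ref_PiM F I. \<forall>i\<in>I. x i \<in> F"
proof -
  have "AE x in gauss_PiM F I. \<forall>i\<in>I. x i \<in> F"
  proof (rule AE_finite_allI[OF I])
    fix i assume "i \<in> I"
    then show "AE x in gauss_PiM F I. x i \<in> F"
      by (intro AE_PiM_component[where P = "\<lambda>z. z \<in> F"] prob_space_gauss AE_gauss F)
  qed
  moreover have "product_weight F I x > 0" for x
  proof -
    have "0 < gauss_weight F z" for z by (simp add: gauss_weight_def)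
    then show ?thesis unfolding product_weight_def
      by (simp add: prod_ennreal prod_pos)
  qed
  ultimately show ?thesis
    unfolding PiM_gauss_eq_density[OF I] by (simp add: AE_density)
qed

text \<open>
  A surjective norm-preserving additive map of \<open>F\<close>-valued arrays. Surjectivity is
  required on \<open>F\<close>-valued arrays only, as almost every array is of this form.
\<close>

locale gauss_isometry =
  fixes F :: "complex set" and I :: "'i set" and T :: "('i \<Rightarrow> complex) \<Rightarrow> 'i \<Rightarrow> complex"
  assumes F: "F = \<real> \<or> F = UNIV" and I: "finite I"
    and T_measurable [measurable]: "T \<in> ref_PiM F I \<rightarrow>\<^sub>M ref_PiM F I"
    and T_add: "\<And>x y. T (\<lambda>i\<in>I. x i + y i) = (\<lambda>i\<in>I. T x i + T y i)"
    and T_norm: "\<And>x. (\<Sum>i\<in>I. (cmod (T x i))\<^sup>2) = (\<Sum>i\<in>I. (cmod (x i))\<^sup>2)"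
    and T_F: "\<And>x i. \<forall>i\<in>I. x i \<in> F \<Longrightarrow> i \<in> I \<Longrightarrow> T x i \<in> F"
    and T_surj: "\<And>a. \<forall>i\<in>I. a i \<in> F \<Longrightarrow> \<exists>b. (\<forall>i\<in>I. b i \<in> F) \<and> (\<forall>i\<in>I. T b i = a i)"
begin

abbreviation L where "L \<equiv> ref_PiM F I"

text \<open>
  The uniqueness argument for Haar measure. With \<open>w\<close> the Gaussian weight, which has
  integral 1 and is even and invariant under \<open>T\<close>, integrate \<open>w (T y) f (x + T y)\<close> over \<open>x\<close> and \<open>y\<close>.
  Integrating over \<open>x\<close> first, a translation by \<open>T y\<close> gives the integral of \<open>f\<close>. Integrating over \<open>y\<close>
  first, a translation of \<open>y\<close> by a preimage of \<open>- x\<close> changes the integrand into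
  \<open>w (x - T y) f (T y)\<close>, and integrating that over \<open>x\<close> leaves the integral of \<open>f \<circ> T\<close>.
\<close>

lemma ref_invariant:
  assumes f [measurable]: "f \<in> borel_measurable L"
  shows "(\<integral>\<^sup>+x. f (T x) \<partial>L) = (\<integral>\<^sup>+x. f x \<partial>L)"
proof -
  have sfL: "sigma_finite_measure L" by (rule product_sigma_finite.sigma_finite[OF product_sigma_finite_ref I])
  interpret pair_sigma_finite L L by (rule pair_sigma_finite.intro[OF sfL sfL])
  let ?w = "product_weight F I"
  have Ti: "(\<lambda>x. T x i) \<in> borel_measurable L" if "i \<in> I" for i
    by (rule measurable_compose[OF T_measurable]) (use that in measurable)
  have [measurable]: "(\<lambda>p. T (snd p) i) \<in> borel_measurable (L \<Otimes>\<^sub>M L)" if "i \<in> I" for i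
    by (rule measurable_compose[OF measurable_snd Ti[OF that]])
  have [measurable]: "(\<lambda>p. T (fst p) i) \<in> borel_measurable (L \<Otimes>\<^sub>M L)" if "i \<in> I" for i
    by (rule measurable_compose[OF measurable_fst Ti[OF that]])
  note [measurable] = Ti
  have one: "(\<integral>\<^sup>+x. ?w x \<partial>L) = 1"
  proof -
    have "(\<integral>\<^sup>+x. 1 \<partial>gauss_PiM F I) = (\<integral>\<^sup>+x. ?w x * 1 \<partial>L)"
      by (rule nn_integral_PiM_gauss[OF I]) simp
    then show ?thesis using prob_space.emeasure_space_1[OF prob_space_PiM_gauss[of I F]] by simp
  qed
  have wT: "?w (T y) = ?w y" for y by (rule product_weight_cong[OF I T_norm])
  have AE: "AE y in L. \<forall>i\<in>I. y i \<in> F" by (rule AE_PiM_ref[OF F I])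
  have neg: "- z \<in> F" if "z \<in> F" for z using that F by auto
  have "(\<integral>\<^sup>+x. f x \<partial>L) = (\<integral>\<^sup>+y. ?w (T y) * (\<integral>\<^sup>+x. f x \<partial>L) \<partial>L)"
    by (simp add: wT nn_integral_multc one)
  also have "\<dots> = (\<integral>\<^sup>+y. (\<integral>\<^sup>+x. ?w (T y) * f (\<lambda>i\<in>I. x i + T y i) \<partial>L) \<partial>L)"
  proof (rule nn_integral_cong_AE)
    from AE show "AE y in L. ?w (T y) * (\<integral>\<^sup>+x. f x \<partial>L) = (\<integral>\<^sup>+x. ?w (T y) * f (\<lambda>i\<in>I. x i + T y i) \<partial>L)"
    proof eventually_elim
      case (elim y)
      have "(\<integral>\<^sup>+x. f (\<lambda>i\<in>I. x i + T y i) \<partial>L) = (\<integral>\<^sup>+x. f x \<partial>L)"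
        by (rule PiM_ref_translation[OF F I T_F[OF elim] f])
      then show ?case by (simp add: nn_integral_cmult)
    qed
  qed
  also have "\<dots> = (\<integral>\<^sup>+x. (\<integral>\<^sup>+y. ?w (T y) * f (\<lambda>i\<in>I. x i + T y i) \<partial>L) \<partial>L)"
    by (rule Fubini') measurable
  also have "\<dots> = (\<integral>\<^sup>+x. (\<integral>\<^sup>+y. ?w (\<lambda>i\<in>I. x i - T y i) * f (T y) \<partial>L) \<partial>L)"
  proof (rule nn_integral_cong_AE)
    from AE show "AE x in L. (\<integral>\<^sup>+y. ?w (T y) * f (\<lambda>i\<in>I. x i + T y i) \<partial>L)
        = (\<integral>\<^sup>+y. ?w (\<lambda>i\<in>I. x i - T y i) * f (T y) \<partial>L)"
    proof eventually_elim
      case (elim x)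
      \<comment> \<open>the translation of \<open>y\<close> that turns \<open>x + T y\<close> into \<open>T y\<close>\<close>
      obtain b where bF: "\<forall>i\<in>I. b i \<in> F" and b: "\<forall>i\<in>I. T b i = - x i"
        using T_surj[of "\<lambda>i. - x i"] elim neg by auto
      have "(\<integral>\<^sup>+y. ?w (T y) * f (\<lambda>i\<in>I. x i + T y i) \<partial>L)
          = (\<integral>\<^sup>+y. ?w (T (\<lambda>i\<in>I. y i + b i)) * f (\<lambda>i\<in>I. x i + T (\<lambda>i\<in>I. y i + b i) i) \<partial>L)"
        by (rule PiM_ref_translation[OF F I, symmetric]) (use bF in auto)
      also have "\<dots> = (\<integral>\<^sup>+y. ?w (\<lambda>i\<in>I. x i - T y i) * f (T y) \<partial>L)"
      proof (rule nn_integral_cong)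
        fix y assume "y \<in> space L"
        then have "T y \<in> space L" by (rule measurable_space[OF T_measurable])
        then have Ty: "T y \<in> extensional I" by (auto simp: space_PiM PiE_def)
        have 1: "(\<lambda>i\<in>I. x i + T (\<lambda>i\<in>I. y i + b i) i) = T y"
          by (rule extensionalityI[of _ I]) (use Ty b in \<open>auto simp: T_add\<close>)
        have 2: "?w (T (\<lambda>i\<in>I. y i + b i)) = ?w (\<lambda>i\<in>I. x i - T y i)"
        proof (rule product_weight_cong[OF I sum.cong])
          fix i assume "i \<in> I"
          then show "(cmod (T (\<lambda>i\<in>I. y i + b i) i))\<^sup>2 = (cmod ((\<lambda>i\<in>I. x i - T y i) i))\<^sup>2"
            using b by (simp add: T_add norm_minus_commute)
        qed simp
        show "?w (T (\<lambda>i\<in>I. y i + b i)) * f (\<lambda>i\<in>I. x i + T (\<lambda>i\<in>I. y i + b i) i)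
            = ?w (\<lambda>i\<in>I. x i - T y i) * f (T y)" by (simp only: 1 2)
      qed
      finally show ?case .
    qed
  qed
  also have "\<dots> = (\<integral>\<^sup>+y. (\<integral>\<^sup>+x. ?w (\<lambda>i\<in>I. x i - T y i) * f (T y) \<partial>L) \<partial>L)"
    by (rule Fubini') measurable
  also have "\<dots> = (\<integral>\<^sup>+y. f (T y) \<partial>L)"
  proof (rule nn_integral_cong_AE)
    from AE show "AE y in L. (\<integral>\<^sup>+x. ?w (\<lambda>i\<in>I. x i - T y i) * f (T y) \<partial>L) = f (T y)"
    proof eventually_elim
      case (elim y)
      have "(\<integral>\<^sup>+x. ?w (\<lambda>i\<in>I. x i + - T y i) \<partial>L) = (\<integral>\<^sup>+x. ?w x \<partial>L)"
        by (rule PiM_ref_translation[OF F I]) (use T_F[OF elim] neg in auto)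
      then show ?case by (simp add: nn_integral_multc one)
    qed
  qed
  finally show ?thesis by simp
qed

lemma gauss_invariant:
  assumes f [measurable]: "f \<in> borel_measurable (gauss_PiM F I)"
  shows "(\<integral>\<^sup>+x. f (T x) \<partial>gauss_PiM F I) = (\<integral>\<^sup>+x. f x \<partial>gauss_PiM F I)"
proof -
  have s: "sets (gauss_PiM F I) = sets L" by (rule sets_PiM_cong) auto
  have fm [measurable]: "f \<in> borel_measurable L" using f by (simp add: measurable_cong_sets[OF s refl])
  have wT: "product_weight F I (T y) = product_weight F I y" for y by (rule product_weight_cong[OF I T_norm])
  have "(\<integral>\<^sup>+x. f (T x) \<partial>gauss_PiM F I) = (\<integral>\<^sup>+x. product_weight F I (T x) * f (T x) \<partial>L)"
    by (simp add: nn_integral_PiM_gauss[OF I] wT)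
  also have "\<dots> = (\<integral>\<^sup>+x. product_weight F I x * f x \<partial>L)" by (rule ref_invariant) measurable
  finally show ?thesis by (simp add: nn_integral_PiM_gauss[OF I])
qed

end

text \<open>
  Averaging over \<open>z\<close> and \<open>- z\<close> removes the mixed term, by the parallelogram law. This
  avoids all integrability side conditions on first moments.
\<close>

lemma nn_integral_gauss_affine_sq:
  "(\<integral>\<^sup>+z. ennreal ((cmod (s + c * z))\<^sup>2) \<partial>gauss F) = ennreal ((cmod s)\<^sup>2 + real (real_dim F) * (cmod c)\<^sup>2)"
proof -
  let ?I = "\<integral>\<^sup>+z. ennreal ((cmod (s + c * z))\<^sup>2) \<partial>gauss F"
  have pl: "(cmod (s + c * z))\<^sup>2 + (cmod (s + c * - z))\<^sup>2 = 2 * ((cmod s)\<^sup>2 + (cmod c)\<^sup>2 * (cmod z)\<^sup>2)" for z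
  proof -
    have "(cmod (s + w))\<^sup>2 + (cmod (s - w))\<^sup>2 = 2 * ((cmod s)\<^sup>2 + (cmod w)\<^sup>2)" for w
      unfolding cmod_power2 by (simp add: power2_eq_square algebra_simps)
    from this[of "c * z"] show ?thesis by (simp add: norm_mult power_mult_distrib)
  qed
  have p: "emeasure (gauss F) UNIV = 1" using prob_space.emeasure_space_1[OF prob_space_gauss[of F]] by simp
  have "2 * ?I = ?I + (\<integral>\<^sup>+z. ennreal ((cmod (s + c * - z))\<^sup>2) \<partial>gauss F)"
    by (subst gauss_reflection[of "\<lambda>z. ennreal ((cmod (s + c * z))\<^sup>2)"]) (auto simp: mult_2)
  also have "\<dots> = (\<integral>\<^sup>+z. ennreal ((cmod (s + c * z))\<^sup>2) + ennreal ((cmod (s + c * - z))\<^sup>2) \<partial>gauss F)"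
    by (rule nn_integral_add[symmetric]) measurable
  also have "\<dots> = (\<integral>\<^sup>+z. 2 * (ennreal ((cmod s)\<^sup>2) + ennreal ((cmod c)\<^sup>2) * ennreal ((cmod z)\<^sup>2)) \<partial>gauss F)"
    unfolding ennreal_plus[OF zero_le_power2 zero_le_power2, symmetric] pl
    by (simp add: ennreal_mult ennreal_plus distrib_left flip: ennreal_numeral)
  also have "\<dots> = 2 * (ennreal ((cmod s)\<^sup>2) + ennreal ((cmod c)\<^sup>2) * ennreal (real (real_dim F)))"
    by (simp add: nn_integral_cmult nn_integral_add nn_integral_gauss_sq p)
  finally have "?I = ennreal ((cmod s)\<^sup>2) + ennreal ((cmod c)\<^sup>2) * ennreal (real (real_dim F))"
    by (subst (asm) ennreal_mult_cancel_left) simp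
  then show ?thesis by (simp add: mult.commute[of "real (real_dim F)"] ennreal_mult ennreal_plus)
qed

lemma nn_integral_PiM_gauss_linear_sq:
  fixes J :: "'i set"
  assumes J: "finite J"
  shows "(\<integral>\<^sup>+x. ennreal ((cmod (s + (\<Sum>j\<in>J. c j * x j)))\<^sup>2) \<partial>gauss_PiM F J)
    = ennreal ((cmod s)\<^sup>2 + real (real_dim F) * (\<Sum>j\<in>J. (cmod (c j))\<^sup>2))"
  using J
proof (induction J arbitrary: s)
  case empty
  have "emeasure (gauss_PiM F ({} :: 'i set)) (space (gauss_PiM F {})) = 1"
    by (rule prob_space.emeasure_space_1[OF prob_space_PiM_gauss])
  then show ?case by simp
next
  case (insert i J)
  have "(\<integral>\<^sup>+x. ennreal ((cmod (s + (\<Sum>j\<in>insert i J. c j * x j)))\<^sup>2) \<partial>gauss_PiM F (insert i J))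
      = (\<integral>\<^sup>+x. \<integral>\<^sup>+z. ennreal ((cmod (s + (\<Sum>j\<in>insert i J. c j * (x(i := z)) j)))\<^sup>2) \<partial>gauss F \<partial>gauss_PiM F J)"
    by (rule product_sigma_finite.product_nn_integral_insert[OF product_sigma_finite_gauss insert.hyps]) measurable
  also have "\<dots> = (\<integral>\<^sup>+x. \<integral>\<^sup>+z. ennreal ((cmod ((s + (\<Sum>j\<in>J. c j * x j)) + c i * z))\<^sup>2) \<partial>gauss F \<partial>gauss_PiM F J)"
  proof (intro nn_integral_cong)
    fix x z
    have "(\<Sum>j\<in>J. c j * (x(i := z)) j) = (\<Sum>j\<in>J. c j * x j)" by (rule sum.cong) (use insert.hyps in auto)
    then show "ennreal ((cmod (s + (\<Sum>j\<in>insert i J. c j * (x(i := z)) j)))\<^sup>2)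
        = ennreal ((cmod ((s + (\<Sum>j\<in>J. c j * x j)) + c i * z))\<^sup>2)"
      using insert.hyps by (simp add: add_ac)
  qed
  also have "\<dots> = (\<integral>\<^sup>+x. ennreal ((cmod (s + (\<Sum>j\<in>J. c j * x j)))\<^sup>2) + ennreal (real (real_dim F) * (cmod (c i))\<^sup>2) \<partial>gauss_PiM F J)"
    by (simp add: nn_integral_gauss_affine_sq)
  also have "\<dots> = (\<integral>\<^sup>+x. ennreal ((cmod (s + (\<Sum>j\<in>J. c j * x j)))\<^sup>2) \<partial>gauss_PiM F J)
      + (\<integral>\<^sup>+x. ennreal (real (real_dim F) * (cmod (c i))\<^sup>2) \<partial>gauss_PiM F J)"
    by (rule nn_integral_add) measurable
  also have "\<dots> = ennreal ((cmod s)\<^sup>2 + real (real_dim F) * (\<Sum>j\<in>J. (cmod (c j))\<^sup>2)) + ennreal (real (real_dim F) * (cmod (c i))\<^sup>2)"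
    using prob_space.emeasure_space_1[OF prob_space_PiM_gauss[of J F]] by (simp add: insert.IH)
  also have "\<dots> = ennreal ((cmod s)\<^sup>2 + real (real_dim F) * (\<Sum>j\<in>insert i J. (cmod (c j))\<^sup>2))"
    using insert.hyps by (simp add: sum_nonneg algebra_simps flip: ennreal_plus)
  finally show ?case .
qed

text \<open>
  Valid also for \<open>s = 0\<close>, where both sides are infinite.
\<close>

lemma inverse_as_exp_integral:
  assumes s: "0 \<le> s"
  shows "inverse (ennreal s) = (\<integral>\<^sup>+t\<in>{0..}. ennreal (exp (- t * s / 2) / 2) \<partial>lborel)"
proof (cases "s = 0")
  case True
  have "(\<integral>\<^sup>+t\<in>{0..}. ennreal (exp (- t * s / 2) / 2) \<partial>lborel) = ennreal (1/2) * emeasure lborel {0::real..}"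
    using True by (simp add: nn_integral_cmult_indicator)
  also have "emeasure lborel {0::real..} = \<infinity>"
  proof (rule ccontr)
    assume "emeasure lborel {0::real..} \<noteq> \<infinity>"
    then obtain n :: nat where n: "emeasure lborel {0::real..} < of_nat n"
      using ennreal_Ex_less_of_nat[of "emeasure lborel {0::real..}"] by (auto simp: less_top)
    have "emeasure lborel {0..real n} \<le> emeasure lborel {0::real..}" by (rule emeasure_mono) auto
    then show False using n by (simp add: ennreal_of_nat_eq_real_of_nat)
  qed
  finally show ?thesis using True by (simp add: ennreal_mult_top)
next
  case False
  then have s: "0 < s" using s by simp
  have "(\<integral>\<^sup>+t\<in>{0..}. ennreal (exp (- t * s / 2) / 2) \<partial>lborel) = ennreal (0 - (- exp (- 0 * s / 2) / s))"
  proof (rule nn_integral_FTC_atLeast)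
    show "((\<lambda>t. - exp (- t * s / 2) / s) has_real_derivative exp (- t * s / 2) / 2) (at t)" for t
      using s by (auto intro!: derivative_eq_intros simp: field_simps)
    show "((\<lambda>t. - exp (- t * s / 2) / s) \<longlongrightarrow> 0) at_top"
      using s by real_asymp
  qed auto
  then show ?thesis using s by (simp add: inverse_ennreal inverse_eq_divide)
qed

lemma nn_integral_powr_atLeast:
  assumes d: "(2::real) < d"
  shows "(\<integral>\<^sup>+t\<in>{0..}. ennreal ((1 + t) powr (- d / 2) / 2) \<partial>lborel) = ennreal (1 / (d - 2))"
proof -
  have "(\<integral>\<^sup>+t\<in>{0..}. ennreal ((1 + t) powr (- d / 2) / 2) \<partial>lborel)
      = ennreal (0 - (- ((1 + 0) powr (1 - d / 2)) / (d - 2)))"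
  proof (rule nn_integral_FTC_atLeast)
    show "((\<lambda>t. - ((1 + t) powr (1 - d / 2)) / (d - 2)) has_real_derivative (1 + t) powr (- d / 2) / 2) (at t)"
      if "0 \<le> t" for t
    proof -
      have "((\<lambda>t. (1 + t) powr (1 - d / 2)) has_real_derivative (1 - d / 2) * (1 + t) powr (1 - d / 2 - 1)) (at t)"
        using that by (auto intro!: derivative_eq_intros)
      then have "((\<lambda>t. - ((1 + t) powr (1 - d / 2)) / (d - 2)) has_real_derivative
          - ((1 - d / 2) * (1 + t) powr (1 - d / 2 - 1)) / (d - 2)) (at t)"
        by (intro DERIV_cdivide DERIV_minus)
      moreover have "- ((1 - d / 2) * p) / (d - 2) = p / 2" for p using d by (simp add: field_simps)
      moreover have "1 - d / 2 - 1 = - d / 2" by simp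
      ultimately show ?thesis by (simp only:)
    qed
    show "((\<lambda>t. - ((1 + t) powr (1 - d / 2)) / (d - 2)) \<longlongrightarrow> 0) at_top"
      using d by real_asymp
  qed auto
  then show ?thesis by simp
qed

text \<open>
  Write the inverse as \<open>1/2\<close> times the integral of \<open>exp (- t s / 2)\<close> over \<open>t \<ge> 0\<close>. For fixed \<open>t\<close>
  the expectation factorises over the entries into a power of \<open>1 + t\<close> with exponent
  \<open>- (real_dim F * card K) / 2\<close>, which is integrable exactly when the assumption holds.
\<close>

lemma nn_integral_inverse_gauss_sq_norm:
  assumes J: "finite J" "K \<subseteq> J" and d: "2 < real_dim F * card K"
  shows "(\<integral>\<^sup>+x. inverse (ennreal (\<Sum>j\<in>K. (cmod (x j))\<^sup>2)) \<partial>gauss_PiM F J)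
    = ennreal (1 / (real (real_dim F) * real (card K) - 2))"
proof -
  let ?G = "gauss_PiM F J"
  define S where "S x = (\<Sum>j\<in>K. (cmod (x j))\<^sup>2)" for x :: "'a \<Rightarrow> complex"
  have KJ: "j \<in> J" if "j \<in> K" for j using J(2) that by blast
  have S0: "0 \<le> S x" for x by (simp add: S_def sum_nonneg)
  have Sm [measurable]: "S \<in> borel_measurable ?G"
    unfolding S_def by (intro borel_measurable_sum) (use KJ in measurable)
  interpret G: prob_space ?G by (rule prob_space_PiM_gauss)
  interpret pair_sigma_finite ?G lborel ..
  have inner: "(\<integral>\<^sup>+x. ennreal (exp (- t * S x / 2)) \<partial>?G) = ennreal ((1 + t) powr (- (real (real_dim F) * real (card K)) / 2))"
    if t: "0 \<le> t" for t
  proof -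
    define h where "h j z = (if j \<in> K then ennreal (exp (- t * (cmod z)\<^sup>2 / 2)) else 1)" for j and z :: complex
    have hm: "h j \<in> borel_measurable (gauss F)" for j unfolding h_def by measurable
    have finK: "finite K" using J finite_subset by blast
    have "ennreal (exp (- t * S x / 2)) = (\<Prod>j\<in>J. h j (x j))" for x
    proof -
      have "(\<Prod>j\<in>J. h j (x j)) = (\<Prod>j\<in>K. ennreal (exp (- t * (cmod (x j))\<^sup>2 / 2)))"
        unfolding h_def by (rule prod.mono_neutral_cong_right) (use J in auto)
      also have "\<dots> = ennreal (exp (\<Sum>j\<in>K. - t * (cmod (x j))\<^sup>2 / 2))"
        by (simp add: prod_ennreal exp_sum[OF finK])
      also have "(\<Sum>j\<in>K. - t * (cmod (x j))\<^sup>2 / 2) = - t * S x / 2"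
        by (simp add: S_def sum_distrib_left sum_negf sum_divide_distrib)
      finally show ?thesis by simp
    qed
    then have "(\<integral>\<^sup>+x. ennreal (exp (- t * S x / 2)) \<partial>?G) = (\<integral>\<^sup>+x. (\<Prod>j\<in>J. h j (x j)) \<partial>?G)" by simp
    also have "\<dots> = (\<Prod>j\<in>J. \<integral>\<^sup>+z. h j z \<partial>gauss F)"
      by (rule product_sigma_finite.product_nn_integral_prod[OF product_sigma_finite_gauss J(1) hm])
    also have "\<dots> = (\<Prod>j\<in>K. ennreal ((1 + t) powr (- real (real_dim F) / 2)))"
      by (rule prod.mono_neutral_cong_right)
        (use J nn_integral_gauss_exp[OF t] prob_space.emeasure_space_1[OF prob_space_gauss[of F]] in \<open>auto simp: h_def\<close>)
    also have "\<dots> = ennreal (((1 + t) powr (- real (real_dim F) / 2)) ^ card K)"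
      by (simp add: ennreal_power)
    also have "((1 + t) powr (- real (real_dim F) / 2)) ^ card K = (1 + t) powr (- (real (real_dim F) * real (card K)) / 2)"
      using t by (subst powr_realpow[symmetric]) (auto simp: powr_powr)
    finally show ?thesis .
  qed
  have "(\<integral>\<^sup>+x. inverse (ennreal (S x)) \<partial>?G)
      = (\<integral>\<^sup>+x. \<integral>\<^sup>+t. ennreal (exp (- t * S x / 2) / 2) * indicator {0..} t \<partial>lborel \<partial>?G)"
    by (simp add: inverse_as_exp_integral[OF S0])
  also have "\<dots> = (\<integral>\<^sup>+t. \<integral>\<^sup>+x. ennreal (exp (- t * S x / 2) / 2) * indicator {0..} t \<partial>?G \<partial>lborel)"
    by (rule Fubini'[symmetric]) measurable
  also have "\<dots> = (\<integral>\<^sup>+t\<in>{0..}. ennreal ((1 + t) powr (- (real (real_dim F) * real (card K)) / 2) / 2) \<partial>lborel)"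
  proof (rule nn_integral_cong)
    fix t :: real
    have "(\<integral>\<^sup>+x. ennreal (exp (- t * S x / 2) / 2) \<partial>?G)
        = ennreal ((1 + t) powr (- (real (real_dim F) * real (card K)) / 2) / 2)" if "0 \<le> t"
    proof -
      have "(\<integral>\<^sup>+x. ennreal (exp (- t * S x / 2) / 2) \<partial>?G) = (\<integral>\<^sup>+x. ennreal (1/2) * ennreal (exp (- t * S x / 2)) \<partial>?G)"
        by (rule nn_integral_cong) (subst ennreal_mult[symmetric], auto)
      also have "\<dots> = ennreal (1/2) * ennreal ((1 + t) powr (- (real (real_dim F) * real (card K)) / 2))"
        unfolding inner[OF that, symmetric] by (rule nn_integral_cmult) measurable
      also have "\<dots> = ennreal ((1 + t) powr (- (real (real_dim F) * real (card K)) / 2) / 2)"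
        by (subst ennreal_mult[symmetric]) auto
      finally show ?thesis .
    qed
    then show "(\<integral>\<^sup>+x. ennreal (exp (- t * S x / 2) / 2) * indicator {0..} t \<partial>?G)
        = ennreal ((1 + t) powr (- (real (real_dim F) * real (card K)) / 2) / 2) * indicator {0..} t"
      by (cases "0 \<le> t") (simp_all only: indicator_simps atLeast_iff mult_1_right mult_zero_right nn_integral_const mult_zero_left simp_thms)
  qed
  also have "\<dots> = ennreal (1 / (real (real_dim F) * real (card K) - 2))"
  proof (rule nn_integral_powr_atLeast)
    have "real 2 < real (real_dim F * card K)" using d by (simp only: of_nat_less_iff)
    then show "2 < real (real_dim F) * real (card K)" by simp
  qed
  finally show ?thesis by (simp add: S_def)
qed

lemma gauss_isometry_unitary:
  fixes I :: "'i set"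
  assumes F: "real_or_complex F" and I: "finite I"
    and UF: "\<And>i l. i \<in> I \<Longrightarrow> l \<in> I \<Longrightarrow> U i l \<in> F"
    and cols: "\<And>l m. l \<in> I \<Longrightarrow> m \<in> I \<Longrightarrow> (\<Sum>i\<in>I. U i l * cnj (U i m)) = (if l = m then 1 else 0)"
    and rows: "\<And>i j. i \<in> I \<Longrightarrow> j \<in> I \<Longrightarrow> (\<Sum>l\<in>I. U i l * cnj (U j l)) = (if i = j then 1 else 0)"
  shows "gauss_isometry F I (\<lambda>x. \<lambda>i\<in>I. \<Sum>l\<in>I. U i l * x l)"
proof
  show "F = \<real> \<or> F = UNIV" using F by (simp add: real_or_complex_def)
  show "finite I" by (rule I)
  show "(\<lambda>x. \<lambda>i\<in>I. \<Sum>l\<in>I. U i l * x l) \<in> ref_PiM F I \<rightarrow>\<^sub>M ref_PiM F I"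
    by measurable
  show "(\<lambda>i\<in>I. \<Sum>l\<in>I. U i l * (\<lambda>i\<in>I. x i + y i) l)
      = (\<lambda>i\<in>I. (\<lambda>i\<in>I. \<Sum>l\<in>I. U i l * x l) i + (\<lambda>i\<in>I. \<Sum>l\<in>I. U i l * y l) i)" for x y
    by (rule restrict_ext) (simp add: distrib_left sum.distrib)
  show "(\<lambda>i\<in>I. \<Sum>l\<in>I. U i l * x l) i \<in> F" if "\<forall>i\<in>I. x i \<in> F" "i \<in> I" for x i
    using that UF by (auto intro!: real_or_complex_sum[OF F] real_or_complex_closed[OF F])
next
  fix x :: "'i \<Rightarrow> complex"
  have sq: "complex_of_real ((cmod z)\<^sup>2) = z * cnj z" for z using complex_norm_square[of z] by simp
  have "complex_of_real (\<Sum>i\<in>I. (cmod (\<Sum>l\<in>I. U i l * x l))\<^sup>2)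
      = (\<Sum>i\<in>I. (\<Sum>l\<in>I. U i l * x l) * (\<Sum>m\<in>I. cnj (U i m) * cnj (x m)))"
    unfolding of_real_sum sq by simp
  also have "\<dots> = (\<Sum>i\<in>I. \<Sum>l\<in>I. \<Sum>m\<in>I. x l * cnj (x m) * (U i l * cnj (U i m)))"
    unfolding sum_product by (intro sum.cong refl) (simp add: mult_ac)
  also have "\<dots> = (\<Sum>l\<in>I. \<Sum>i\<in>I. \<Sum>m\<in>I. x l * cnj (x m) * (U i l * cnj (U i m)))" by (rule sum.swap)
  also have "\<dots> = (\<Sum>l\<in>I. \<Sum>m\<in>I. x l * cnj (x m) * (\<Sum>i\<in>I. U i l * cnj (U i m)))"
    unfolding sum_distrib_left by (intro sum.cong refl sum.swap)
  also have "\<dots> = (\<Sum>l\<in>I. \<Sum>m\<in>I. if l = m then x l * cnj (x l) else 0)"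
    by (intro sum.cong refl) (auto simp: cols)
  also have "\<dots> = complex_of_real (\<Sum>l\<in>I. (cmod (x l))\<^sup>2)"
    unfolding of_real_sum sq using I by simp
  finally have "(\<Sum>i\<in>I. (cmod (\<Sum>l\<in>I. U i l * x l))\<^sup>2) = (\<Sum>l\<in>I. (cmod (x l))\<^sup>2)"
    using of_real_eq_iff by blast
  then show "(\<Sum>i\<in>I. (cmod ((\<lambda>i\<in>I. \<Sum>l\<in>I. U i l * x l) i))\<^sup>2) = (\<Sum>i\<in>I. (cmod (x i))\<^sup>2)"
    by simp
next
  fix a :: "'i \<Rightarrow> complex" assume a: "\<forall>i\<in>I. a i \<in> F"
  define b where "b = (\<lambda>l. \<Sum>j\<in>I. cnj (U j l) * a j)"
  have "b l \<in> F" if "l \<in> I" for l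
    unfolding b_def using that UF a by (auto intro!: real_or_complex_sum[OF F] real_or_complex_closed[OF F])
  moreover have "(\<Sum>l\<in>I. U i l * b l) = a i" if i: "i \<in> I" for i
  proof -
    have "(\<Sum>l\<in>I. U i l * b l) = (\<Sum>l\<in>I. \<Sum>j\<in>I. a j * (U i l * cnj (U j l)))"
      unfolding b_def sum_distrib_left by (intro sum.cong refl) (simp add: mult_ac)
    also have "\<dots> = (\<Sum>j\<in>I. a j * (\<Sum>l\<in>I. U i l * cnj (U j l)))"
      unfolding sum_distrib_left by (rule sum.swap)
    also have "\<dots> = (\<Sum>j\<in>I. if i = j then a i else 0)"
      by (intro sum.cong refl) (auto simp: rows i)
    finally show ?thesis using I i by simp
  qed
  ultimately show "\<exists>b. (\<forall>i\<in>I. b i \<in> F) \<and> (\<forall>i\<in>I. (\<lambda>i\<in>I. \<Sum>l\<in>I. U i l * b l) i = a i)"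
    by (intro exI[of _ b]) simp
qed

lemma orthonormal_conj_rows:
  assumes u: "orthonormal n {..<n} u" and "i < n" "j < n"
  shows "(\<Sum>l<n. cnj (u i l) * u j l) = (if i = j then 1 else 0)"
  using orthonormalD[OF u, of i j] assms by (simp add: ip_def)

lemma orthonormal_conj_cols:
  assumes u: "orthonormal n {..<n} u" and "a < n" "b < n"
  shows "(\<Sum>j<n. cnj (u j a) * u j b) = (if a = b then 1 else 0)"
  using orthonormal_complete[OF u, of b a] assms by (auto simp: mult.commute)

text \<open>
  A change to the coordinates of the basis \<open>v\<close> in every column.
\<close>

lemma left_action_isometry:
  fixes n k :: nat
  assumes F: "real_or_complex F" and v: "orthonormal n {..<n} v"
    and vF: "\<And>i l. i < n \<Longrightarrow> l < n \<Longrightarrow> v i l \<in> F"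
  shows "gauss_isometry F ({..<n} \<times> {..<k})
    (\<lambda>x. \<lambda>(i, j)\<in>{..<n} \<times> {..<k}. ip n (v i) (\<lambda>l. x (l, j)))"
proof -
  let ?I = "{..<n} \<times> {..<k}"
  define U where "U p q = (if snd p = snd q then cnj (v (fst p) (fst q)) else 0)" for p q :: "nat \<times> nat"
  have sum_pair: "(\<Sum>q\<in>?I. f q) = (\<Sum>j<k. \<Sum>l<n. f (l, j))" for f :: "nat \<times> nat \<Rightarrow> complex"
  proof -
    have "(\<Sum>q\<in>?I. f q) = (\<Sum>l<n. \<Sum>j<k. f (l, j))" by (simp add: sum.cartesian_product)
    also have "\<dots> = (\<Sum>j<k. \<Sum>l<n. f (l, j))" by (rule sum.swap)
    finally show ?thesis .
  qed
  have "gauss_isometry F ?I (\<lambda>x. \<lambda>p\<in>?I. \<Sum>q\<in>?I. U p q * x q)"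
  proof (rule gauss_isometry_unitary[OF F])
    show "finite ?I" by simp
    show "U p q \<in> F" if "p \<in> ?I" "q \<in> ?I" for p q
      using that vF by (auto simp: U_def intro!: real_or_complex_closed[OF F])
    show "(\<Sum>p\<in>?I. U p q * cnj (U p m)) = (if q = m then 1 else 0)" if qm: "q \<in> ?I" "m \<in> ?I" for q m
    proof -
      have "(\<Sum>p\<in>?I. U p q * cnj (U p m))
          = (\<Sum>j<k. if j = snd q then (if j = snd m then (\<Sum>i<n. cnj (v i (fst q)) * v i (fst m)) else 0) else 0)"
        unfolding sum_pair by (rule sum.cong) (auto simp: U_def)
      also have "\<dots> = (if q = m then 1 else 0)"
        using qm by (auto simp: orthonormal_conj_cols[OF v] split: if_splits)
      finally show ?thesis .
    qed
    show "(\<Sum>q\<in>?I. U p q * cnj (U m q)) = (if p = m then 1 else 0)" if pm: "p \<in> ?I" "m \<in> ?I" for p m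
    proof -
      have "(\<Sum>q\<in>?I. U p q * cnj (U m q))
          = (\<Sum>j<k. if j = snd p then (if j = snd m then (\<Sum>l<n. cnj (v (fst p) l) * v (fst m) l) else 0) else 0)"
        unfolding sum_pair by (rule sum.cong) (auto simp: U_def)
      also have "\<dots> = (if p = m then 1 else 0)"
        using pm by (auto simp: orthonormal_conj_rows[OF v] split: if_splits)
      finally show ?thesis .
    qed
  qed
  also have "(\<lambda>x. \<lambda>p\<in>?I. \<Sum>q\<in>?I. U p q * x q) = (\<lambda>x. \<lambda>(i, j)\<in>?I. ip n (v i) (\<lambda>l. x (l, j)))"
  proof (rule ext, rule restrict_ext)
    fix x p assume p: "p \<in> ?I"
    have "(\<Sum>q\<in>?I. U p q * x q) = (\<Sum>j<k. if j = snd p then ip n (v (fst p)) (\<lambda>l. x (l, j)) else 0)"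
      unfolding sum_pair by (rule sum.cong) (auto simp: U_def ip_def)
    then show "(\<Sum>q\<in>?I. U p q * x q) = (case p of (i, j) \<Rightarrow> ip n (v i) (\<lambda>l. x (l, j)))"
      using p by (auto simp: split_beta)
  qed
  finally show ?thesis .
qed

text \<open>
  A change to the coordinates of the basis \<open>u\<close> in the single row \<open>c\<close>.
\<close>

lemma row_action_isometry:
  assumes F: "real_or_complex F" and u: "orthonormal k {..<k} u"
    and uF: "\<And>i l. i < k \<Longrightarrow> l < k \<Longrightarrow> u i l \<in> F"
  shows "gauss_isometry F ({c} \<times> {..<k})
    (\<lambda>x. \<lambda>(i, j)\<in>{c} \<times> {..<k}. ip k (u j) (\<lambda>l. x (c, l)))"
proof -
  let ?I = "{c} \<times> {..<k}"
  define U where "U p q = cnj (u (snd p) (snd q))" for p q :: "'a \<times> nat"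
  have sum_pair: "(\<Sum>q\<in>?I. f q) = (\<Sum>j<k. f (c, j))" for f :: "'a \<times> nat \<Rightarrow> complex"
    using sum.cartesian_product[of "\<lambda>i j. f (i, j)" "{..<k}" "{c}"] by simp
  have "gauss_isometry F ?I (\<lambda>x. \<lambda>p\<in>?I. \<Sum>q\<in>?I. U p q * x q)"
  proof (rule gauss_isometry_unitary[OF F])
    show "finite ?I" by simp
    show "U p q \<in> F" if "p \<in> ?I" "q \<in> ?I" for p q
      using that uF by (auto simp: U_def intro!: real_or_complex_closed[OF F])
    show "(\<Sum>p\<in>?I. U p q * cnj (U p m)) = (if q = m then 1 else 0)" if "q \<in> ?I" "m \<in> ?I" for q m
      unfolding sum_pair U_def using that by (auto simp: orthonormal_conj_cols[OF u] split: if_splits)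
    show "(\<Sum>q\<in>?I. U p q * cnj (U m q)) = (if p = m then 1 else 0)" if "p \<in> ?I" "m \<in> ?I" for p m
      unfolding sum_pair U_def using that by (auto simp: orthonormal_conj_rows[OF u] split: if_splits)
  qed
  also have "(\<lambda>x. \<lambda>p\<in>?I. \<Sum>q\<in>?I. U p q * x q) = (\<lambda>x. \<lambda>(i, j)\<in>?I. ip k (u j) (\<lambda>l. x (c, l)))"
    by (rule ext, rule restrict_ext) (auto simp: sum_pair U_def ip_def)
  finally show ?thesis .
qed

section \<open>Residuals of random rows\<close>

text \<open>
  The component of \<open>v\<close> orthogonal to the span of the list, by Gram-Schmidt. The explicit
  recursion makes measurability in the entries evident. If the head of the list already lies in the
  span of the tail, its residual is 0 and so is the correction, whatever the quotient.
\<close>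

fun resid :: "nat \<Rightarrow> (nat \<Rightarrow> complex) list \<Rightarrow> (nat \<Rightarrow> complex) \<Rightarrow> (nat \<Rightarrow> complex)" where
  "resid n [] v = v"
| "resid n (w # ws) v = (\<lambda>i. resid n ws v i
     - (ip n (resid n ws w) (resid n ws v) / of_real (nsq n (resid n ws w))) * resid n ws w i)"

lemma ip_resid_Cons:
  "ip n x (resid n (w # ws) v) = ip n x (resid n ws v)
    - ip n (resid n ws w) (resid n ws v) / of_real (nsq n (resid n ws w)) * ip n x (resid n ws w)"
  by (simp only: resid.simps ip_diff ip_scale)

lemma ip_resid:
  assumes "\<And>w. w \<in> set ws \<Longrightarrow> ip n x w = 0"
  shows "ip n x (resid n ws v) = ip n x v"
  using assms
proof (induction ws arbitrary: v)
  case (Cons w ws)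
  have "ip n x (resid n ws w) = 0" using Cons by simp
  then show ?case using Cons by (simp add: ip_resid_Cons del: resid.simps(2))
qed simp

lemma ip_resid_left:
  assumes "\<And>w. w \<in> set ws \<Longrightarrow> ip n w x = 0"
  shows "ip n (resid n ws v) x = ip n v x"
proof -
  have "ip n x (resid n ws v) = ip n x v"
  proof (rule ip_resid)
    fix w assume "w \<in> set ws"
    then show "ip n x w = 0" using assms[of w] cnj_ip[of n w x] by simp
  qed
  then show ?thesis by (metis cnj_ip)
qed

lemma resid_orthogonal: "w \<in> set ws \<Longrightarrow> ip n w (resid n ws v) = 0"
proof (induction ws arbitrary: v w)
  case (Cons w0 ws)
  let ?z = "resid n (w0 # ws) v"
  have ws: "ip n w ?z = 0" if "w \<in> set ws" for w
    using Cons.IH[OF that] by (simp add: ip_resid_Cons del: resid.simps(2))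
  have "ip n w0 ?z = ip n (resid n ws w0) ?z"
    by (rule ip_resid_left[OF ws, symmetric])
  also have "\<dots> = 0"
  proof (cases "nsq n (resid n ws w0) = 0")
    case True
    then show ?thesis by (simp add: ip_def nsq_eq_0_iff del: resid.simps(2))
  next
    case False
    then show ?thesis by (simp add: ip_resid_Cons ip_self del: resid.simps(2))
  qed
  finally show ?case using Cons.prems ws by (auto simp del: resid.simps(2))
qed simp

lemma ip_self_resid: "ip n v (resid n ws v) = of_real (nsq n (resid n ws v))"
  using ip_resid_left[of ws n "resid n ws v" v] resid_orthogonal[of _ ws n v] by (simp add: ip_self)

lemma resid_cong:
  assumes "\<And>i. i < n \<Longrightarrow> v i = v' i" "length ws = length ws'"
    "\<And>s i. s < length ws \<Longrightarrow> i < n \<Longrightarrow> (ws ! s) i = (ws' ! s) i" "i < n"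
  shows "resid n ws v i = resid n ws' v' i"
  using assms(2,1,3,4)
proof (induction ws ws' arbitrary: v v' i rule: list_induct2)
  case (Cons w ws w' ws')
  have rest: "(ws ! s) i = (ws' ! s) i" if "s < length ws" "i < n" for s i
    using Cons.prems(2)[of "Suc s" i] that by simp
  have w: "w i = w' i" if "i < n" for i using Cons.prems(2)[of 0 i] that by simp
  have 1: "resid n ws v i = resid n ws' v' i" if "i < n" for i
    by (rule Cons.IH) (use Cons.prems(1) rest that in auto)
  have 2: "resid n ws w i = resid n ws' w' i" if "i < n" for i
    by (rule Cons.IH) (use w rest that in auto)
  have "ip n (resid n ws w) (resid n ws v) = ip n (resid n ws' w') (resid n ws' v')"
    by (rule ip_cong) (use 1 2 in auto)
  moreover have "nsq n (resid n ws w) = nsq n (resid n ws' w')" by (rule nsq_cong) (use 2 in auto)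
  ultimately show ?case using 1 2 Cons.prems(3) by simp
qed simp

lemma ip_measurable:
  assumes "\<And>i. i < n \<Longrightarrow> (\<lambda>x. f x i) \<in> borel_measurable M" "\<And>i. i < n \<Longrightarrow> (\<lambda>x. g x i) \<in> borel_measurable M"
  shows "(\<lambda>x. ip n (f x) (g x)) \<in> borel_measurable M"
proof -
  have cnj: "cnj \<in> borel_measurable borel" by (intro borel_measurable_continuous_onI continuous_intros)
  show ?thesis
    unfolding ip_def
    by (intro borel_measurable_sum borel_measurable_times measurable_compose[OF assms(1) cnj] assms(2)) auto
qed

lemma nsq_measurable:
  assumes "\<And>i. i < n \<Longrightarrow> (\<lambda>x. f x i) \<in> borel_measurable M"
  shows "(\<lambda>x. nsq n (f x)) \<in> borel_measurable M"
proof -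
  have "(\<lambda>x. (cmod (f x i))\<^sup>2) \<in> borel_measurable M" if "i \<in> {..<n}" for i
  proof -
    have [measurable]: "(\<lambda>x. f x i) \<in> borel_measurable M" using assms that by simp
    show ?thesis by measurable
  qed
  then show ?thesis unfolding nsq_def by (rule borel_measurable_sum)
qed

lemma resid_measurable:
  assumes "\<And>l j. l \<in> set ls \<Longrightarrow> j < n \<Longrightarrow> (\<lambda>x. W x l j) \<in> borel_measurable M"
    and "\<And>j. j < n \<Longrightarrow> (\<lambda>x. v x j) \<in> borel_measurable M" and "i < n"
  shows "(\<lambda>x. resid n (map (W x) ls) (v x) i) \<in> borel_measurable M"
  using assms
proof (induction ls arbitrary: v i)
  case (Cons l ls)
  have 1 [measurable]: "(\<lambda>x. resid n (map (W x) ls) (v x) i) \<in> borel_measurable M" if "i < n" for i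
    by (rule Cons.IH) (use Cons.prems that in auto)
  have 2 [measurable]: "(\<lambda>x. resid n (map (W x) ls) (W x l) i) \<in> borel_measurable M" if "i < n" for i
    by (rule Cons.IH) (use Cons.prems that in auto)
  have [measurable]: "(\<lambda>x. ip n (resid n (map (W x) ls) (W x l)) (resid n (map (W x) ls) (v x))) \<in> borel_measurable M"
    by (rule ip_measurable) (use 1 2 in auto)
  have [measurable]: "(\<lambda>x. nsq n (resid n (map (W x) ls) (W x l))) \<in> borel_measurable M"
    by (rule nsq_measurable) (use 2 in auto)
  show ?case using Cons.prems(3) by simp
qed simp

definition other_rows :: "nat \<Rightarrow> nat \<Rightarrow> nat list" where
  "other_rows \<rho> c = filter (\<lambda>l. l \<noteq> c) [0..<\<rho>]"

lemma set_other_rows [simp]: "set (other_rows \<rho> c) = {..<\<rho>} - {c}"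
  by (auto simp: other_rows_def)

lemma length_other_rows: "c < \<rho> \<Longrightarrow> length (other_rows \<rho> c) = \<rho> - 1"
  using distinct_card[of "other_rows \<rho> c"] set_other_rows[of \<rho> c]
  by (simp add: other_rows_def)

definition row_resid :: "nat \<Rightarrow> nat \<Rightarrow> (nat \<times> nat \<Rightarrow> complex) \<Rightarrow> nat \<Rightarrow> nat \<Rightarrow> complex" where
  "row_resid k \<rho> y c = resid k (map (\<lambda>l j. y (l, j)) (other_rows \<rho> c)) (\<lambda>j. y (c, j))"

lemma row_resid_cong:
  assumes "\<And>l j. l < \<rho> \<Longrightarrow> j < k \<Longrightarrow> y (l, j) = y' (l, j)" "c < \<rho>" "j < k"
  shows "row_resid k \<rho> y c j = row_resid k \<rho> y' c j"
  unfolding row_resid_def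
proof (rule resid_cong)
  fix s i assume s: "s < length (map (\<lambda>l j. y (l, j)) (other_rows \<rho> c))" and i: "i < k"
  then have "other_rows \<rho> c ! s \<in> set (other_rows \<rho> c)" by (intro nth_mem) simp
  then have "other_rows \<rho> c ! s < \<rho>" unfolding set_other_rows by simp
  then show "(map (\<lambda>l j. y (l, j)) (other_rows \<rho> c) ! s) i = (map (\<lambda>l j. y' (l, j)) (other_rows \<rho> c) ! s) i"
    using s i assms(1) by simp
qed (use assms in auto)

lemma row_resid_measurable:
  assumes "\<And>l j. l < \<rho> \<Longrightarrow> j < k \<Longrightarrow> (\<lambda>x. f x (l, j)) \<in> borel_measurable M" "c < \<rho>" "i < k"
  shows "(\<lambda>x. row_resid k \<rho> (f x) c i) \<in> borel_measurable M"
  unfolding row_resid_def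
  by (rule resid_measurable[where W = "\<lambda>x l j. f x (l, j)" and v = "\<lambda>x j. f x (c, j)"]) (use assms in auto)

text \<open>
  The vectors dual to the first \<open>\<rho>\<close> rows of \<open>y\<close>. The conjugate compensates that \<open>ip\<close>
  conjugates its first argument, while rows meet dual rows in a bilinear product.
\<close>

definition dual_row :: "nat \<Rightarrow> nat \<Rightarrow> (nat \<times> nat \<Rightarrow> complex) \<Rightarrow> nat \<Rightarrow> nat \<Rightarrow> complex" where
  "dual_row k \<rho> y c j = cnj (row_resid k \<rho> y c j) / of_real (nsq k (row_resid k \<rho> y c))"

lemma dual_row:
  assumes "l < \<rho>" "c < \<rho>" "nsq k (row_resid k \<rho> y c) \<noteq> 0"
  shows "(\<Sum>j<k. y (l, j) * dual_row k \<rho> y c j) = (if l = c then 1 else 0)"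
proof -
  have "(\<Sum>j<k. y (l, j) * dual_row k \<rho> y c j)
      = cnj (ip k (\<lambda>j. y (l, j)) (row_resid k \<rho> y c)) / of_real (nsq k (row_resid k \<rho> y c))"
    by (simp add: dual_row_def ip_def sum_divide_distrib)
  also have "\<dots> = (if l = c then 1 else 0)"
  proof (cases "l = c")
    case True
    then have "ip k (\<lambda>j. y (l, j)) (row_resid k \<rho> y c) = of_real (nsq k (row_resid k \<rho> y c))"
      unfolding row_resid_def by (simp only: ip_self_resid)
    then show ?thesis using True assms(3) by simp
  next
    case False
    have "ip k (\<lambda>j. y (l, j)) (row_resid k \<rho> y c) = 0"
      unfolding row_resid_def by (rule resid_orthogonal) (use False assms in auto)
    then show ?thesis using False by simp
  qed
  finally show ?thesis .
qed

lemma nsq_dual_row: "nsq k (dual_row k \<rho> y c) = 1 / nsq k (row_resid k \<rho> y c)"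
proof -
  have "nsq k (dual_row k \<rho> y c) = (\<Sum>j<k. (cmod (row_resid k \<rho> y c j))\<^sup>2 / (nsq k (row_resid k \<rho> y c))\<^sup>2)"
    unfolding nsq_def[of k "dual_row k \<rho> y c"] dual_row_def
    by (simp add: norm_divide power_divide)
  also have "\<dots> = nsq k (row_resid k \<rho> y c) / (nsq k (row_resid k \<rho> y c))\<^sup>2"
    by (simp add: nsq_def flip: sum_divide_distrib)
  finally show ?thesis by (simp add: power2_eq_square)
qed

text \<open>
  Choose an orthonormal basis whose members from \<open>length ws\<close> on are orthogonal to the
  list. The coordinates of the random row along these are not changed by passing to the residual, so
  their squares sum to at most its square norm; and by rotation invariance they are independent
  Gaussian variables.
\<close>

lemma inverse_resid_sq_integral:
  assumes F: "real_or_complex F" and m: "length ws \<le> k"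
    and wsF: "\<And>s j. s < length ws \<Longrightarrow> j < k \<Longrightarrow> (ws ! s) j \<in> F"
    and d: "2 < real_dim F * (k - length ws)"
  shows "(\<integral>\<^sup>+x. inverse (ennreal (nsq k (resid k ws (\<lambda>j. x (c, j))))) \<partial>gauss_PiM F ({c} \<times> {..<k}))
    \<le> ennreal (1 / (real (real_dim F) * real (k - length ws) - 2))"
proof -
  let ?G = "gauss_PiM F ({c} \<times> {..<k})"
  obtain u where u: "orthonormal k {..<k} u" and uF: "\<forall>j<k. \<forall>i<k. u j i \<in> F"
    and ws: "\<forall>s<length ws. \<forall>j. length ws \<le> j \<longrightarrow> j < k \<longrightarrow> ip k (ws ! s) (u j) = 0"
    using orthonormal_basis_avoiding[OF F m, of "\<lambda>s. ws ! s"] wsF by blast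
  interpret gauss_isometry F "{c} \<times> {..<k}" "\<lambda>x. \<lambda>(i, j)\<in>{c} \<times> {..<k}. ip k (u j) (\<lambda>l. x (c, l))"
    by (rule row_action_isometry[OF F u]) (use uF in auto)
  let ?T = "\<lambda>x. \<lambda>(i, j)\<in>{c} \<times> {..<k}. ip k (u j) (\<lambda>l. x (c, l))"
  let ?K = "{c} \<times> {length ws..<k}"
  let ?f = "\<lambda>x. inverse (ennreal (\<Sum>p\<in>?K. (cmod (x p))\<^sup>2))"
  have "(\<integral>\<^sup>+x. inverse (ennreal (nsq k (resid k ws (\<lambda>j. x (c, j))))) \<partial>?G) \<le> (\<integral>\<^sup>+x. ?f (?T x) \<partial>?G)"
  proof (rule nn_integral_mono)
    fix x
    \<comment> \<open>also for \<open>a \<le> 0\<close>, where the right-hand side is infinite\<close>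
    have anti: "inverse (ennreal b) \<le> inverse (ennreal a)" if "a \<le> b" for a b
    proof (cases "0 < a")
      case True
      then show ?thesis using that by (simp add: inverse_ennreal ennreal_leI le_imp_inverse_le)
    next
      case False
      then show ?thesis by (simp add: ennreal_neg)
    qed
    have "(\<Sum>p\<in>?K. (cmod (?T x p))\<^sup>2) = (\<Sum>j\<in>{length ws..<k}. (cmod (ip k (u j) (\<lambda>l. x (c, l))))\<^sup>2)"
    proof -
      have "(\<Sum>p\<in>?K. g p) = (\<Sum>j\<in>{length ws..<k}. g (c, j))" for g :: "'a \<times> nat \<Rightarrow> real"
        using sum.cartesian_product[of "\<lambda>i j. g (i, j)" "{length ws..<k}" "{c}"] by simp
      then show ?thesis by simp
    qed
    also have "\<dots> = (\<Sum>j\<in>{length ws..<k}. (cmod (ip k (u j) (resid k ws (\<lambda>j. x (c, j)))))\<^sup>2)"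
    proof (rule sum.cong)
      fix j assume j: "j \<in> {length ws..<k}"
      have "ip k (u j) (resid k ws (\<lambda>j. x (c, j))) = ip k (u j) (\<lambda>l. x (c, l))"
      proof (rule ip_resid)
        fix w assume "w \<in> set ws"
        then obtain s where "s < length ws" "w = ws ! s" by (auto simp: in_set_conv_nth)
        then have "ip k w (u j) = 0" using ws j by auto
        then show "ip k (u j) w = 0" using cnj_ip[of k w "u j"] by simp
      qed
      then show "(cmod (ip k (u j) (\<lambda>l. x (c, l))))\<^sup>2 = (cmod (ip k (u j) (resid k ws (\<lambda>j. x (c, j)))))\<^sup>2"
        by simp
    qed simp
    also have "\<dots> \<le> nsq k (resid k ws (\<lambda>j. x (c, j)))"
      by (rule bessel[OF _ orthonormal_subset[OF u]]) auto
    finally show "inverse (ennreal (nsq k (resid k ws (\<lambda>j. x (c, j))))) \<le> ?f (?T x)" by (rule anti)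
  qed
  also have "\<dots> = (\<integral>\<^sup>+x. ?f x \<partial>?G)"
  proof (rule gauss_invariant)
    have "(\<lambda>x. \<Sum>p\<in>?K. (cmod (x p))\<^sup>2) \<in> borel_measurable ?G"
      by (intro borel_measurable_sum borel_measurable_power borel_measurable_norm
          measurable_component_singleton[THEN measurable_compose, of _ _ _ "\<lambda>z. z" borel, simplified]) auto
    then show "?f \<in> borel_measurable ?G" by measurable
  qed
  also have "\<dots> = ennreal (1 / (real (real_dim F) * real (card ?K) - 2))"
    by (rule nn_integral_inverse_gauss_sq_norm) (use d in \<open>auto simp: card_cartesian_product\<close>)
  finally show ?thesis by (simp add: card_cartesian_product)
qed

lemma component_measurable_gauss:
  "p \<in> I \<Longrightarrow> (\<lambda>x. x p) \<in> borel_measurable (gauss_PiM F I)"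
  using measurable_component_singleton[of p I "\<lambda>_. gauss F"] by (simp add: measurable_cong_sets[OF refl sets_gauss])

text \<open>
  Fix all rows except \<open>c\<close> and apply the bound for a deterministic list. It needs the fixed
  rows to be over \<open>F\<close>, which holds almost surely.
\<close>

lemma row_resid_inverse_integral:
  assumes F: "real_or_complex F" and c: "c < \<rho>" and \<rho>: "\<rho> \<le> k"
    and d: "2 < real_dim F * (k - \<rho> + 1)"
  shows "(\<integral>\<^sup>+x. inverse (ennreal (nsq k (row_resid k \<rho> x c))) \<partial>gauss_PiM F ({..<\<rho>} \<times> {..<k}))
    \<le> ennreal (1 / (real (real_dim F) * real (k - \<rho> + 1) - 2))"
proof -
  let ?f = "\<lambda>x. inverse (ennreal (nsq k (row_resid k \<rho> x c)))"
  let ?I = "({..<\<rho>} - {c}) \<times> {..<k}" and ?J = "{c} \<times> {..<k}"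
  let ?b = "ennreal (1 / (real (real_dim F) * real (k - \<rho> + 1) - 2))"
  have IJ: "{..<\<rho>} \<times> {..<k} = ?I \<union> ?J" using c by auto
  have fm: "?f \<in> borel_measurable (gauss_PiM F (?I \<union> ?J))"
  proof -
    have "(\<lambda>x. nsq k (row_resid k \<rho> x c)) \<in> borel_measurable (gauss_PiM F (?I \<union> ?J))"
      by (intro nsq_measurable row_resid_measurable component_measurable_gauss) (use c in auto)
    then show ?thesis by measurable
  qed
  have F': "F = \<real> \<or> F = UNIV" using F by (simp add: real_or_complex_def)
  have AE: "AE x in gauss_PiM F ?I. \<forall>p\<in>?I. x p \<in> F"
  proof (rule AE_finite_allI)
    fix p assume "p \<in> ?I"
    then show "AE x in gauss_PiM F ?I. x p \<in> F"
      by (intro AE_PiM_component[where P = "\<lambda>z. z \<in> F"] prob_space_gauss AE_gauss F')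
  qed simp
  have "(\<integral>\<^sup>+x. ?f x \<partial>gauss_PiM F (?I \<union> ?J))
      = (\<integral>\<^sup>+x. \<integral>\<^sup>+y. ?f (merge ?I ?J (x, y)) \<partial>gauss_PiM F ?J \<partial>gauss_PiM F ?I)"
    by (rule product_sigma_finite.product_nn_integral_fold[OF product_sigma_finite_gauss _ _ _ fm]) auto
  also have "\<dots> \<le> (\<integral>\<^sup>+x. ?b \<partial>gauss_PiM F ?I)"
  proof (rule nn_integral_mono_AE)
    from AE show "AE x in gauss_PiM F ?I.
      (\<integral>\<^sup>+y. ?f (merge ?I ?J (x, y)) \<partial>gauss_PiM F ?J) \<le> ?b"
    proof eventually_elim
      case (elim x)
      let ?ws = "map (\<lambda>l j. x (l, j)) (other_rows \<rho> c)"
      have len: "length ?ws = \<rho> - 1" using length_other_rows[OF c] by simp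
      have kk: "k - length ?ws = k - \<rho> + 1" using len c \<rho> by simp
      have "row_resid k \<rho> (merge ?I ?J (x, y)) c j = resid k ?ws (\<lambda>j. y (c, j)) j" if j: "j < k" for y j
        unfolding row_resid_def
      proof (rule resid_cong)
        fix s i assume s: "s < length (map (\<lambda>l j. merge ?I ?J (x, y) (l, j)) (other_rows \<rho> c))" and i: "i < k"
        then have "other_rows \<rho> c ! s \<in> set (other_rows \<rho> c)" by (intro nth_mem) simp
        then have "other_rows \<rho> c ! s < \<rho>" "other_rows \<rho> c ! s \<noteq> c" unfolding set_other_rows by auto
        then show "(map (\<lambda>l j. merge ?I ?J (x, y) (l, j)) (other_rows \<rho> c) ! s) i = (?ws ! s) i"
          using s i by (simp add: merge_def)
      qed (use j in \<open>auto simp: merge_def\<close>)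
      then have eq: "?f (merge ?I ?J (x, y)) = inverse (ennreal (nsq k (resid k ?ws (\<lambda>j. y (c, j)))))" for y
        by (simp cong: nsq_cong)
      have "(\<integral>\<^sup>+y. inverse (ennreal (nsq k (resid k ?ws (\<lambda>j. y (c, j))))) \<partial>gauss_PiM F ?J)
          \<le> ennreal (1 / (real (real_dim F) * real (k - length ?ws) - 2))"
      proof (rule inverse_resid_sq_integral[OF F])
        show "length ?ws \<le> k" using len \<rho> by simp
        show "2 < real_dim F * (k - length ?ws)" unfolding kk by (rule d)
        fix s j assume s: "s < length ?ws" and j: "j < k"
        then have "other_rows \<rho> c ! s \<in> set (other_rows \<rho> c)" by (intro nth_mem) simp
        then have "(other_rows \<rho> c ! s, j) \<in> ?I" unfolding set_other_rows using j by auto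
        then show "(?ws ! s) j \<in> F" using elim s by simp
      qed
      then show ?case unfolding eq kk .
    qed
  qed
  also have "\<dots> = ?b"
    using prob_space.emeasure_space_1[OF prob_space_PiM_gauss[of ?I F]] by simp
  finally show ?thesis unfolding IJ .
qed

section \<open>The expected error of the Nystrom approximation\<close>

text \<open>
  The summand for \<open>c\<close> in the bound on the Nystrom error, where \<open>s l\<close> stands for
  \<open>B v\<^sub>l\<close>. The value \<open>\<infinity>\<close> for rows without a dual system makes the bound hold at every sample point;
  these arrays form a null set.
\<close>

definition dual_cost :: "nat \<Rightarrow> nat \<Rightarrow> nat \<Rightarrow> (nat \<Rightarrow> nat \<Rightarrow> complex) \<Rightarrow> (nat \<times> nat \<Rightarrow> complex) \<Rightarrow> nat \<Rightarrow> ennreal" where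
  "dual_cost k \<rho> n s y c = (if nsq k (row_resid k \<rho> y c) = 0 then \<infinity> else
     ennreal (nsq n (\<lambda>a. \<Sum>l\<in>{\<rho>..<n}. (\<Sum>j<k. y (l, j) * dual_row k \<rho> y c j) * s l a)))"

lemma dual_cost_measurable:
  assumes c: "c < \<rho>" "\<rho> \<le> n"
  shows "(\<lambda>y. dual_cost k \<rho> n s y c) \<in> borel_measurable (gauss_PiM F ({..<n} \<times> {..<k}))"
proof -
  let ?G = "gauss_PiM F ({..<n} \<times> {..<k})"
  have y: "(\<lambda>y. y (l, j)) \<in> borel_measurable ?G" if "l < n" "j < k" for l j
    by (rule component_measurable_gauss) (use that in auto)
  have r: "(\<lambda>y. row_resid k \<rho> y c i) \<in> borel_measurable ?G" if "i < k" for i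
    by (rule row_resid_measurable) (use y c that in auto)
  have [measurable]: "(\<lambda>y. nsq k (row_resid k \<rho> y c)) \<in> borel_measurable ?G"
    by (rule nsq_measurable[OF r])
  have cnj: "cnj \<in> borel_measurable borel" by (intro borel_measurable_continuous_onI continuous_intros)
  have d: "(\<lambda>y. dual_row k \<rho> y c j) \<in> borel_measurable ?G" if "j < k" for j
  proof -
    have [measurable]: "(\<lambda>y. cnj (row_resid k \<rho> y c j)) \<in> borel_measurable ?G"
      by (rule measurable_compose[OF r[OF that] cnj])
    show ?thesis unfolding dual_row_def by measurable
  qed
  have [measurable]: "(\<lambda>y. nsq n (\<lambda>a. \<Sum>l\<in>{\<rho>..<n}. (\<Sum>j<k. y (l, j) * dual_row k \<rho> y c j) * s l a)) \<in> borel_measurable ?G"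
    by (intro nsq_measurable borel_measurable_sum borel_measurable_times borel_measurable_const y d) auto
  show ?thesis unfolding dual_cost_def by measurable
qed

lemma gauss_bilinear_sq_integral:
  fixes n k \<rho> :: nat
  shows "(\<integral>\<^sup>+y. ennreal (nsq N (\<lambda>a. \<Sum>l\<in>{\<rho>..<n}. (\<Sum>j<k. y (l, j) * x j) * s l a)) \<partial>gauss_PiM F ({\<rho>..<n} \<times> {..<k}))
    = ennreal (real (real_dim F) * (nsq k x * (\<Sum>l\<in>{\<rho>..<n}. nsq N (s l))))"
proof -
  let ?J = "{\<rho>..<n} \<times> {..<k}"
  let ?G = "gauss_PiM F ?J"
  define C where "C a p = x (snd p) * s (fst p) a" for a and p :: "nat \<times> nat"
  have e: "(\<Sum>l\<in>{\<rho>..<n}. (\<Sum>j<k. y (l, j) * x j) * s l a) = 0 + (\<Sum>p\<in>?J. C a p * y p)" for y a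
    unfolding C_def sum_distrib_right sum.cartesian_product add_0_left
    by (rule sum.cong) (auto simp: mult_ac)
  have "(\<integral>\<^sup>+y. ennreal (nsq N (\<lambda>a. \<Sum>l\<in>{\<rho>..<n}. (\<Sum>j<k. y (l, j) * x j) * s l a)) \<partial>?G)
      = (\<integral>\<^sup>+y. (\<Sum>a<N. ennreal ((cmod (0 + (\<Sum>p\<in>?J. C a p * y p)))\<^sup>2)) \<partial>?G)"
    unfolding nsq_def e by (simp add: sum_ennreal)
  also have "\<dots> = (\<Sum>a<N. \<integral>\<^sup>+y. ennreal ((cmod (0 + (\<Sum>p\<in>?J. C a p * y p)))\<^sup>2) \<partial>?G)"
    by (rule nn_integral_sum) measurable
  also have "\<dots> = (\<Sum>a<N. ennreal (real (real_dim F) * (\<Sum>p\<in>?J. (cmod (C a p))\<^sup>2)))"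
    by (subst nn_integral_PiM_gauss_linear_sq) auto
  also have "\<dots> = ennreal (\<Sum>a<N. real (real_dim F) * (\<Sum>p\<in>?J. (cmod (C a p))\<^sup>2))"
    by (rule sum_ennreal) (simp add: sum_nonneg)
  also have "(\<Sum>a<N. real (real_dim F) * (\<Sum>p\<in>?J. (cmod (C a p))\<^sup>2))
      = real (real_dim F) * (nsq k x * (\<Sum>l\<in>{\<rho>..<n}. nsq N (s l)))"
  proof -
    have "(\<Sum>p\<in>?J. (cmod (C a p))\<^sup>2) = nsq k x * (\<Sum>l\<in>{\<rho>..<n}. (cmod (s l a))\<^sup>2)" for a
    proof -
      have "(\<Sum>p\<in>?J. (cmod (C a p))\<^sup>2) = (\<Sum>l\<in>{\<rho>..<n}. \<Sum>j<k. (cmod (x j))\<^sup>2 * (cmod (s l a))\<^sup>2)"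
        unfolding sum.cartesian_product C_def
        by (rule sum.cong) (auto simp: norm_mult power_mult_distrib)
      also have "\<dots> = (\<Sum>l\<in>{\<rho>..<n}. nsq k x * (cmod (s l a))\<^sup>2)"
        unfolding nsq_def sum_distrib_right ..
      finally show ?thesis by (simp only: sum_distrib_left)
    qed
    then have "(\<Sum>a<N. real (real_dim F) * (\<Sum>p\<in>?J. (cmod (C a p))\<^sup>2))
        = real (real_dim F) * (nsq k x * (\<Sum>a<N. \<Sum>l\<in>{\<rho>..<n}. (cmod (s l a))\<^sup>2))"
      by (simp add: sum_distrib_left)
    also have "(\<Sum>a<N. \<Sum>l\<in>{\<rho>..<n}. (cmod (s l a))\<^sup>2) = (\<Sum>l\<in>{\<rho>..<n}. nsq N (s l))"
      unfolding nsq_def by (rule sum.swap)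
    finally show ?thesis .
  qed
  finally show ?thesis .
qed

text \<open>
  The first \<open>\<rho>\<close> rows determine the dual vector and the remaining rows enter linearly.
  Integrating the latter first leaves a multiple of the inverse square norm of the residual. Its
  finite expectation also shows that the residual is almost surely nonzero.
\<close>

lemma expected_dual_cost:
  assumes F: "real_or_complex F" and c: "c < \<rho>" and \<rho>: "\<rho> \<le> k" "\<rho> \<le> n"
    and d: "2 < real_dim F * (k - \<rho> + 1)"
  shows "(\<integral>\<^sup>+y. dual_cost k \<rho> n s y c \<partial>gauss_PiM F ({..<n} \<times> {..<k}))
    \<le> ennreal (real (real_dim F) * (\<Sum>l\<in>{\<rho>..<n}. nsq n (s l)) / (real (real_dim F) * real (k - \<rho> + 1) - 2))"
proof -
  let ?I = "{..<\<rho>} \<times> {..<k}" and ?J = "{\<rho>..<n} \<times> {..<k}"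
  let ?S = "\<Sum>l\<in>{\<rho>..<n}. nsq n (s l)" and ?D = "real (real_dim F) * real (k - \<rho> + 1) - 2"
  let ?r = "\<lambda>x. nsq k (row_resid k \<rho> x c)"
  have S0: "0 \<le> ?S" by (rule sum_nonneg) simp
  have D0: "0 < ?D"
  proof -
    have "real 2 < real (real_dim F * (k - \<rho> + 1))" using d by (simp only: of_nat_less_iff)
    then show ?thesis by (simp only: of_nat_mult of_nat_numeral diff_gt_0_iff_gt)
  qed
  have IJ: "{..<n} \<times> {..<k} = ?I \<union> ?J" using \<rho> by auto
  have rm [measurable]: "?r \<in> borel_measurable (gauss_PiM F ?I)"
    by (intro nsq_measurable row_resid_measurable component_measurable_gauss) (use c in auto)
  have R: "(\<integral>\<^sup>+x. inverse (ennreal (?r x)) \<partial>gauss_PiM F ?I) \<le> ennreal (1 / ?D)"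
    by (rule row_resid_inverse_integral[OF F c \<rho>(1) d])
  then have fin: "(\<integral>\<^sup>+x. inverse (ennreal (?r x)) \<partial>gauss_PiM F ?I) \<noteq> \<infinity>"
    by (auto simp: top_unique)
  have "AE x in gauss_PiM F ?I. inverse (ennreal (?r x)) \<noteq> \<infinity>"
    by (rule nn_integral_PInf_AE[OF _ fin]) measurable
  then have AE: "AE x in gauss_PiM F ?I. ?r x \<noteq> 0" by eventually_elim auto
  have "(\<integral>\<^sup>+y. dual_cost k \<rho> n s y c \<partial>gauss_PiM F ({..<n} \<times> {..<k}))
      = (\<integral>\<^sup>+x. \<integral>\<^sup>+y. dual_cost k \<rho> n s (merge ?I ?J (x, y)) c \<partial>gauss_PiM F ?J \<partial>gauss_PiM F ?I)"
    unfolding IJ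
    by (rule product_sigma_finite.product_nn_integral_fold[OF product_sigma_finite_gauss])
      (use dual_cost_measurable[OF c \<rho>(2), of k s F] in \<open>auto simp: IJ\<close>)
  also have "\<dots> = (\<integral>\<^sup>+x. ennreal (real (real_dim F) * ?S) * inverse (ennreal (?r x)) \<partial>gauss_PiM F ?I)"
  proof (rule nn_integral_cong_AE)
    from AE show "AE x in gauss_PiM F ?I.
      (\<integral>\<^sup>+y. dual_cost k \<rho> n s (merge ?I ?J (x, y)) c \<partial>gauss_PiM F ?J)
        = ennreal (real (real_dim F) * ?S) * inverse (ennreal (?r x))"
    proof eventually_elim
      case (elim x)
      have rr: "row_resid k \<rho> (merge ?I ?J (x, y)) c j = row_resid k \<rho> x c j" if "j < k" for y j
        by (rule row_resid_cong) (use that c in \<open>auto simp: merge_def\<close>)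
      then have nr: "?r (merge ?I ?J (x, y)) = ?r x" for y by (rule nsq_cong)
      have dr: "dual_row k \<rho> (merge ?I ?J (x, y)) c j = dual_row k \<rho> x c j" if "j < k" for y j
        by (simp only: dual_row_def nr rr[OF that])
      have low: "merge ?I ?J (x, y) (l, j) = y (l, j)" if "\<rho> \<le> l" "l < n" "j < k" for y l j
        using that by (simp add: merge_def)
      have "dual_cost k \<rho> n s (merge ?I ?J (x, y)) c
          = ennreal (nsq n (\<lambda>a. \<Sum>l\<in>{\<rho>..<n}. (\<Sum>j<k. y (l, j) * dual_row k \<rho> x c j) * s l a))" for y
      proof -
        have "(\<Sum>l\<in>{\<rho>..<n}. (\<Sum>j<k. merge ?I ?J (x, y) (l, j) * dual_row k \<rho> (merge ?I ?J (x, y)) c j) * s l a)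
            = (\<Sum>l\<in>{\<rho>..<n}. (\<Sum>j<k. y (l, j) * dual_row k \<rho> x c j) * s l a)" for a
          by (intro sum.cong refl arg_cong2[where f = "(*)"]) (simp_all add: low dr)
        then show ?thesis using elim by (simp add: dual_cost_def nr)
      qed
      then have "(\<integral>\<^sup>+y. dual_cost k \<rho> n s (merge ?I ?J (x, y)) c \<partial>gauss_PiM F ?J)
          = ennreal (real (real_dim F) * (nsq k (dual_row k \<rho> x c) * ?S))"
        by (simp add: gauss_bilinear_sq_integral)
      also have "\<dots> = ennreal (real (real_dim F) * ?S * inverse (?r x))"
        unfolding nsq_dual_row by (simp add: inverse_eq_divide mult_ac)
      also have "\<dots> = ennreal (real (real_dim F) * ?S) * inverse (ennreal (?r x))"
        using S0 elim nsq_nonneg[of k "row_resid k \<rho> x c"]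
        by (subst inverse_ennreal) (auto simp: less_le intro!: ennreal_mult)
      finally show ?case .
    qed
  qed
  also have "\<dots> = ennreal (real (real_dim F) * ?S) * (\<integral>\<^sup>+x. inverse (ennreal (?r x)) \<partial>gauss_PiM F ?I)"
    by (rule nn_integral_cmult) measurable
  also have "\<dots> \<le> ennreal (real (real_dim F) * ?S) * ennreal (1 / ?D)"
    by (rule mult_left_mono[OF R]) simp
  also have "\<dots> = ennreal (real (real_dim F) * ?S / ?D)"
    using S0 D0 by (subst ennreal_mult[symmetric]) auto
  finally show ?thesis .
qed

text \<open>
  The entrywise conjugate of a Penrose inverse of \<open>H\<close> is a Penrose inverse of the conjugate
  of \<open>H\<close>, which is \<open>H\<close>; so uniqueness makes it real.
\<close>

lemma pinv_real:
  assumes H: "H \<in> carrier_mat k k" "mat_adjoint H = H" and real: "elements_mat H \<subseteq> \<real>"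
  shows "elements_mat (pinv H) \<subseteq> \<real>"
proof -
  interpret cnj: semiring_hom cnj by unfold_locales auto
  have adj: "mat_adjoint (map_mat cnj M) = map_mat cnj (mat_adjoint M)" for M :: "complex mat"
    by (rule eq_matI) auto
  obtain X where X: "penrose H X" using hermitian_penrose_exists[OF H] by blast
  have Xc: "X \<in> carrier_mat k k" and X1: "H * X * H = H" and X2: "X * H * X = X"
    and X3: "mat_adjoint (H * X) = H * X" and X4: "mat_adjoint (X * H) = X * H"
    using X H(1) by (auto simp: penrose_def)
  have Hr: "map_mat cnj H = H"
  proof (rule eq_matI)
    fix i j assume ij: "i < dim_row H" "j < dim_col H"
    then have "H $$ (i, j) \<in> \<real>" using real by auto
    then show "map_mat cnj H $$ (i, j) = H $$ (i, j)" using ij by (simp add: Reals_cnj_iff)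
  qed auto
  have HX: "map_mat cnj (H * X) = H * map_mat cnj X"
    by (simp only: cnj.mat_hom_mult[OF H(1) Xc] Hr)
  have XH: "map_mat cnj (X * H) = map_mat cnj X * H"
    by (simp only: cnj.mat_hom_mult[OF Xc H(1)] Hr)
  have HXH: "map_mat cnj (H * X * H) = H * map_mat cnj X * H"
    by (simp only: cnj.mat_hom_mult[OF mult_carrier_mat[OF H(1) Xc] H(1)] HX Hr)
  have XHX: "map_mat cnj (X * H * X) = map_mat cnj X * H * map_mat cnj X"
    by (simp only: cnj.mat_hom_mult[OF mult_carrier_mat[OF Xc H(1)] Xc] XH)
  have "penrose H (map_mat cnj X)"
    unfolding penrose_def
  proof (intro conjI)
    show "map_mat cnj X \<in> carrier_mat (dim_col H) (dim_row H)" using Xc H(1) by auto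
    show "H * map_mat cnj X * H = H" by (simp only: HXH[symmetric] X1 Hr)
    show "map_mat cnj X * H * map_mat cnj X = map_mat cnj X" by (simp only: XHX[symmetric] X2)
    show "mat_adjoint (H * map_mat cnj X) = H * map_mat cnj X" by (simp only: HX[symmetric] adj X3)
    show "mat_adjoint (map_mat cnj X * H) = map_mat cnj X * H" by (simp only: XH[symmetric] adj X4)
  qed
  then have eq: "map_mat cnj X = X" using X by (rule penrose_unique)
  show ?thesis
  proof
    fix z assume "z \<in> elements_mat (pinv H)"
    then obtain i j where ij: "i < k" "j < k" "z = X $$ (i, j)"
      using Xc by (auto simp: pinv_eq[OF X] elements_mat_def)
    have "cnj (X $$ (i, j)) = map_mat cnj X $$ (i, j)" using ij Xc by simp
    then show "z \<in> \<real>" using ij eq by (simp add: Reals_cnj_iff)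
  qed
qed

lemma mats_over_mult:
  assumes F: "real_or_complex F" and A: "A \<in> mats_over F m p" and B: "B \<in> mats_over F p n"
  shows "A * B \<in> mats_over F m n"
proof -
  have Ac: "A \<in> carrier_mat m p" and Bc: "B \<in> carrier_mat p n" using A B by (auto simp: mats_over_def)
  have "elements_mat (A * B) \<subseteq> F"
  proof
    fix z assume "z \<in> elements_mat (A * B)"
    then obtain i j where ij: "i < m" "j < n" "z = (A * B) $$ (i, j)"
      using Ac Bc by (auto simp: elements_mat_def)
    have "z = (\<Sum>l<p. A $$ (i, l) * B $$ (l, j))" unfolding ij(3) by (rule mat_mult_index[OF Ac Bc ij(1,2)])
    also have "\<dots> \<in> F"
    proof (intro real_or_complex_sum[OF F] real_or_complex_closed(6)[OF F])
      fix l assume "l \<in> {..<p}"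
      then show "A $$ (i, l) \<in> F" "B $$ (l, j) \<in> F"
        using A B ij by (auto simp: mats_over_def subset_iff)
    qed
    finally show "z \<in> F" .
  qed
  then show ?thesis using mult_carrier_mat[OF Ac Bc] by (simp add: mats_over_def)
qed

lemma mats_over_adjoint:
  assumes F: "real_or_complex F" and A: "A \<in> mats_over F m n"
  shows "mat_adjoint A \<in> mats_over F n m"
proof -
  have Ac: "A \<in> carrier_mat m n" using A by (simp add: mats_over_def)
  have "elements_mat (mat_adjoint A) \<subseteq> F"
  proof
    fix z assume "z \<in> elements_mat (mat_adjoint A)"
    then obtain i j where ij: "i < n" "j < m" "z = cnj (A $$ (j, i))"
      using Ac by (auto simp: elements_mat_def)
    have "A $$ (j, i) \<in> F" using A ij by (auto simp: mats_over_def subset_iff)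
    then show "z \<in> F" unfolding ij(3) by (rule real_or_complex_closed(7)[OF F])
  qed
  then show ?thesis using Ac by (simp add: mats_over_def)
qed

text \<open>
  The hypothesis on best approximations speaks of matrices over \<open>F\<close>; this makes it
  applicable to the Nystrom matrix.
\<close>

lemma nystrom_over:
  assumes F: "real_or_complex F" and A: "A \<in> mats_over F n n" and h: "mat_adjoint A = A"
    and \<Omega>: "\<Omega> \<in> mats_over F n k"
  shows "nystrom A \<Omega> \<in> mats_over F n n"
proof -
  define H where "H = mat_adjoint \<Omega> * (A * \<Omega>)"
  have Ac: "A \<in> carrier_mat n n" and \<Omega>c: "\<Omega> \<in> carrier_mat n k" using A \<Omega> by (auto simp: mats_over_def)
  have A\<Omega>: "A * \<Omega> \<in> mats_over F n k" by (rule mats_over_mult[OF F A \<Omega>])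
  have \<Omega>a: "mat_adjoint \<Omega> \<in> mats_over F k n" by (rule mats_over_adjoint[OF F \<Omega>])
  have HF: "H \<in> mats_over F k k" unfolding H_def by (rule mats_over_mult[OF F \<Omega>a A\<Omega>])
  have Hc: "H \<in> carrier_mat k k" using HF by (simp add: mats_over_def)
  have A\<Omega>c: "A * \<Omega> \<in> carrier_mat n k" and \<Omega>ac: "mat_adjoint \<Omega> \<in> carrier_mat k n"
    using A\<Omega> \<Omega>a by (auto simp: mats_over_def)
  have "mat_adjoint H = mat_adjoint \<Omega> * A * \<Omega>"
    unfolding H_def by (simp add: mat_adjoint_mult[OF \<Omega>ac A\<Omega>c] mat_adjoint_mult[OF Ac \<Omega>c] h)
  also have "\<dots> = H" unfolding H_def by (rule assoc_mult_mat[OF \<Omega>ac Ac \<Omega>c])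
  finally have Hh: "mat_adjoint H = H" .
  have "pinv H \<in> mats_over F k k"
    using F pinv_hermitian(1)[OF Hc Hh] pinv_real[OF Hc Hh] HF
    by (auto simp: mats_over_def real_or_complex_def)
  then have "A * \<Omega> * pinv H * mat_adjoint (A * \<Omega>) \<in> mats_over F n n"
    by (intro mats_over_mult[OF F, of _ _ k] A\<Omega> mats_over_adjoint[OF F])
  then show ?thesis by (simp add: nystrom_def Let_def H_def)
qed

lemma gaussian_entries_distr:
  assumes M: "prob_space M" and F: "F = \<real> \<or> F = UNIV" and G: "gaussian_test_matrix F M n k G"
    and nk: "0 < n" "0 < k"
  shows "(\<lambda>\<omega>. \<lambda>(i, j)\<in>{..<n} \<times> {..<k}. G \<omega> $$ (i, j)) \<in> M \<rightarrow>\<^sub>M gauss_PiM F ({..<n} \<times> {..<k})"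
    and "distr M (gauss_PiM F ({..<n} \<times> {..<k})) (\<lambda>\<omega>. \<lambda>(i, j)\<in>{..<n} \<times> {..<k}. G \<omega> $$ (i, j))
      = gauss_PiM F ({..<n} \<times> {..<k})"
proof -
  interpret prob_space M by fact
  let ?I = "{..<n} \<times> {..<k}"
  let ?X = "\<lambda>(i, j) \<omega>. G \<omega> $$ (i, j)"
  have ind: "indep_vars (\<lambda>_. borel) ?X ?I" using G by (simp add: gaussian_test_matrix_def)
  have rv: "?X p \<in> borel_measurable M" if "p \<in> ?I" for p
    using ind that unfolding indep_vars_def by blast
  have ne: "?I \<noteq> {}" using nk by auto
  have fe: "(\<lambda>\<omega>. \<lambda>(i, j)\<in>?I. G \<omega> $$ (i, j)) = (\<lambda>\<omega>. \<lambda>p\<in>?I. ?X p \<omega>)"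
    by (rule ext, rule restrict_ext) auto
  have s: "sets (gauss_PiM F ?I) = sets (PiM ?I (\<lambda>_. borel))" by (rule sets_PiM_cong) auto
  have "(\<lambda>\<omega>. \<lambda>p\<in>?I. ?X p \<omega>) \<in> M \<rightarrow>\<^sub>M PiM ?I (\<lambda>_. borel)" by (rule measurable_restrict) (rule rv)
  then show "(\<lambda>\<omega>. \<lambda>(i, j)\<in>?I. G \<omega> $$ (i, j)) \<in> M \<rightarrow>\<^sub>M gauss_PiM F ?I"
    unfolding fe by (simp add: measurable_cong_sets[OF refl s])
  have "distr M (PiM ?I (\<lambda>_. borel)) (\<lambda>\<omega>. \<lambda>p\<in>?I. ?X p \<omega>) = PiM ?I (\<lambda>p. distr M borel (?X p))"
    using ind indep_vars_iff_distr_eq_PiM'[OF ne rv] by simp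
  also have "\<dots> = gauss_PiM F ?I"
  proof (rule PiM_cong)
    fix p assume p: "p \<in> ?I"
    have "std_normal_over F M (?X p)" using G p by (auto simp: gaussian_test_matrix_def)
    then show "distr M borel (?X p) = gauss F"
      by (rule std_normal_over_distr[OF M F _ rv[OF p]])
  qed simp
  finally show "distr M (gauss_PiM F ?I) (\<lambda>\<omega>. \<lambda>(i, j)\<in>?I. G \<omega> $$ (i, j)) = gauss_PiM F ?I"
    unfolding fe using distr_cong[OF refl s, of M "\<lambda>\<omega>. \<lambda>p\<in>?I. ?X p \<omega>"] by simp
qed

text \<open>
  Both kinds of test matrix factor a Gaussian matrix; a Gaussian one trivially, with
  \<open>R = 1\<close>.
\<close>

lemma test_matrix_range:
  assumes F: "real_or_complex F" and "gaussian_test_matrix F M n k \<Omega> \<or> orthonormal_test_matrix F M n k \<Omega>"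
  shows "\<exists>G R. gaussian_test_matrix F M n k G \<and>
    (\<forall>\<omega>\<in>space M. G \<omega> \<in> carrier_mat n k \<and> \<Omega> \<omega> \<in> mats_over F n k \<and> R \<omega> \<in> carrier_mat k k \<and> G \<omega> = \<Omega> \<omega> * R \<omega>)"
  using assms(2)
proof
  assume g: "gaussian_test_matrix F M n k \<Omega>"
  then have o: "\<Omega> \<omega> \<in> mats_over F n k" if "\<omega> \<in> space M" for \<omega>
    using that by (simp add: gaussian_test_matrix_def)
  then have c: "\<Omega> \<omega> \<in> carrier_mat n k" if "\<omega> \<in> space M" for \<omega>
    using that by (simp add: mats_over_def)
  have "\<Omega> \<omega> = \<Omega> \<omega> * 1\<^sub>m k" if "\<omega> \<in> space M" for \<omega> using c[OF that] by simp
  then show ?thesis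
    by (intro exI[of _ \<Omega>] exI[of _ "\<lambda>_. 1\<^sub>m k"]) (use g o c in simp)
next
  assume "orthonormal_test_matrix F M n k \<Omega>"
  then obtain G R where g: "gaussian_test_matrix F M n k G"
    and qr: "\<forall>\<omega>\<in>space M. thin_qr F n k (G \<omega>) (\<Omega> \<omega>) (R \<omega>)"
    by (auto simp: orthonormal_test_matrix_def)
  have "G \<omega> \<in> mats_over F n k" if "\<omega> \<in> space M" for \<omega> using that g by (simp add: gaussian_test_matrix_def)
  then show ?thesis
    by (intro exI[of _ G] exI[of _ R]) (use g qr in \<open>simp add: thin_qr_def mats_over_def\<close>)
qed

text \<open>
  The bound is stated through a measurable majorant \<open>Z\<close>, because \<open>\<Omega>\<close> itself
  need not be measurable: an orthonormal test matrix is any selection of thin factors.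
\<close>

lemma expected_nystrom_error:
  assumes F: "F = \<real> \<or> F = UNIV" and \<alpha>: "\<alpha> = (if F = \<real> then 1 else 0)"
    and \<rho>: "\<rho> < k - \<alpha>" and kn: "k \<le> n"
    and A: "A \<in> mats_over F n n" and psd: "psd A" and M: "prob_space M"
    and \<Omega>: "gaussian_test_matrix F M n k \<Omega> \<or> orthonormal_test_matrix F M n k \<Omega>"
    and C: "C \<in> mats_over F n n" and rank: "mat_rank C \<le> \<rho>"
  shows "\<exists>Z\<in>borel_measurable M.
    (\<forall>\<omega>\<in>space M. ennreal (schatten_norm 1 (A - nystrom A (\<Omega> \<omega>))) \<le> Z \<omega>) \<and>
    (\<integral>\<^sup>+\<omega>. Z \<omega> \<partial>M) \<le> ennreal ((1 + real \<rho> / (real k - real \<rho> - real \<alpha>)) * schatten_norm 1 (A - C))"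
proof -
  interpret prob_space M by fact
  have RC: "real_or_complex F" using F by (simp add: real_or_complex_def)
  have Ac: "A \<in> carrier_mat n n" and Cc: "C \<in> carrier_mat n n" and CF: "elements_mat C \<subseteq> F"
    using A C by (auto simp: mats_over_def)
  obtain B where B: "B \<in> carrier_mat n n" and AB: "A = mat_adjoint B * B" by (rule psd_factor[OF Ac psd])
  have \<rho>n: "\<rho> \<le> n" and \<rho>k: "\<rho> \<le> k" and k0: "0 < k" and n0: "0 < n" using \<rho> kn by auto
  obtain S where SF: "\<And>s i. s < \<rho> \<Longrightarrow> i < n \<Longrightarrow> S s i \<in> F"
    and SC: "\<And>x j. \<lbrakk>\<And>s. s < \<rho> \<Longrightarrow> ip n (S s) x = 0\<rbrakk> \<Longrightarrow> j < n \<Longrightarrow> ip n (\<lambda>i. C $$ (i, j)) x = 0"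
    using low_rank_columns[OF Cc rank CF RC] by blast
  obtain v where v: "orthonormal n {..<n} v" and vF: "\<forall>j<n. \<forall>i<n. v j i \<in> F"
    and Sv: "\<forall>s<\<rho>. \<forall>j. \<rho> \<le> j \<longrightarrow> j < n \<longrightarrow> ip n (S s) (v j) = 0"
    using orthonormal_basis_avoiding[OF RC \<rho>n, of S] SF by blast
  have vC: "ip n (v c) (\<lambda>i. C $$ (i, j)) = 0" if "\<rho> \<le> c" "c < n" "j < n" for c j
  proof -
    have "ip n (\<lambda>i. C $$ (i, j)) (v c) = 0" by (rule SC) (use Sv that in auto)
    then show ?thesis using cnj_ip[of n "\<lambda>i. C $$ (i, j)" "v c"] by simp
  qed
  define s where "s l = app B (v l)" for l
  define t where "t = (\<Sum>c\<in>{\<rho>..<n}. nsq n (s c))"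
  have t0: "0 \<le> t" unfolding t_def by (rule sum_nonneg) simp
  have tC: "t \<le> schatten_norm 1 (A - C)"
    unfolding t_def s_def AB by (rule tail_le_schatten_one[OF B Cc v vC])
  obtain G R where G: "gaussian_test_matrix F M n k G"
    and GR': "\<forall>\<omega>\<in>space M. G \<omega> \<in> carrier_mat n k \<and> \<Omega> \<omega> \<in> mats_over F n k
      \<and> R \<omega> \<in> carrier_mat k k \<and> G \<omega> = \<Omega> \<omega> * R \<omega>"
    using test_matrix_range[OF RC \<Omega>] by blast
  then have Gc: "G \<omega> \<in> carrier_mat n k" and \<Omega>F: "\<Omega> \<omega> \<in> mats_over F n k"
    and R: "R \<omega> \<in> carrier_mat k k" and GR: "G \<omega> = \<Omega> \<omega> * R \<omega>" if "\<omega> \<in> space M" for \<omega>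
    using that by blast+
  let ?I = "{..<n} \<times> {..<k}"
  let ?P = "gauss_PiM F ?I"
  define X where "X = (\<lambda>\<omega>. \<lambda>(i, j)\<in>?I. G \<omega> $$ (i, j))"
  define T where "T = (\<lambda>x. \<lambda>(i, j)\<in>?I. ip n (v i) (\<lambda>l. x (l, j)))"
  interpret T: gauss_isometry F ?I T
    unfolding T_def by (rule left_action_isometry[OF RC v]) (use vF in auto)
  have Xm [measurable]: "X \<in> M \<rightarrow>\<^sub>M ?P" and Xd: "distr M ?P X = ?P"
    unfolding X_def by (rule gaussian_entries_distr[OF M F G n0 k0])+
  have sPL: "sets ?P = sets (ref_PiM F ?I)" by (rule sets_PiM_cong) auto
  have Tm [measurable]: "T \<in> ?P \<rightarrow>\<^sub>M ?P"
    using T.T_measurable by (simp add: measurable_cong_sets[OF sPL sPL])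
  \<comment> \<open>the majorant, as a function of the rotated Gaussian array\<close>
  define f where "f y = ennreal t + (\<Sum>c<\<rho>. dual_cost k \<rho> n s y c)" for y
  have dm: "(\<lambda>y. dual_cost k \<rho> n s y c) \<in> borel_measurable ?P" if "c < \<rho>" for c
    by (rule dual_cost_measurable[OF that \<rho>n])
  have fm [measurable]: "f \<in> borel_measurable ?P"
    unfolding f_def by (intro borel_measurable_add borel_measurable_const borel_measurable_sum dm) simp
  show ?thesis
  proof (intro bexI[of _ "\<lambda>\<omega>. f (T (X \<omega>))"] conjI ballI)
    show "(\<lambda>\<omega>. f (T (X \<omega>))) \<in> borel_measurable M" by measurable
    fix \<omega> assume \<omega>: "\<omega> \<in> space M"
    define y where "y = T (X \<omega>)"
    have y: "y (l, j) = ip n (v l) (\<lambda>i. G \<omega> $$ (i, j))" if "l < n" "j < k" for l j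
      using that by (auto simp: y_def T_def X_def intro!: ip_cong)
    show "ennreal (schatten_norm 1 (A - nystrom A (\<Omega> \<omega>))) \<le> f (T (X \<omega>))"
    proof (cases "\<exists>c<\<rho>. nsq k (row_resid k \<rho> y c) = 0")
      case True
      then obtain c where "c < \<rho>" "dual_cost k \<rho> n s y c = \<infinity>" by (auto simp: dual_cost_def)
      then have "(\<Sum>c<\<rho>. dual_cost k \<rho> n s y c) = \<infinity>" by auto
      then have "f y = \<infinity>" by (simp only: f_def) simp
      then show ?thesis unfolding y_def[symmetric] by (simp only: top_greatest infinity_ennreal_def)
    next
      case False
      let ?q = "\<lambda>c. nsq n (\<lambda>a. \<Sum>l\<in>{\<rho>..<n}. (\<Sum>j<k. y (l, j) * dual_row k \<rho> y c j) * s l a)"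
      have "schatten_norm 1 (A - nystrom A (\<Omega> \<omega>)) \<le> t + (\<Sum>c<\<rho>. ?q c)"
        unfolding t_def s_def AB
      proof (rule nystrom_error_bound[OF B Gc[OF \<omega>] _ R[OF \<omega>] GR[OF \<omega>] v \<rho>n])
        show "\<Omega> \<omega> \<in> carrier_mat n k" using \<Omega>F[OF \<omega>] by (simp add: mats_over_def)
        show "(\<Sum>j<k. y (l, j) * dual_row k \<rho> y c j) = (if l = c then 1 else 0)" if "l < \<rho>" "c < \<rho>" for l c
          by (rule dual_row[OF that]) (use False that in blast)
      qed (rule y)
      moreover have "(\<Sum>c<\<rho>. dual_cost k \<rho> n s y c) = (\<Sum>c<\<rho>. ennreal (?q c))"
        by (rule sum.cong) (use False in \<open>auto simp: dual_cost_def\<close>)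
      ultimately have "ennreal (schatten_norm 1 (A - nystrom A (\<Omega> \<omega>))) \<le> f y"
        using t0 by (simp add: f_def sum_nonneg ennreal_leI flip: ennreal_plus)
      then show ?thesis by (simp add: y_def)
    qed
  next
    let ?\<beta> = "real (real_dim F)" and ?m = "real (k - \<rho> + 1)"
    have d: "2 < real_dim F * (k - \<rho> + 1)"
      using \<rho> \<alpha> by (auto simp: real_dim_def split: if_splits)
    \<comment> \<open>this is where \<open>\<alpha> = 2 - \<beta>\<close> enters\<close>
    have ratio: "?\<beta> * t / (?\<beta> * ?m - 2) = t / (real k - real \<rho> - real \<alpha>)"
    proof -
      have m: "?m = real k - real \<rho> + 1" using \<rho>k by simp
      show ?thesis
      proof (cases "F = \<real>")
        case True
        then show ?thesis using \<alpha> m by (simp add: real_dim_def)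
      next
        case False
        have "?\<beta> * ?m - 2 = 2 * (real k - real \<rho>)" using False m by (simp add: real_dim_def)
        then have "?\<beta> * t / (?\<beta> * ?m - 2) = (2 * t) / (2 * (real k - real \<rho>))"
          using False by (simp only: real_dim_def if_False of_nat_numeral)
        also have "\<dots> = t / (real k - real \<rho>)" by (rule mult_divide_mult_cancel_left) simp
        finally show ?thesis using False \<alpha> by simp
      qed
    qed
    have pos: "0 < real k - real \<rho> - real \<alpha>" using \<rho> by linarith
    have "(\<integral>\<^sup>+\<omega>. f (T (X \<omega>)) \<partial>M) = (\<integral>\<^sup>+x. f (T x) \<partial>distr M ?P X)"
      by (rule nn_integral_distr[symmetric]) measurable
    also have "\<dots> = (\<integral>\<^sup>+x. f x \<partial>?P)" unfolding Xd by (rule T.gauss_invariant[OF fm])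
    also have "\<dots> = (\<integral>\<^sup>+x. ennreal t \<partial>?P) + (\<integral>\<^sup>+x. (\<Sum>c<\<rho>. dual_cost k \<rho> n s x c) \<partial>?P)"
      unfolding f_def
      by (rule nn_integral_add) (use dm in \<open>auto intro!: borel_measurable_sum\<close>)
    also have "(\<integral>\<^sup>+x. (\<Sum>c<\<rho>. dual_cost k \<rho> n s x c) \<partial>?P) = (\<Sum>c<\<rho>. \<integral>\<^sup>+x. dual_cost k \<rho> n s x c \<partial>?P)"
      by (rule nn_integral_sum) (use dm in auto)
    also have "(\<integral>\<^sup>+x. ennreal t \<partial>?P) = ennreal t"
      using prob_space.emeasure_space_1[OF prob_space_PiM_gauss[of ?I F]] by simp
    also have "ennreal t + (\<Sum>c<\<rho>. \<integral>\<^sup>+x. dual_cost k \<rho> n s x c \<partial>?P)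
        \<le> ennreal t + (\<Sum>c<\<rho>. ennreal (t / (real k - real \<rho> - real \<alpha>)))"
    proof (intro add_left_mono sum_mono)
      fix c assume "c \<in> {..<\<rho>}"
      then have c: "c < \<rho>" by simp
      show "(\<integral>\<^sup>+x. dual_cost k \<rho> n s x c \<partial>?P) \<le> ennreal (t / (real k - real \<rho> - real \<alpha>))"
        using expected_dual_cost[OF RC c \<rho>k \<rho>n d, of s] unfolding t_def[symmetric] ratio .
    qed
    also have "\<dots> = ennreal (t + real \<rho> * (t / (real k - real \<rho> - real \<alpha>)))"
    proof -
      have u0: "0 \<le> t / (real k - real \<rho> - real \<alpha>)" using t0 pos by simp
      have "(\<Sum>c<\<rho>. ennreal (t / (real k - real \<rho> - real \<alpha>)))
          = ennreal (\<Sum>c<\<rho>. t / (real k - real \<rho> - real \<alpha>))"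
        by (rule sum_ennreal) (rule u0)
      also have "(\<Sum>c<\<rho>. t / (real k - real \<rho> - real \<alpha>)) = real \<rho> * (t / (real k - real \<rho> - real \<alpha>))"
        by simp
      finally show ?thesis
        using ennreal_plus[OF t0 mult_nonneg_nonneg[OF of_nat_0_le_iff u0]] by simp
    qed
    also have "\<dots> \<le> ennreal ((1 + real \<rho> / (real k - real \<rho> - real \<alpha>)) * schatten_norm 1 (A - C))"
    proof (rule ennreal_leI)
      have "t + real \<rho> * (t / (real k - real \<rho> - real \<alpha>)) = (1 + real \<rho> / (real k - real \<rho> - real \<alpha>)) * t"
        by (simp add: algebra_simps)
      also have "\<dots> \<le> (1 + real \<rho> / (real k - real \<rho> - real \<alpha>)) * schatten_norm 1 (A - C)"
        using pos by (intro mult_left_mono tC) simp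
      finally show "t + real \<rho> * (t / (real k - real \<rho> - real \<alpha>))
          \<le> (1 + real \<rho> / (real k - real \<rho> - real \<alpha>)) * schatten_norm 1 (A - C)" .
    qed
    finally show "(\<integral>\<^sup>+\<omega>. f (T (X \<omega>)) \<partial>M)
        \<le> ennreal ((1 + real \<rho> / (real k - real \<rho> - real \<alpha>)) * schatten_norm 1 (A - C))" .
  qed
qed

lemma truncation_error:
  assumes p: "p = 1 \<or> p = \<infinity>"
    and A: "A \<in> mats_over F n n" and N: "N \<in> mats_over F n n"
    and tA: "best_rank_approx F r A A'" and tN: "best_rank_approx F r N N'"
  shows "schatten_norm p (A - N') \<le> schatten_norm p (A - A') + 2 * schatten_norm 1 (A - N)"
proof -
  have c: "A \<in> carrier_mat n n" "N \<in> carrier_mat n n" using A N by (auto simp: mats_over_def)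
  have A'F: "A' \<in> mats_over F n n" and A'r: "mat_rank A' \<le> r"
    using tA c by (auto simp: best_rank_approx_def)
  have N'F: "N' \<in> mats_over F n n" using tN c by (auto simp: best_rank_approx_def)
  have c': "A' \<in> carrier_mat n n" "N' \<in> carrier_mat n n" using A'F N'F by (auto simp: mats_over_def)
  have tri: "schatten_norm p (U - W) \<le> schatten_norm p (U - V) + schatten_norm p (V - W)"
    if "U \<in> carrier_mat n n" "V \<in> carrier_mat n n" "W \<in> carrier_mat n n" for U V W
    using p schatten_one_triangle[OF that] schatten_inf_triangle[OF that] by auto
  have p1: "1 \<le> p" using p by auto
  have "schatten_norm p (N - N') \<le> schatten_norm p (N - A')"
    using tN p1 A'F A'r c unfolding best_rank_approx_def by auto
  moreover have "schatten_norm p (A - N') \<le> schatten_norm p (A - N) + schatten_norm p (N - N')"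
    by (rule tri[OF c c'(2)])
  moreover have "schatten_norm p (N - A') \<le> schatten_norm p (N - A) + schatten_norm p (A - A')"
    by (rule tri[OF c(2,1) c'(1)])
  moreover have "schatten_norm p (N - A) = schatten_norm p (A - N)"
    by (rule schatten_norm_minus_commute[OF c(2,1)])
  moreover have "schatten_norm p (A - N) \<le> schatten_norm 1 (A - N)"
    using p schatten_inf_le_one[OF minus_carrier_mat[OF c(2)], of A] by auto
  ultimately show ?thesis by linarith
qed

theorem theorem4p2:
  fixes F :: "complex set" and \<alpha> r k n :: nat
    and A :: "complex mat"
    and M :: "'w measure" and \<Omega> :: "'w \<Rightarrow> complex mat"
    and trunc :: "nat \<Rightarrow> complex mat \<Rightarrow> complex mat"
  assumes "F = \<real> \<or> F = UNIV"
    and "\<alpha> = (if F = \<real> then 1 else 0)"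
    and "1 \<le> r" and "r < k" and "k \<le> n"
    and "A \<in> mats_over F n n" and "psd A"
    and "prob_space M"
    and "gaussian_test_matrix F M n k \<Omega> \<or> orthonormal_test_matrix F M n k \<Omega>"
    and "\<And>s B. B \<in> mats_over F n n \<Longrightarrow> best_rank_approx F s B (trunc s B)"
  shows "(\<integral>\<^sup>+ \<omega>. ennreal (schatten_norm 1 (A - trunc r (nystrom A (\<Omega> \<omega>)))) \<partial>M)
           \<le> ennreal (schatten_norm 1 (A - trunc r A) +
               2 * (MIN \<rho>\<in>{\<rho>. \<rho> < k - \<alpha>}. (1 + real \<rho> / (real k - real \<rho> - real \<alpha>)) *
                      schatten_norm 1 (A - trunc \<rho> A)))
       \<and> (\<integral>\<^sup>+ \<omega>. ennreal (schatten_norm \<infinity> (A - trunc r (nystrom A (\<Omega> \<omega>)))) \<partial>M)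
           \<le> ennreal (schatten_norm \<infinity> (A - trunc r A) +
               2 * (MIN \<rho>\<in>{\<rho>. \<rho> < k - \<alpha>}. (1 + real \<rho> / (real k - real \<rho> - real \<alpha>)) *
                      schatten_norm 1 (A - trunc \<rho> A)))"
proof -
  interpret prob_space M by fact
  have RC: "real_or_complex F" using assms(1) by (simp add: real_or_complex_def)
  have h: "mat_adjoint A = A" using assms(7) by (simp add: psd_def)
  have Ac: "A \<in> carrier_mat n n" using assms(6) by (simp add: mats_over_def)
  define b where "b \<rho> = (1 + real \<rho> / (real k - real \<rho> - real \<alpha>)) * schatten_norm 1 (A - trunc \<rho> A)" for \<rho>
  define m where "m = (MIN \<rho>\<in>{\<rho>. \<rho> < k - \<alpha>}. b \<rho>)"
  have "{\<rho>. \<rho> < k - \<alpha>} \<noteq> {}"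
    using assms(2-4) by (auto split: if_splits intro!: exI[of _ 0])
  then have "m \<in> b ` {\<rho>. \<rho> < k - \<alpha>}" unfolding m_def by (intro Min_in) auto
  then obtain \<rho> where \<rho>: "\<rho> < k - \<alpha>" and m: "m = b \<rho>" by auto
  have tA: "best_rank_approx F s A (trunc s A)" for s by (rule assms(10)[OF assms(6)])
  have CF: "trunc \<rho> A \<in> mats_over F n n" and Cr: "mat_rank (trunc \<rho> A) \<le> \<rho>"
    using tA[of \<rho>] Ac by (auto simp: best_rank_approx_def)
  have "\<exists>Z\<in>borel_measurable M.
    (\<forall>\<omega>\<in>space M. ennreal (schatten_norm 1 (A - nystrom A (\<Omega> \<omega>))) \<le> Z \<omega>) \<and> (\<integral>\<^sup>+\<omega>. Z \<omega> \<partial>M) \<le> ennreal m"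
    unfolding m b_def
    by (rule expected_nystrom_error[OF assms(1,2) \<rho> assms(5,6,7,8,9) CF Cr])
  then obtain Z where Zm [measurable]: "Z \<in> borel_measurable M"
    and Z: "\<And>\<omega>. \<omega> \<in> space M \<Longrightarrow> ennreal (schatten_norm 1 (A - nystrom A (\<Omega> \<omega>))) \<le> Z \<omega>"
    and EZ: "(\<integral>\<^sup>+\<omega>. Z \<omega> \<partial>M) \<le> ennreal m" by blast
  have \<Omega>F: "\<Omega> \<omega> \<in> mats_over F n k" if "\<omega> \<in> space M" for \<omega>
    using test_matrix_range[OF RC assms(9)] that by blast
  have main: "(\<integral>\<^sup>+ \<omega>. ennreal (schatten_norm p (A - trunc r (nystrom A (\<Omega> \<omega>)))) \<partial>M)
      \<le> ennreal (schatten_norm p (A - trunc r A) + 2 * m)" if p: "p = 1 \<or> p = \<infinity>" for p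
  proof -
    let ?a = "schatten_norm p (A - trunc r A)"
    have "(\<integral>\<^sup>+ \<omega>. ennreal (schatten_norm p (A - trunc r (nystrom A (\<Omega> \<omega>)))) \<partial>M)
        \<le> (\<integral>\<^sup>+ \<omega>. ennreal ?a + 2 * Z \<omega> \<partial>M)"
    proof (rule nn_integral_mono)
      fix \<omega> assume \<omega>: "\<omega> \<in> space M"
      have N: "nystrom A (\<Omega> \<omega>) \<in> mats_over F n n" by (rule nystrom_over[OF RC assms(6) h \<Omega>F[OF \<omega>]])
      have "ennreal (schatten_norm p (A - trunc r (nystrom A (\<Omega> \<omega>))))
          \<le> ennreal (?a + 2 * schatten_norm 1 (A - nystrom A (\<Omega> \<omega>)))"
        by (rule ennreal_leI[OF truncation_error[OF p assms(6) N tA assms(10)[OF N]]])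
      also have "\<dots> = ennreal ?a + 2 * ennreal (schatten_norm 1 (A - nystrom A (\<Omega> \<omega>)))"
        using schatten_norm_nonneg by (simp add: ennreal_plus ennreal_mult)
      also have "\<dots> \<le> ennreal ?a + 2 * Z \<omega>"
        by (intro add_left_mono mult_left_mono Z[OF \<omega>]) simp
      finally show "ennreal (schatten_norm p (A - trunc r (nystrom A (\<Omega> \<omega>)))) \<le> ennreal ?a + 2 * Z \<omega>" .
    qed
    also have "\<dots> = ennreal ?a + 2 * (\<integral>\<^sup>+\<omega>. Z \<omega> \<partial>M)"
      by (simp add: nn_integral_add nn_integral_cmult emeasure_space_1)
    also have "\<dots> \<le> ennreal ?a + 2 * ennreal m"
      by (intro add_left_mono mult_left_mono EZ) simp
    also have "\<dots> = ennreal (?a + 2 * m)"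
    proof -
      have "0 \<le> m" unfolding m b_def using \<rho> schatten_norm_nonneg by (intro mult_nonneg_nonneg) auto
      then show ?thesis using schatten_norm_nonneg by (simp add: ennreal_plus ennreal_mult)
    qed
    finally show ?thesis .
  qed
  show ?thesis using main[of 1] main[of \<infinity>] by (simp add: m_def b_def)
qed

end
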